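(* Let $\{F_\delta\}_{\delta\in[0,1)}$, $F_\delta=(f_\delta,G_\delta)$, be an admissible $R(\delta)$-perturbation of $F=F_0$, with $\delta_0\in(0,1)$ the constant from the definition of $R(\delta)$-perturbation, and let $\mu_\delta$ be the unique $F_\delta$-invariant probability measure in $S^1$, for each $\delta\in[0,\delta_0)$. Then there exists a constant $B_u>0$ such that $$V(\mu_\delta)\le B_u\qquad\text{for all }\delta\in[0,\delta_0).$$
   Context: **Setting.** $I=[0,1]$ with Euclidean metric $d_1$ and Lebesgue measure $m$; $(K,d_2)$ is a compact metric space with $\mathrm{diam}(K)=1$; $\Sigma=I\times K$ with metric $d_1+d_2$. Maps are $F=(f,G):\Sigma\to\Sigma$, $F(x,y)=(f(x),G(x,y))$, with $f$ and $G$ measurable. $\mathcal P=\{I_i=(a_i,b_i)\}_{i\ge1}$ is a family of disjoint open subintervals of $I$ with $m(I\setminus\bigcup_i I_i)=0$, and $f_i=f|_{I_i}$. **Variation.** For $h:I\to\mathbb R$, $J\subset I$: $V_J(h)=\sup\sum_{i=1}^k|h(x_i)-h(x_{i-1})|$ over finite increasing sequences in $J$. For $h\in L^1_m$, $V(h)$ is the infimum of $V_I(h^* )$ over representatives $h^*$ of $h$; $BV_m=\{h\in L^1_m:V(h)<\infty\}$, $|h|_1=\int|h|\,dm$, $|h|_v=|h|_1+V(h)$. For non-singular $f$ ($f_*m\ll m$), $\mathrm P_f:L^1_m\to L^1_m$ is the Frobenius–Perron operator: $\int h_1\mathrm P_f(h_2)\,dm=\int (h_1\circ f)h_2\,dm$.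 **Piecewise convex map** (on $\mathcal P$): (1) each $f_i$ is increasing, convex, differentiable, $\lim_{x\to a_i^+}f_i(x)=0$ (and $f_i'(a_i)$ is defined by right-continuity); (2) $\sum_i 1/f_i'(a_i)<\infty$; (3) if $0$ is not a limit point of $\{a_i\}$ then $f'(0)=1/\beta>1$ for some $0<\beta<1$. **Piecewise expanding map** (on $\mathcal P$): each $f|_{I_i}$ extends to a homeomorphism $f_i:[a_i,b_i]\to f_i([a_i,b_i])$, and $g(x)=1/|f_i'(x)|$ for $x\in I_i$, $g=0$ elsewhere, satisfies $\sup g\le\beta<1$. **Pre-piecewise convex or expanding map** (on $\mathcal P$): (1) for some $n_0\in\mathbb N$ there is a countable family $\{J_j=(c_j,d_j)\}_{j\ge1}$ of disjoint open subintervals of $I$ with $m(I\setminus\bigcup_jJ_j)=0$ (the countable partition corresponding to $f^{n_0}$) on which the iterate $\tau=f^{n_0}$, with branches $\tau_j=\tau|_{J_j}$, is either a piecewise convex map, i.e. each $\tau_j$ is increasing, convex, differentiable with $\lim_{x\to c_j^+}\tau_j(x)=0$, $\sum_j1/\tau_j'(c_j)<\infty$ (with $\tau_j'(c_j)$ defined by right-continuity), and if $0$ is not a limit point of $\{c_j\}$ then $\tau'(0)=1/\beta>1$ for some $0<\beta<1$; or a piecewise expanding map, i.e. each $\tau_j$ extends to a homeomorphism of $[c_j,d_j]$ onto its image, and the function equal to $1/|\tau_j'(x)|$ for $x\in J_j$ and to $0$ elsewhere has supremum $\le\beta<1$; (2) $f$ is non-singular; (3) $\mathrm P_f:BV_m\to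 BV_m$ is bounded; (4) there is $h_1\in BV_m$ with $\mathrm P_f h_1=h_1$ and $m_1=h_1m$ a mixing probability measure. **Fiber conditions.** (H1) There is $0\le\alpha<1$ such that for $m$-a.e. $x$: $d_2(G(x,z_1),G(x,z_2))\le\alpha d_2(z_1,z_2)$ for all $z_1,z_2\in K$. (H2) $|G|_{\mathrm{Lip}}:=\sup_s|G_s|_{\mathrm{Lip}}<\infty$, where $|G_s|_{\mathrm{Lip}}=\sup_{y\in K}\sup_{x_1\ne x_2\in I_s}d_2(G(x_1,y),G(x_2,y))/d_1(x_1,x_2)$. (H3) For some $k\in\mathbb N$, writing $F^k=(f^k,G_k)$: $\alpha^k\cdot\operatorname{ess\,sup}_m\frac1{|(f^k)'|}<1$, and $G_k$ satisfies (H1) with rate $\alpha^k$ and (H2) (with respect to the partition of $f^k$). **$R(\delta)$-perturbation.** $\{F_\delta\}_{\delta\in[0,1)}$, $F_0=F$, is an $R(\delta)$-perturbation of $F$ if there is $\delta_0\in(0,1)$ such that: (U1) for all $\delta\in[0,\delta_0)$, $f_\delta$ is pre-piecewise convex or expanding for the same partition $\mathcal P$; moreover $f_\delta(I_i)=f_0(I_i)$ for all $i,\delta$; (U2) writing $\gamma_{\delta,i}$ for the $i$-th pre-image of $\gamma\in I$ under $f_\delta$ (the pre-image in $I_i$), there is $\delta\mapsto R(\delta)\in\mathbb R^+$ with $\lim_{\delta\to0^+}R(\delta)\log\delta=0$ and, for all $\delta\in[0,\delta_0)$: (U2.1) $\sum_i\left|\frac1{f_\delta'(\gamma_{\delta,i})}-\frac1{f_0'(\gamma_{0,i})}\right|\le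 R(\delta)$ for every $\gamma$; (U2.2) $\operatorname{ess\,sup}_\gamma\max_i d_1(\gamma_{0,i},\gamma_{\delta,i})\le R(\delta)$; (U2.3) $d_2(G_0(x,y),G_\delta(x,y))\le R(\delta)$ for all $(x,y)$. (Terms with $\gamma\notin f_0(I_i)$ are omitted.) **Admissible.** It is admissible if: (A1) there are $D>0$, $0<\lambda<1$ with $|\mathrm P_{f_\delta}^nh|_v\le D\lambda^n|h|_v+D|h|_1$ for all $h\in BV_m$, $\delta\in[0,\delta_0)$, $n\ge1$; (A2) for all $\delta\in[0,\delta_0)$, $G_\delta$ satisfies (H1) with rate $\alpha_\delta$, (H2), and (H3) with some common $k$, and with $\alpha_{4,\delta}:=\alpha_\delta^k\operatorname{ess\,sup}\frac1{|(f_\delta^k)'|}$ and $U_{4,\delta}:=|G_\delta|_{\mathrm{Lip}}\operatorname{ess\,sup}\frac1{|(f_\delta^k)'|}+V_I\!\left(\frac1{|(f_\delta^k)'|}\right)$ one has $\sup_\delta\alpha_{4,\delta}<1$ and $\sup_\delta U_{4,\delta}<\infty$. **Measures.** $\pi_1,\pi_2$ are the projections of $\Sigma$ to $I$, $K$. $\mathcal{AB}$ is the set of signed Borel measures $\mu=\mu^+-\mu^-$ (Jordan decomposition) on $\Sigma$ with $\pi_{1*}\mu^\pm\ll m$; $\phi_1=d(\pi_{1*}\mu)/dm$. A positive $\mu\in\mathcal{AB}$ has a Rokhlin disintegration $\omega=(\{\mu_\gamma\}_\gamma,\phi_1)$ along the fibers $\{\gamma\}\times K$, $\gamma\in I$ (a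 fiber is identified with its base point), with $\mu_\gamma$ probabilities; its restriction is the measure on $K$ $\mu|_\gamma=\pi_{2*}(\phi_1(\gamma)\mu_\gamma)$. For signed $\mu$, $\mu|_\gamma=\mu^+|_\gamma-\mu^-|_\gamma$. For signed measures on $K$, $W_1(\mu,\nu)=\sup\{|\int h\,d\mu-\int h\,d\nu|: L(h)\le1,|h|_\infty\le1\}$, $L(h)$ the Lipschitz constant, $\|\mu\|_W=W_1(0,\mu)$. $\mathcal L^1=\{\mu\in\mathcal{AB}:\|\mu\|_1:=\int\|\mu|_\gamma\|_W\,dm(\gamma)<\infty\}$, $S^1=\{\mu\in\mathcal L^1:\phi_1\in BV_m\}$ with $\|\mu\|_{S^1}=|\phi_1|_v+\|\mu\|_1$. For a disintegration $\omega$ of $\mu$, defined on a full measure set $I_\omega\subset I$, the path $\Gamma^\omega_\mu:I_\omega\to\{\text{signed measures on }K\}$ is $\Gamma_\mu^\omega(\gamma)=\mu|_\gamma$; $V_{I_\omega}(\Gamma_\mu^\omega)=\sup\sum_i\|\Gamma_\mu^\omega(x_{i+1})-\Gamma_\mu^\omega(x_i)\|_W$ over finite increasing sequences in $I_\omega$; $V(\mu)=V_I(\mu)=\inf_\omega V_{I_\omega}(\Gamma_\mu^\omega)$. *)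

theory Defs
  imports "HOL-Probability.Probability"
begin

section \<open>Lebesgue measure on the unit interval and partitions\<close>

definition mI :: "real measure" where
  "mI = restrict_space lborel {0..1}"

text \<open>An open interval is encoded by the pair of its end points, so a countable family of
  intervals is a countable set of pairs (possibly finite).\<close>

definition ival :: "real \<times> real \<Rightarrow> real set" where
  "ival i = {fst i <..< snd i}"

definition interval_partition :: "(real \<times> real) set \<Rightarrow> bool" where
  "interval_partition P \<longleftrightarrow>
     countable P \<and> (\<forall>i\<in>P. 0 \<le> fst i \<and> fst i < snd i \<and> snd i \<le> 1) \<and>
     disjoint_family_on ival P \<and> emeasure lborel ({0..1} - (\<Union>i\<in>P. ival i)) = 0"

text \<open>The partition belonging to \<open>f ^^ k\<close> (for \<open>k \<ge> 1\<close>): the nonempty cylinders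
  \<open>I\<^sub>0 \<inter> f\<inverse>(I\<^sub>1) \<inter> \<dots>\<close> of length \<open>k\<close>, which are open intervals as soon as
  \<open>f\<close> is continuous and injective on every element of \<open>P\<close>.\<close>

definition iter_partition :: "(real \<Rightarrow> real) \<Rightarrow> (real \<times> real) set \<Rightarrow> nat \<Rightarrow> (real \<times> real) set" where
  "iter_partition f P k =
     {i. fst i < snd i \<and>
         (\<exists>s :: nat \<Rightarrow> real \<times> real. (\<forall>l<k. s l \<in> P) \<and>
            ival i = {x\<in>{0..1}. \<forall>l<k. (f ^^ l) x \<in> ival (s l)})}"

definition inv_deriv :: "(real \<times> real) set \<Rightarrow> (real \<Rightarrow> real) \<Rightarrow> real \<Rightarrow> real" where
  "inv_deriv Q \<tau> x = (if x \<in> (\<Union>i\<in>Q. ival i) then 1 / \<bar>deriv \<tau> x\<bar> else 0)"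


section \<open>Bounded variation\<close>

definition variation_wrt :: "('a \<Rightarrow> 'a \<Rightarrow> ennreal) \<Rightarrow> real set \<Rightarrow> (real \<Rightarrow> 'a) \<Rightarrow> ennreal" where
  "variation_wrt d J h =
     (SUP xs\<in>{xs. sorted_wrt (<) xs \<and> set xs \<subseteq> J}.
        \<Sum>i<length xs - 1. d (h (xs ! i)) (h (xs ! Suc i)))"

definition variation_on :: "real set \<Rightarrow> (real \<Rightarrow> real) \<Rightarrow> ennreal" where
  "variation_on J h = variation_wrt (\<lambda>u v. ennreal \<bar>u - v\<bar>) J h"

definition ess_variation :: "(real \<Rightarrow> real) \<Rightarrow> ennreal" where
  "ess_variation h = (INF h'\<in>{h'. AE x in mI. h' x = h x}. variation_on {0..1} h')"

definition L1_norm :: "(real \<Rightarrow> real) \<Rightarrow> ennreal" where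
  "L1_norm h = (\<integral>\<^sup>+x. ennreal \<bar>h x\<bar> \<partial>mI)"

definition BV_norm :: "(real \<Rightarrow> real) \<Rightarrow> ennreal" where
  "BV_norm h = L1_norm h + ess_variation h"

definition BV :: "(real \<Rightarrow> real) set" where
  "BV = {h. integrable mI h \<and> ess_variation h < \<infinity>}"


section \<open>The Frobenius-Perron operator\<close>

definition nonsingular :: "(real \<Rightarrow> real) \<Rightarrow> bool" where
  "nonsingular f \<longleftrightarrow> absolutely_continuous mI (distr mI mI f)"

text \<open>For nonsingular \<open>f\<close> and integrable \<open>h\<close> a function as below exists and is unique
  almost everywhere; a representative of this class is chosen.\<close>

definition PF :: "(real \<Rightarrow> real) \<Rightarrow> (real \<Rightarrow> real) \<Rightarrow> (real \<Rightarrow> real)" where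
  "PF f h = (SOME h'. integrable mI h' \<and>
     (\<forall>u\<in>borel_measurable mI. (\<exists>C. \<forall>x\<in>{0..1}. \<bar>u x\<bar> \<le> C) \<longrightarrow>
        (\<integral>x. u x * h' x \<partial>mI) = (\<integral>x. u (f x) * h x \<partial>mI)))"

definition PF_bounded_on_BV :: "(real \<Rightarrow> real) \<Rightarrow> bool" where
  "PF_bounded_on_BV f \<longleftrightarrow>
     (\<exists>C\<ge>0. \<forall>h\<in>BV. PF f h \<in> BV \<and> BV_norm (PF f h) \<le> ennreal C * BV_norm h)"

definition mixing :: "real measure \<Rightarrow> (real \<Rightarrow> real) \<Rightarrow> bool" where
  "mixing M f \<longleftrightarrow>
     (\<forall>A\<in>sets M. \<forall>B\<in>sets M.
        (\<lambda>n. measure M (((f ^^ n) -` A \<inter> space M) \<inter> B)) \<longlonglongrightarrow> measure M A * measure M B)"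


section \<open>Classes of interval maps\<close>

text \<open>The value of the derivative at a left end point, defined by right-continuity.\<close>

definition rderiv :: "(real \<Rightarrow> real) \<Rightarrow> real \<Rightarrow> real" where
  "rderiv \<tau> a = Lim (at_right a) (deriv \<tau>)"

definition piecewise_convex :: "(real \<times> real) set \<Rightarrow> (real \<Rightarrow> real) \<Rightarrow> bool" where
  "piecewise_convex Q \<tau> \<longleftrightarrow>
     (\<forall>i\<in>Q. strict_mono_on (ival i) \<tau> \<and> convex_on (ival i) \<tau> \<and>
            (\<forall>x\<in>ival i. \<tau> differentiable (at x)) \<and>
            (\<tau> \<longlongrightarrow> 0) (at_right (fst i)) \<and> 0 < rderiv \<tau> (fst i)) \<and>
     (\<lambda>i. 1 / rderiv \<tau> (fst i)) summable_on Q \<and>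
     (\<not> 0 islimpt (fst ` Q) \<longrightarrow> (\<exists>\<beta>. 0 < \<beta> \<and> \<beta> < 1 \<and> rderiv \<tau> 0 = 1 / \<beta>))"

definition piecewise_expanding :: "(real \<times> real) set \<Rightarrow> (real \<Rightarrow> real) \<Rightarrow> bool" where
  "piecewise_expanding Q \<tau> \<longleftrightarrow>
     (\<forall>i\<in>Q. (\<exists>\<tau>' \<sigma>. (\<forall>x\<in>ival i. \<tau>' x = \<tau> x) \<and>
                  homeomorphism {fst i..snd i} (\<tau>' ` {fst i..snd i}) \<tau>' \<sigma>) \<and>
            (\<forall>x\<in>ival i. \<tau> differentiable (at x) \<and> deriv \<tau> x \<noteq> 0)) \<and>
     (\<exists>\<beta><1. \<forall>x\<in>{0..1}. inv_deriv Q \<tau> x \<le> \<beta>)"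

text \<open>What is needed for the \<open>i\<close>-th pre-image of a point and for the numbers
  \<open>1 / f'\<close> on the elements of the partition to make sense.\<close>

definition regular_branches :: "(real \<times> real) set \<Rightarrow> (real \<Rightarrow> real) \<Rightarrow> bool" where
  "regular_branches P f \<longleftrightarrow>
     (\<forall>i\<in>P. inj_on f (ival i) \<and> (\<forall>x\<in>ival i. f differentiable (at x) \<and> deriv f x \<noteq> 0))"

definition pre_piecewise_convex_or_expanding :: "(real \<times> real) set \<Rightarrow> (real \<Rightarrow> real) \<Rightarrow> bool" where
  "pre_piecewise_convex_or_expanding P f \<longleftrightarrow>
     regular_branches P f \<and>
     (\<exists>n\<^sub>0\<ge>1. \<exists>Q. interval_partition Q \<and>
        (piecewise_convex Q (f ^^ n\<^sub>0) \<or> piecewise_expanding Q (f ^^ n\<^sub>0))) \<and>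
     nonsingular f \<and>
     PF_bounded_on_BV f \<and>
     (\<exists>h\<in>BV. (AE x in mI. 0 \<le> h x) \<and> (AE x in mI. PF f h x = h x) \<and>
        prob_space (density mI (\<lambda>x. ennreal (h x))) \<and>
        mixing (density mI (\<lambda>x. ennreal (h x))) f)"


section \<open>Skew products and the conditions on the fibers\<close>

text \<open>The Borel space \<open>[0,1] \<times> K\<close>. The metric \<open>d\<^sub>1 + d\<^sub>2\<close> induces the product topology.\<close>

definition SigmaM :: "(real \<times> 'k::topological_space) measure" where
  "SigmaM = restrict_space borel ({0..1} \<times> UNIV)"

definition skew :: "(real \<Rightarrow> real) \<Rightarrow> (real \<Rightarrow> 'k \<Rightarrow> 'k) \<Rightarrow> real \<times> 'k \<Rightarrow> real \<times> 'k" where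
  "skew f G = (\<lambda>(x, y). (f x, G x y))"

definition skew_product :: "(real \<Rightarrow> real) \<Rightarrow> (real \<Rightarrow> 'k::metric_space \<Rightarrow> 'k) \<Rightarrow> bool" where
  "skew_product f G \<longleftrightarrow>
     f \<in> measurable mI mI \<and> (\<lambda>(x, y). G x y) \<in> measurable SigmaM borel"

definition fiber_iter :: "(real \<Rightarrow> real) \<Rightarrow> (real \<Rightarrow> 'k \<Rightarrow> 'k) \<Rightarrow> nat \<Rightarrow> real \<Rightarrow> 'k \<Rightarrow> 'k" where
  "fiber_iter f G k x y = snd ((skew f G ^^ k) (x, y))"

definition H1 :: "real \<Rightarrow> (real \<Rightarrow> 'k::metric_space \<Rightarrow> 'k) \<Rightarrow> bool" where
  "H1 \<alpha> G \<longleftrightarrow> 0 \<le> \<alpha> \<and> \<alpha> < 1 \<and>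
     (AE x in mI. \<forall>z1 z2. dist (G x z1) (G x z2) \<le> \<alpha> * dist z1 z2)"

definition lip_G :: "(real \<times> real) set \<Rightarrow> (real \<Rightarrow> 'k::metric_space \<Rightarrow> 'k) \<Rightarrow> ennreal" where
  "lip_G P G =
     (SUP s\<in>P. SUP y. SUP (x1, x2)\<in>{(x1, x2). x1 \<in> ival s \<and> x2 \<in> ival s \<and> x1 \<noteq> x2}.
        ennreal (dist (G x1 y) (G x2 y) / dist x1 x2))"

definition H2 :: "(real \<times> real) set \<Rightarrow> (real \<Rightarrow> 'k::metric_space \<Rightarrow> 'k) \<Rightarrow> bool" where
  "H2 P G \<longleftrightarrow> lip_G P G < \<infinity>"

definition iter_inv_deriv :: "(real \<times> real) set \<Rightarrow> (real \<Rightarrow> real) \<Rightarrow> nat \<Rightarrow> real \<Rightarrow> real" where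
  "iter_inv_deriv P f k = inv_deriv (iter_partition f P k) (f ^^ k)"

definition alpha4 :: "(real \<times> real) set \<Rightarrow> (real \<Rightarrow> real) \<Rightarrow> nat \<Rightarrow> real \<Rightarrow> ennreal" where
  "alpha4 P f k \<alpha> = ennreal (\<alpha> ^ k) * esssup mI (\<lambda>x. ennreal (iter_inv_deriv P f k x))"

definition U4 ::
  "(real \<times> real) set \<Rightarrow> (real \<Rightarrow> real) \<Rightarrow> (real \<Rightarrow> 'k::metric_space \<Rightarrow> 'k) \<Rightarrow> nat \<Rightarrow> ennreal" where
  "U4 P f G k =
     lip_G P G * esssup mI (\<lambda>x. ennreal (iter_inv_deriv P f k x)) +
     variation_on {0..1} (iter_inv_deriv P f k)"

definition H3 ::
  "(real \<times> real) set \<Rightarrow> (real \<Rightarrow> real) \<Rightarrow> (real \<Rightarrow> 'k::metric_space \<Rightarrow> 'k) \<Rightarrow> real \<Rightarrow> nat \<Rightarrow> bool" where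
  "H3 P f G \<alpha> k \<longleftrightarrow> 1 \<le> k \<and> alpha4 P f k \<alpha> < 1 \<and>
     H1 (\<alpha> ^ k) (fiber_iter f G k) \<and> H2 (iter_partition f P k) (fiber_iter f G k)"


section \<open>Perturbations\<close>

definition preim :: "(real \<Rightarrow> real) \<Rightarrow> real \<times> real \<Rightarrow> real \<Rightarrow> real" where
  "preim f i \<gamma> = the_inv_into (ival i) f \<gamma>"

definition R_perturbation ::
  "(real \<times> real) set \<Rightarrow> (real \<Rightarrow> real \<Rightarrow> real) \<Rightarrow> (real \<Rightarrow> real \<Rightarrow> 'k::metric_space \<Rightarrow> 'k) \<Rightarrow> real \<Rightarrow> bool"
where
  "R_perturbation P f G \<delta>\<^sub>0 \<longleftrightarrow>
     0 < \<delta>\<^sub>0 \<and> \<delta>\<^sub>0 < 1 \<and>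
     (\<forall>\<delta>\<in>{0..<\<delta>\<^sub>0}. pre_piecewise_convex_or_expanding P (f \<delta>) \<and>
        (\<forall>i\<in>P. f \<delta> ` ival i = f 0 ` ival i)) \<and>
     (\<exists>R :: real \<Rightarrow> real. (\<forall>\<delta>. 0 \<le> R \<delta>) \<and> ((\<lambda>\<delta>. R \<delta> * ln \<delta>) \<longlongrightarrow> 0) (at_right 0) \<and>
        (\<forall>\<delta>\<in>{0..<\<delta>\<^sub>0}.
           (\<forall>\<gamma>\<in>{0..1}.
              (\<Sum>\<^sub>\<infinity>i\<in>{i\<in>P. \<gamma> \<in> f 0 ` ival i}.
                 ennreal \<bar>1 / deriv (f \<delta>) (preim (f \<delta>) i \<gamma>) - 1 / deriv (f 0) (preim (f 0) i \<gamma>)\<bar>)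
              \<le> ennreal (R \<delta>)) \<and>
           esssup mI (\<lambda>\<gamma>. SUP i\<in>{i\<in>P. \<gamma> \<in> f 0 ` ival i}.
                 ennreal (dist (preim (f 0) i \<gamma>) (preim (f \<delta>) i \<gamma>))) \<le> ennreal (R \<delta>) \<and>
           (\<forall>x\<in>{0..1}. \<forall>y. dist (G 0 x y) (G \<delta> x y) \<le> R \<delta>)))"

definition admissible ::
  "(real \<times> real) set \<Rightarrow> (real \<Rightarrow> real \<Rightarrow> real) \<Rightarrow> (real \<Rightarrow> real \<Rightarrow> 'k::metric_space \<Rightarrow> 'k) \<Rightarrow> real \<Rightarrow> bool"
where
  "admissible P f G \<delta>\<^sub>0 \<longleftrightarrow>
     (\<exists>D q. 0 < D \<and> 0 < q \<and> q < 1 \<and>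
        (\<forall>h\<in>BV. \<forall>\<delta>\<in>{0..<\<delta>\<^sub>0}. \<forall>n\<ge>1.
           BV_norm ((PF (f \<delta>) ^^ n) h) \<le> ennreal (D * q ^ n) * BV_norm h + ennreal D * L1_norm h)) \<and>
     (\<exists>k \<alpha>.
        (\<forall>\<delta>\<in>{0..<\<delta>\<^sub>0}. H1 (\<alpha> \<delta>) (G \<delta>) \<and> H2 P (G \<delta>) \<and> H3 P (f \<delta>) (G \<delta>) (\<alpha> \<delta>) k) \<and>
        (SUP \<delta>\<in>{0..<\<delta>\<^sub>0}. alpha4 P (f \<delta>) k (\<alpha> \<delta>)) < 1 \<and>
        (SUP \<delta>\<in>{0..<\<delta>\<^sub>0}. U4 P (f \<delta>) (G \<delta>) k) < \<infinity>)"


section \<open>Signed measures, disintegrations and the spaces of measures\<close>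

text \<open>A pair of finite measures stands for the difference of its components. The Jordan
  decomposition is the unique such pair with mutually singular components.\<close>

type_synonym 'a smeasure = "'a measure \<times> 'a measure"

definition jordan_pair :: "'a measure \<Rightarrow> 'a smeasure \<Rightarrow> bool" where
  "jordan_pair M \<mu> \<longleftrightarrow>
     finite_measure (fst \<mu>) \<and> finite_measure (snd \<mu>) \<and>
     sets (fst \<mu>) = sets M \<and> sets (snd \<mu>) = sets M \<and>
     (\<exists>A\<in>sets M. emeasure (fst \<mu>) (space M - A) = 0 \<and> emeasure (snd \<mu>) A = 0)"

definition of_positive :: "'a measure \<Rightarrow> 'a smeasure" where
  "of_positive \<mu> = (\<mu>, null_measure \<mu>)"

definition sintegral :: "'a smeasure \<Rightarrow> ('a \<Rightarrow> real) \<Rightarrow> real" where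
  "sintegral \<mu> h = (\<integral>y. h y \<partial>fst \<mu>) - (\<integral>y. h y \<partial>snd \<mu>)"

definition W1 :: "'k::metric_space smeasure \<Rightarrow> 'k smeasure \<Rightarrow> ennreal" where
  "W1 \<mu> \<nu> = (SUP h\<in>{h. 1-lipschitz_on UNIV h \<and> (\<forall>y. \<bar>h y\<bar> \<le> 1)}.
     ennreal \<bar>sintegral \<mu> h - sintegral \<nu> h\<bar>)"

definition normW :: "'k::metric_space smeasure \<Rightarrow> ennreal" where
  "normW \<mu> = W1 (null_measure borel, null_measure borel) \<mu>"

definition AB :: "(real \<times> 'k::metric_space) smeasure set" where
  "AB = {\<mu>. jordan_pair SigmaM \<mu> \<and>
     absolutely_continuous mI (distr (fst \<mu>) mI fst) \<and>
     absolutely_continuous mI (distr (snd \<mu>) mI fst)}"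

definition phi1 :: "(real \<times> 'k::metric_space) smeasure \<Rightarrow> real \<Rightarrow> real" where
  "phi1 \<mu> x = enn2real (RN_deriv mI (distr (fst \<mu>) mI fst) x)
            - enn2real (RN_deriv mI (distr (snd \<mu>) mI fst) x)"

text \<open>\<open>(\<kappa>, \<phi>)\<close> is a Rokhlin disintegration of the positive measure \<open>\<nu>\<close> along the fibers
  \<open>{\<gamma>} \<times> K\<close>, defined on the set \<open>J\<close> of full measure.\<close>

definition disintegrates ::
  "(real \<times> 'k::metric_space) measure \<Rightarrow> real set \<Rightarrow> (real \<Rightarrow> (real \<times> 'k) measure) \<Rightarrow> (real \<Rightarrow> real) \<Rightarrow> bool"
where
  "disintegrates \<nu> J \<kappa> \<phi> \<longleftrightarrow>
     J \<in> sets mI \<and> emeasure mI (space mI - J) = 0 \<and>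
     \<phi> \<in> borel_measurable mI \<and> (\<forall>\<gamma>\<in>J. 0 \<le> \<phi> \<gamma>) \<and>
     density mI (\<lambda>\<gamma>. ennreal (\<phi> \<gamma>)) = distr \<nu> mI fst \<and>
     (\<forall>\<gamma>\<in>J. prob_space (\<kappa> \<gamma>) \<and> sets (\<kappa> \<gamma>) = sets SigmaM \<and>
             emeasure (\<kappa> \<gamma>) ({\<gamma>} \<times> UNIV) = 1) \<and>
     (\<forall>E\<in>sets SigmaM.
        (\<lambda>\<gamma>. emeasure (\<kappa> \<gamma>) E) \<in> borel_measurable (restrict_space mI J) \<and>
        emeasure \<nu> E = (\<integral>\<^sup>+\<gamma>\<in>J. emeasure (\<kappa> \<gamma>) E \<partial>distr \<nu> mI fst))"

definition fiber_restriction ::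
  "(real \<Rightarrow> (real \<times> 'k::metric_space) measure) \<Rightarrow> (real \<Rightarrow> real) \<Rightarrow> real \<Rightarrow> 'k measure" where
  "fiber_restriction \<kappa> \<phi> \<gamma> = distr (scale_measure (ennreal (\<phi> \<gamma>)) (\<kappa> \<gamma>)) borel snd"

text \<open>All pairs \<open>(J, \<Gamma>)\<close> of a domain and a path of signed measures
  \<open>\<Gamma> \<gamma> = \<mu>\<^sup>+|\<^sub>\<gamma> - \<mu>\<^sup>-|\<^sub>\<gamma>\<close> that are obtained from disintegrations of \<open>\<mu>\<close>.\<close>

definition disintegration_paths ::
  "(real \<times> 'k::metric_space) smeasure \<Rightarrow> (real set \<times> (real \<Rightarrow> 'k smeasure)) set" where
  "disintegration_paths \<mu> =
     {(J, \<lambda>\<gamma>. (fiber_restriction \<kappa>\<^sub>p \<phi>\<^sub>p \<gamma>, fiber_restriction \<kappa>\<^sub>n \<phi>\<^sub>n \<gamma>)) | J \<kappa>\<^sub>p \<phi>\<^sub>p \<kappa>\<^sub>n \<phi>\<^sub>n.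
        disintegrates (fst \<mu>) J \<kappa>\<^sub>p \<phi>\<^sub>p \<and> disintegrates (snd \<mu>) J \<kappa>\<^sub>n \<phi>\<^sub>n}"

text \<open>The integral does not depend on the disintegration, since the restrictions are unique
  for almost every \<open>\<gamma>\<close>; the infimum only selects this common value.\<close>

definition norm1 :: "(real \<times> 'k::metric_space) smeasure \<Rightarrow> ennreal" where
  "norm1 \<mu> = (INF (J, \<Gamma>)\<in>disintegration_paths \<mu>. \<integral>\<^sup>+\<gamma>\<in>J. normW (\<Gamma> \<gamma>) \<partial>mI)"

definition S1 :: "(real \<times> 'k::metric_space) smeasure set" where
  "S1 = {\<mu>\<in>AB. norm1 \<mu> < \<infinity> \<and> phi1 \<mu> \<in> BV}"

text \<open>For signed measures on \<open>K\<close>, \<open>\<parallel>\<mu> - \<nu>\<parallel>\<^sub>W = W1 \<mu> \<nu>\<close>.\<close>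

definition measure_variation :: "(real \<times> 'k::metric_space) smeasure \<Rightarrow> ennreal" where
  "measure_variation \<mu> = (INF (J, \<Gamma>)\<in>disintegration_paths \<mu>. variation_wrt W1 J \<Gamma>)"

definition invariant_probability ::
  "(real \<Rightarrow> real) \<Rightarrow> (real \<Rightarrow> 'k::metric_space \<Rightarrow> 'k) \<Rightarrow> (real \<times> 'k) measure \<Rightarrow> bool" where
  "invariant_probability f G \<mu> \<longleftrightarrow>
     prob_space \<mu> \<and> sets \<mu> = sets SigmaM \<and> distr \<mu> SigmaM (skew f G) = \<mu>"

end

theory Submission
  imports Defs
begin

text \<open>
  For one \<open>\<delta>\<close> write \<open>\<tau> = f\<^sub>\<delta>\<^sup>k\<close>, let \<open>Q\<close>
  be the partition into cylinders of length \<open>k\<close>, let \<open>g = 1 / \<bar>\<tau>'\<bar>\<close>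
  on the cylinders and \<open>g = 0\<close> elsewhere, and let \<open>H\<close> be the fiber map of the
  \<open>k\<close>-th iterate of the skew product. Let \<open>\<phi>\<close> be the density of the projection
  of \<open>\<mu>\<^sub>\<delta>\<close> to the base and \<open>\<gamma>\<^sub>i\<close> the preimage of
  \<open>\<gamma>\<close> in the \<open>i\<close>-th cylinder. Invariance of
  \<open>\<mu>\<^sub>\<delta>\<close> makes its path of fiber restrictions a fixed point of the operator
  \<open>(L \<Gamma>)(\<gamma>)(h) = (\<Sum>i. g \<gamma>\<^sub>i * \<Gamma>(\<gamma>\<^sub>i)(h \<circ> H
  \<gamma>\<^sub>i))\<close>, where measures on the fiber are identified with functionals on test functions
  \<open>h\<close>.

  The operator \<open>L\<close> satisfies a Lasota-Yorke inequality for the variation of paths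
  (\<open>variation_step\<close>). When \<open>\<gamma>\<close> moves, each branch contributes three changes.
  The change of \<open>g\<close> costs \<open>sup \<phi>\<close> times the variation of \<open>g\<close>;
  since \<open>g\<close> is \<open>0\<close> at the end points of the cylinders, this also pays for branches
  whose image does not contain one of two consecutive points. The change of the fiber map costs a constant
  times the distance on the base. The change of \<open>\<Gamma>\<close> is multiplied by \<open>g\<close> and
  by the contraction rate \<open>\<alpha>\<^sup>k\<close> of \<open>H\<close>, because \<open>h \<circ> H
  \<gamma>\<^sub>i\<close> is a constant plus \<open>\<alpha>\<^sup>k\<close> times a test function, and the
  constant only sees \<open>\<phi>\<close>. So the variation of \<open>L \<Gamma>\<close> is at most
  \<open>\<alpha>\<^sup>k * ess sup g\<close> times that of \<open>\<Gamma>\<close> plus a constant, and the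
  factor is smaller than \<open>1\<close>.

  The inequality says nothing about a path of infinite variation, so it is not applied to the path of
  \<open>\<mu>\<^sub>\<delta>\<close>. It is applied to the iterates of \<open>L\<close> on the path
  \<open>\<gamma> \<mapsto> \<phi> \<gamma>\<close> times the point mass at a fixed \<open>y0\<close>. Their
  variation is bounded uniformly (\<open>uniform_variation\<close>), and by contraction of the fibers the
  \<open>n\<close>-th one is within \<open>\<alpha>\<^sup>k\<^sup>n * \<phi> \<gamma>\<close> of the path of
  \<open>\<mu>\<^sub>\<delta>\<close> for almost every \<open>\<gamma>\<close>
  (\<open>approximation_by_iterates\<close>). Variation is lower semicontinuous under this convergence, which
  gives the bound for \<open>\<mu>\<^sub>\<delta>\<close> on a set of full measure
  (\<open>measure_variation_invariant_le\<close>).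

  It remains to see that the constants do not depend on \<open>\<delta>\<close>. Iterating the Lasota-Yorke
  inequality of the base maps on \<open>\<phi>\<close> bounds the variation and the supremum of
  \<open>\<phi>\<close> (\<open>BV_norm_fixed_le\<close>). Iterating it on the constant \<open>1\<close>
  bounds the densities of all the images of Lebesgue measure, hence \<open>m (f\<^sup>-\<^sup>n E) \<le> c * m
  E\<close> (\<open>measure_preimage_le\<close>), and applied to the image \<open>E\<close> of an interval
  this yields \<open>\<bar>x - y\<bar> \<le> c * \<bar>f\<^sup>n x - f\<^sup>n y\<bar>\<close> on cylinders
  (\<open>expansion_on_cylinder\<close>). That in turn controls the Lipschitz constant of the iterated fiber
  map, relative to distances after \<open>k\<close> steps, by the one of \<open>G\<^sub>\<delta>\<close>
  (\<open>fiber_iterate_lipschitz\<close>). Finally the Lipschitz constant of \<open>G\<^sub>\<delta>\<close>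
  is bounded because its product with \<open>ess sup g\<close> is, while \<open>ess sup g\<close> is bounded
  below: finitely many elements of the partition carry nearly all the mass, so that some
  \<open>k\<close>-cylinder has length at least \<open>len0\<close> for every \<open>\<delta>\<close>
  (\<open>long_cylinder\<close>), and its image has length at most \<open>1\<close>
  (\<open>length_le_esssup\<close>).
\<close>

section \<open>Variation and monotone majorants\<close>

lemma chain_sum_snoc:
  fixes F :: "'a \<Rightarrow> 'a \<Rightarrow> 'b::comm_monoid_add"
  assumes "xs \<noteq> []"
  shows "(\<Sum>i<length (xs @ [y]) - 1. F ((xs @ [y]) ! i) ((xs @ [y]) ! Suc i)) =
         (\<Sum>i<length xs - 1. F (xs ! i) (xs ! Suc i)) + F (last xs) y"
proof -
  obtain n where n: "length xs = Suc n" using assms by (cases xs) auto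
  have "(\<Sum>i<length (xs @ [y]) - 1. F ((xs @ [y]) ! i) ((xs @ [y]) ! Suc i)) =
        (\<Sum>i<n. F ((xs @ [y]) ! i) ((xs @ [y]) ! Suc i)) + F ((xs @ [y]) ! n) ((xs @ [y]) ! Suc n)"
    by (simp add: n)
  moreover have "(\<Sum>i<n. F ((xs @ [y]) ! i) ((xs @ [y]) ! Suc i)) = (\<Sum>i<n. F (xs ! i) (xs ! Suc i))"
    by (rule sum.cong) (auto simp: nth_append n)
  moreover have "(xs @ [y]) ! n = last xs" "(xs @ [y]) ! Suc n = y"
    using assms by (auto simp: nth_append n last_conv_nth)
  ultimately show ?thesis by (simp add: n)
qed

lemma pair_le_variation:
  assumes "x \<in> J" "y \<in> J" "x < y"
  shows "d (h x) (h y) \<le> variation_wrt d J h"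
  unfolding variation_wrt_def
  by (rule SUP_upper2[of "[x, y]"]) (use assms in \<open>auto simp: lessThan_Suc\<close>)

lemma variation_wrt_mono: "J \<subseteq> J' \<Longrightarrow> variation_wrt d J h \<le> variation_wrt d J' h"
  unfolding variation_wrt_def by (rule SUP_subset_mono) auto

text \<open>
  The majorant is the variation on the part of \<open>J\<close> to the left of \<open>x\<close>, which grows
  by at least \<open>\<bar>h x - h y\<bar>\<close> between \<open>x\<close> and \<open>y\<close>. Working with
  majorants turns sums of variations over disjoint intervals into sums of increments of one monotone function,
  so that the sequences in the definition of the variation never have to be cut and glued.
\<close>
lemma bounded_variation_majorant:
  fixes h :: "real \<Rightarrow> real"
  assumes V: "variation_on J h \<le> ennreal B" and B: "0 \<le> B"
  obtains w :: "real \<Rightarrow> real" where "mono w" "\<And>x. 0 \<le> w x" "\<And>x. w x \<le> B"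
    "\<And>x y. x \<in> J \<Longrightarrow> y \<in> J \<Longrightarrow> x \<le> y \<Longrightarrow> \<bar>h x - h y\<bar> \<le> w y - w x"
proof
  define d where "d = (\<lambda>u v::real. ennreal \<bar>u - v\<bar>)"
  define W where "W x = variation_wrt d (J \<inter> {..x}) h" for x
  let ?S = "\<lambda>xs. \<Sum>i<length xs - 1. d (h (xs ! i)) (h (xs ! Suc i))"
  have WB: "W x \<le> ennreal B" for x
    using V variation_wrt_mono[of "J \<inter> {..x}" J d h]
    by (auto simp: W_def variation_on_def d_def)
  have fin: "W x < top" for x using WB[of x] by (auto simp: less_top[symmetric] top_unique)
  show "mono (\<lambda>x. enn2real (W x))"
  proof (rule monoI, rule enn2real_mono)
    fix x y :: real assume "x \<le> y"
    then show "W x \<le> W y" unfolding W_def by (intro variation_wrt_mono) auto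
  qed (rule fin)
  show "0 \<le> enn2real (W x)" "enn2real (W x) \<le> B" for x
    using WB[of x] B by (auto intro: enn2real_leI)
  fix x y assume xy: "x \<in> J" "y \<in> J" "x \<le> y"
  have "W x + d (h x) (h y) \<le> W y"
  proof (cases "x = y")
    case True then show ?thesis by (simp add: d_def)
  next
    case False
    have "?S xs + d (h x) (h y) \<le> W y" if xs: "sorted_wrt (<) xs" "set xs \<subseteq> J \<inter> {..x}" for xs
    proof -
      \<comment> \<open>\<open>zs\<close> is \<open>xs\<close> prolonged so that it ends in \<open>x\<close>\<close>
      define zs where "zs = (if xs \<noteq> [] \<and> last xs = x then xs else xs @ [x])"
      have zs: "zs \<noteq> []" "last zs = x" by (auto simp: zs_def)
      have sub: "set zs \<subseteq> J \<inter> {..x}" using xs xy by (auto simp: zs_def)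
      have "sorted_wrt (<) zs"
      proof (cases "xs = [] \<or> last xs = x")
        case True then show ?thesis using xs by (auto simp: zs_def)
      next
        case F: False
        have "a < x" if "a \<in> set xs" for a
        proof -
          have "a \<le> last xs" using xs(1) that F
            by (metis in_set_conv_nth last_conv_nth nth_append_length order_le_less sorted_wrt_append
                append_butlast_last_id set_append Un_iff list.set_intros(1) empty_iff list.set(1) set_ConsD)
          moreover have "last xs \<le> x" using xs(2) F last_in_set[of xs] by (meson IntD2 atMost_iff subsetD)
          ultimately show ?thesis using F by force
        qed
        then show ?thesis using xs F by (auto simp: zs_def sorted_wrt_append)
      qed
      then have ss: "sorted_wrt (<) (zs @ [y])" using sub xy False
        by (force simp: sorted_wrt_append)
      have "?S xs \<le> ?S zs"
        using chain_sum_snoc[of xs "\<lambda>u v. d (h u) (h v)" x] by (cases "xs = []") (auto simp: zs_def)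
      then have "?S xs + d (h x) (h y) \<le> ?S zs + d (h (last zs)) (h y)"
        using zs by (auto intro: add_right_mono)
      also have "\<dots> = ?S (zs @ [y])"
        using chain_sum_snoc[OF zs(1), of "\<lambda>u v. d (h u) (h v)" y] by simp
      also have "\<dots> \<le> W y" unfolding W_def variation_wrt_def
        by (rule SUP_upper) (use ss sub xy in auto)
      finally show ?thesis .
    qed
    then have "(SUP xs\<in>{xs. sorted_wrt (<) xs \<and> set xs \<subseteq> J \<inter> {..x}}. ?S xs + d (h x) (h y)) \<le> W y"
      by (intro SUP_least) auto
    moreover have "(SUP xs\<in>{xs. sorted_wrt (<) xs \<and> set xs \<subseteq> J \<inter> {..x}}. ?S xs + d (h x) (h y)) =
       (SUP xs\<in>{xs. sorted_wrt (<) xs \<and> set xs \<subseteq> J \<inter> {..x}}. ?S xs) + d (h x) (h y)"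
      by (rule ennreal_SUP_add_left) (auto intro: exI[of _ "[]"] simp: d_def)
    ultimately show ?thesis by (simp add: W_def variation_wrt_def)
  qed
  then have "enn2real (W x + d (h x) (h y)) \<le> enn2real (W y)"
    by (rule enn2real_mono) (rule fin)
  then have "enn2real (W x) + \<bar>h x - h y\<bar> \<le> enn2real (W y)"
    by (subst (asm) enn2real_plus) (auto simp: fin d_def)
  then show "\<bar>h x - h y\<bar> \<le> enn2real (W y) - enn2real (W x)" by simp
qed

text \<open>
  A converse of the previous lemma for an arbitrary distance. The error \<open>\<epsilon>\<close> enters once
  per step of a given sequence and disappears in the limit; this is the lower semicontinuity of the variation
  under uniform approximation, and \<open>w\<close> may depend on \<open>\<epsilon>\<close>.
\<close>
lemma variation_le_of_approximate_majorants:
  assumes "\<And>\<epsilon>. 0 < \<epsilon> \<Longrightarrow> \<exists>w :: real \<Rightarrow> real. mono w \<and> (\<forall>x. 0 \<le> w x \<and> w x \<le> B) \<and>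
      (\<forall>x\<in>J. \<forall>y\<in>J. x < y \<longrightarrow> d (h x) (h y) \<le> ennreal (w y - w x + \<epsilon>))"
  shows "variation_wrt d J h \<le> ennreal B"
  unfolding variation_wrt_def
proof (rule SUP_least)
  let ?S = "\<lambda>xs. \<Sum>i<length xs - 1. d (h (xs ! i)) (h (xs ! Suc i))"
  fix xs :: "real list"
  assume "xs \<in> {xs. sorted_wrt (<) xs \<and> set xs \<subseteq> J}"
  then have xs: "sorted_wrt (<) xs" "set xs \<subseteq> J" by auto
  have approx: "?S xs \<le> ennreal (B + real (length xs) * \<epsilon>)" if eps: "0 < \<epsilon>" for \<epsilon>
  proof -
    obtain w :: "real \<Rightarrow> real" where w: "mono w" "\<And>x. 0 \<le> w x" "\<And>x. w x \<le> B"
      and d: "\<And>x y. x \<in> J \<Longrightarrow> y \<in> J \<Longrightarrow> x < y \<Longrightarrow> d (h x) (h y) \<le> ennreal (w y - w x + \<epsilon>)"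
      using assms[OF eps] by blast
    have "xs \<noteq> [] \<Longrightarrow> ?S xs \<le> ennreal (w (last xs) - w (hd xs) + real (length xs) * \<epsilon>)" using xs
    proof (induction xs rule: rev_induct)
      case Nil then show ?case by simp
    next
      case (snoc y xs)
      show ?case
      proof (cases "xs = []")
        case True then show ?thesis by simp
      next
        case False
        have s: "sorted_wrt (<) xs" "set xs \<subseteq> J" "last xs < y" "y \<in> J" "last xs \<in> J" "hd xs \<le> last xs"
          using snoc.prems False last_in_set[OF False] hd_in_set[OF False]
          by (auto simp: sorted_wrt_append subset_iff)
             (metis False append_butlast_last_id hd_append2 hd_in_set list.sel(1) order.refl
               self_append_conv2 sorted_wrt_append list.set_intros(1) less_imp_le)
        have m: "w (hd xs) \<le> w (last xs)" "w (last xs) \<le> w y"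
          using s monoD[OF w(1)] by auto
        have "?S (xs @ [y]) = ?S xs + d (h (last xs)) (h y)"
          using chain_sum_snoc[OF False, of "\<lambda>u v. d (h u) (h v)" y] by simp
        also have "\<dots> \<le> ennreal (w (last xs) - w (hd xs) + real (length xs) * \<epsilon>) + ennreal (w y - w (last xs) + \<epsilon>)"
          using snoc.IH[OF False s(1,2)] d[OF s(5,4,3)] by (rule add_mono)
        also have "\<dots> = ennreal (w y - w (hd xs) + real (length (xs @ [y])) * \<epsilon>)"
        proof -
          define k where "k = real (length xs) * \<epsilon>"
          have "0 \<le> k" using eps by (simp add: k_def)
          moreover have "real (length (xs @ [y])) * \<epsilon> = k + \<epsilon>" by (simp add: k_def algebra_simps)
          ultimately show ?thesis using m eps unfolding k_def[symmetric]
            by (subst ennreal_plus[symmetric]) (simp_all del: ennreal_plus)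
        qed
        finally show ?thesis using False by simp
      qed
    qed
    moreover have "w (last xs) - w (hd xs) \<le> B" using w(2)[of "hd xs"] w(3)[of "last xs"] by simp
    then have "ennreal (w (last xs) - w (hd xs) + real (length xs) * \<epsilon>) \<le> ennreal (B + real (length xs) * \<epsilon>)"
      by (intro ennreal_leI) simp
    ultimately show ?thesis
      by (cases "xs = []") (simp, rule order_trans)
  qed
  have "(\<lambda>n. ennreal (B + real (length xs) * (1 / real (Suc n)))) \<longlonglongrightarrow> ennreal (B + real (length xs) * 0)"
    by (intro tendsto_ennrealI tendsto_intros LIMSEQ_Suc[OF lim_1_over_n])
  moreover have "?S xs \<le> ennreal (B + real (length xs) * (1 / real (Suc n)))" for n
    by (rule approx) simp
  ultimately have "?S xs \<le> ennreal (B + real (length xs) * 0)"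
    by (intro LIMSEQ_le_const) blast+
  then show "?S xs \<le> ennreal B" by simp
qed

lemma disjoint_intervals_ordered:
  assumes "disjoint_family_on ival Q" "i \<in> Q" "j \<in> Q" "i \<noteq> j"
    and "fst i < snd i" "fst j < snd j" "snd i \<le> snd j"
  shows "snd i \<le> fst j"
proof (rule ccontr)
  assume "\<not> snd i \<le> fst j"
  then obtain z where "max (fst i) (fst j) < z" "z < snd i"
    using assms(5) dense[of "max (fst i) (fst j)" "snd i"] by auto
  then have "z \<in> ival i \<inter> ival j" using assms(7) by (auto simp: ival_def)
  then show False using assms(1-4) by (auto simp: disjoint_family_on_def)
qed

text \<open>
  The interval with the largest right end point lies to the right of all the others, so their increments fit
  below its left end point.
\<close>
lemma sum_increments_disjoint_intervals:
  fixes w :: "real \<Rightarrow> real"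
  assumes w: "mono w" "\<And>x. 0 \<le> w x" "\<And>x. w x \<le> B"
    and F: "finite F" "disjoint_family_on ival F" "\<And>i. i \<in> F \<Longrightarrow> fst i < snd i"
  shows "(\<Sum>i\<in>F. w (snd i) - w (fst i)) \<le> B"
proof -
  have B: "0 \<le> B" using w(2)[of 0] w(3)[of 0] by simp
  have "(\<forall>i\<in>F. snd i \<le> c) \<Longrightarrow> (\<Sum>i\<in>F. w (snd i) - w (fst i)) \<le> w c" for c
    using F
  proof (induction F arbitrary: c rule: finite_ranking_induct[where f = snd])
    case empty then show ?case using w by simp
  next
    case (insert x S)
    show ?case
    proof (cases "x \<in> S")
      case True
      then have "insert x S = S" by auto
      then show ?thesis using insert by (metis)
    next
      case False
      have "snd i \<le> fst x" if "i \<in> S" for i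
        using that insert.prems insert.hyps(2)[OF that] False
        by (intro disjoint_intervals_ordered[of "insert x S"]) auto
      then have "(\<Sum>i\<in>S. w (snd i) - w (fst i)) \<le> w (fst x)"
        using insert by (intro insert.IH) (auto simp: disjoint_family_on_def)
      moreover have "w (snd x) \<le> w c" using insert.prems w(1) by (auto dest: monoD)
      ultimately show ?thesis using False insert by simp
    qed
  qed
  from this[of "if F = {} then 0 else Max (snd ` F)"] show ?thesis
    using F(1) w(3) order_trans by (cases "F = {}") (auto simp: B)
qed

section \<open>Functions of bounded variation and the Frobenius-Perron operator\<close>

lemma space_mI [simp]: "space mI = {0..1}"
  by (simp add: mI_def space_restrict_space)

lemma sets_mI: "A \<in> sets mI \<longleftrightarrow> A \<in> sets borel \<and> A \<subseteq> {0..1}"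
  by (auto simp: mI_def sets_restrict_space_iff)

lemma emeasure_mI: "A \<subseteq> {0..1} \<Longrightarrow> emeasure mI A = emeasure lborel A"
  by (auto simp: mI_def emeasure_restrict_space)

lemma prob_space_mI: "prob_space mI"
  by (rule prob_spaceI) (simp add: emeasure_mI)

lemma measurable_mI: "f \<in> measurable borel M \<Longrightarrow> f \<in> measurable mI M"
  by (simp add: mI_def measurable_restrict_space1)

lemma nn_integral_mI: "(\<integral>\<^sup>+x. q x \<partial>mI) = (\<integral>\<^sup>+x. q x * indicator {0..1} x \<partial>lborel)"
  by (simp add: mI_def nn_integral_restrict_space)

lemma AE_mI: "(AE x in mI. R x) \<longleftrightarrow> (AE x in lborel. x \<in> {0..1} \<longrightarrow> R x)"
  by (subst mI_def, subst AE_restrict_space_iff) auto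

lemma funpow_measurable: "f \<in> measurable M M \<Longrightarrow> (f ^^ n) \<in> measurable M M"
  by (induction n) (auto intro: measurable_comp)

text \<open>
  A function of variation \<open>V\<close> satisfies \<open>\<bar>h x\<bar> \<le> \<bar>h y\<bar> + V\<close>;
  integrating over \<open>y\<close> bounds it everywhere by its \<open>BV\<close>-norm. The strict inequality
  leaves room to choose a representative whose variation is close to the infimum.
\<close>
lemma BV_representative:
  assumes meas: "h \<in> borel_measurable mI" and c: "BV_norm h < ennreal c"
  obtains h' where "AE x in mI. h' x = h x" "variation_on {0..1} h' \<le> ennreal c"
    "\<And>x. x \<in> {0..1} \<Longrightarrow> \<bar>h' x\<bar> \<le> c"
proof -
  interpret prob_space mI by (rule prob_space_mI)
  have c0: "0 < c" using c by (metis ennreal_neg not_less not_less_zero)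
  have lt: "L1_norm h + ess_variation h < ennreal c" using c by (simp add: BV_norm_def)
  then have "L1_norm h \<noteq> \<infinity>" "ess_variation h \<noteq> \<infinity>" by auto
  then obtain l e where l: "L1_norm h = ennreal l" "0 \<le> l" and e: "ess_variation h = ennreal e" "0 \<le> e"
    by (cases "L1_norm h"; cases "ess_variation h") auto
  have lec: "l + e < c" using lt l e by (simp add: ennreal_plus[symmetric] ennreal_less_iff del: ennreal_plus)
  then have "ess_variation h < ennreal (c - l)" using e by (simp add: ennreal_less_iff)
  then obtain h' where h': "AE x in mI. h' x = h x" "variation_on {0..1} h' < ennreal (c - l)"
    unfolding ess_variation_def by (auto simp: INF_less_iff)
  define V where "V = variation_on {0..1} h'"
  have "L1_norm h + V \<le> ennreal l + ennreal (c - l)"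
    using h'(2) l by (intro add_mono) (auto simp: V_def)
  also have "\<dots> = ennreal c" using l lec e by (simp add: ennreal_plus[symmetric] del: ennreal_plus)
  finally have LV: "L1_norm h + V \<le> ennreal c" .
  have "V \<le> ennreal (c - l)" using h'(2) by (simp add: V_def)
  also have "\<dots> \<le> ennreal c" using l by (intro ennreal_leI) auto
  finally have Vc: "V \<le> ennreal c" .
  have pt: "ennreal \<bar>h' x\<bar> \<le> ennreal \<bar>h' y\<bar> + V" if "x \<in> {0..1}" "y \<in> {0..1}" for x y
  proof -
    have "ennreal \<bar>h' x - h' y\<bar> \<le> V"
      using pair_le_variation[of x "{0..1}" y "\<lambda>u v. ennreal \<bar>u - v\<bar>" h']
        pair_le_variation[of y "{0..1}" x "\<lambda>u v. ennreal \<bar>u - v\<bar>" h'] that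
      by (cases x y rule: linorder_cases) (auto simp: V_def variation_on_def abs_minus_commute)
    moreover have "ennreal \<bar>h' x\<bar> \<le> ennreal \<bar>h' y\<bar> + ennreal \<bar>h' x - h' y\<bar>"
      by (subst ennreal_plus[symmetric]) (auto intro!: ennreal_leI simp del: ennreal_plus)
    ultimately show ?thesis by (meson add_left_mono order_trans)
  qed
  have "\<bar>h' x\<bar> \<le> c" if x: "x \<in> {0..1}" for x
  proof -
    have "ennreal \<bar>h' x\<bar> = (\<integral>\<^sup>+y. ennreal \<bar>h' x\<bar> \<partial>mI)" using emeasure_space_1 by simp
    also have "\<dots> \<le> (\<integral>\<^sup>+y. ennreal \<bar>h y\<bar> + V \<partial>mI)"
    proof (rule nn_integral_mono_AE)
      show "AE y in mI. ennreal \<bar>h' x\<bar> \<le> ennreal \<bar>h y\<bar> + V"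
        using h'(1) AE_space by eventually_elim (use pt[OF x] in fastforce)
    qed
    also have "\<dots> = L1_norm h + V"
      using meas emeasure_space_1 by (subst nn_integral_add) (auto simp: L1_norm_def)
    also have "\<dots> \<le> ennreal c" by (rule LV)
    finally show ?thesis using c0 by (simp add: ennreal_le_iff)
  qed
  then show ?thesis using that[OF h'(1)] Vc by (auto simp: V_def)
qed

lemma BV_norm_cong_AE:
  assumes "AE x in mI. h x = h' x" shows "BV_norm h = BV_norm h'"
proof -
  have "L1_norm h = L1_norm h'" unfolding L1_norm_def
    by (rule nn_integral_cong_AE) (use assms in \<open>auto\<close>)
  moreover have "(AE x in mI. k x = h x) \<longleftrightarrow> (AE x in mI. k x = h' x)" for k
    using assms by (intro eventually_subst) (auto elim: eventually_mono)
  ultimately show ?thesis by (simp add: BV_norm_def ess_variation_def)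
qed

lemma variation_const: "variation_on J (\<lambda>_. c) = 0"
proof -
  have "variation_on J (\<lambda>_. c) \<le> 0"
    unfolding variation_on_def variation_wrt_def by (rule SUP_least) simp
  then show ?thesis by simp
qed

lemma one_BV: "(\<lambda>_. 1) \<in> BV" "BV_norm (\<lambda>_. 1) = 1" "L1_norm (\<lambda>_. 1) = 1"
proof -
  interpret prob_space mI by (rule prob_space_mI)
  have "ess_variation (\<lambda>_. 1) \<le> variation_on {0..1} (\<lambda>_. 1)"
    unfolding ess_variation_def by (rule INF_lower) auto
  then have e: "ess_variation (\<lambda>_. 1) = 0" by (simp add: variation_const)
  show "(\<lambda>_. 1) \<in> BV" by (simp add: BV_def e)
  show l: "L1_norm (\<lambda>_. 1) = 1" using emeasure_space_1 by (simp add: L1_norm_def)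
  show "BV_norm (\<lambda>_. 1) = 1" by (simp add: BV_norm_def e l)
qed

text \<open>
  The duality relation that characterizes \<open>PF f h\<close> up to null sets.
\<close>
definition transfers :: "(real \<Rightarrow> real) \<Rightarrow> (real \<Rightarrow> real) \<Rightarrow> (real \<Rightarrow> real) \<Rightarrow> bool" where
  "transfers f h h' \<longleftrightarrow> integrable mI h' \<and>
     (\<forall>u\<in>borel_measurable mI. (\<exists>C. \<forall>x\<in>{0..1}. \<bar>u x\<bar> \<le> C) \<longrightarrow>
        (\<integral>x. u x * h' x \<partial>mI) = (\<integral>x. u (f x) * h x \<partial>mI))"

lemma transfers_PF: "transfers f h h' \<Longrightarrow> transfers f h (PF f h)"
proof -
  assume h': "transfers f h h'"
  have "PF f h = (SOME h'. transfers f h h')" by (simp only: PF_def transfers_def)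
  then show ?thesis using someI[of "transfers f h", OF h'] by simp
qed

lemma transfers_integral:
  assumes "transfers f h h'" "u \<in> borel_measurable mI" "\<And>x. x \<in> {0..1} \<Longrightarrow> \<bar>u x\<bar> \<le> C"
  shows "(\<integral>x. u x * h' x \<partial>mI) = (\<integral>x. u (f x) * h x \<partial>mI)"
  using assms unfolding transfers_def by blast

lemma integrable_bounded_mult:
  fixes h u :: "real \<Rightarrow> real"
  assumes "integrable mI h" "u \<in> borel_measurable mI" "\<And>x. x \<in> {0..1} \<Longrightarrow> \<bar>u x\<bar> \<le> C"
  shows "integrable mI (\<lambda>x. u x * h x)"
proof (rule Bochner_Integration.integrable_bound[of mI "\<lambda>x. C * h x"])
  show "AE x in mI. norm (u x * h x) \<le> norm (C * h x)"
  proof (rule AE_I2)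
    fix x assume "x \<in> space mI"
    then have "\<bar>u x\<bar> \<le> \<bar>C\<bar>" using assms(3)[of x] by auto
    then show "norm (u x * h x) \<le> norm (C * h x)" by (simp add: abs_mult mult_right_mono)
  qed
qed (use assms in auto)

lemma transfers_unique:
  assumes 1: "transfers f h h1" and 2: "transfers f h h2"
  shows "AE x in mI. h1 x = h2 x"
proof -
  have i: "integrable mI h1" "integrable mI h2" using assms by (auto simp: transfers_def)
  have [measurable]: "h1 \<in> borel_measurable mI" "h2 \<in> borel_measurable mI" using i by auto
  define u where "u x = sgn (h1 x - h2 x)" for x
  have u: "u \<in> borel_measurable mI" unfolding u_def by measurable
  have b: "\<bar>u x\<bar> \<le> 1" for x by (auto simp: u_def sgn_if)
  have "(\<integral>x. u x * h1 x \<partial>mI) = (\<integral>x. u x * h2 x \<partial>mI)"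
    using transfers_integral[OF 1 u, of 1] transfers_integral[OF 2 u, of 1] b by simp
  then have "(\<integral>x. u x * h1 x - u x * h2 x \<partial>mI) = 0"
    by (subst Bochner_Integration.integral_diff) (auto intro!: integrable_bounded_mult[where C=1] i u b)
  moreover have "u x * h1 x - u x * h2 x = \<bar>h1 x - h2 x\<bar>" for x
    by (auto simp: u_def sgn_if abs_if)
  ultimately have "(\<integral>x. \<bar>h1 x - h2 x\<bar> \<partial>mI) = 0" by simp
  then have "AE x in mI. \<bar>h1 x - h2 x\<bar> = 0"
    using i by (subst integral_nonneg_eq_0_iff_AE[symmetric]) auto
  then show ?thesis by eventually_elim auto
qed

lemma transfers_cong_AE:
  assumes "AE x in mI. h x = k x" "h \<in> borel_measurable mI" "k \<in> borel_measurable mI"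
    "f \<in> measurable mI mI" "transfers f h h'"
  shows "transfers f k h'"
proof -
  have [measurable]: "h \<in> borel_measurable mI" "k \<in> borel_measurable mI" "f \<in> measurable mI mI"
    using assms by auto
  have "(\<integral>x. u (f x) * h x \<partial>mI) = (\<integral>x. u (f x) * k x \<partial>mI)"
    if [measurable]: "u \<in> borel_measurable mI" for u :: "real \<Rightarrow> real"
    by (rule integral_cong_AE) (use assms(1) in auto)
  then show ?thesis using assms(5) by (auto simp: transfers_def)
qed

text \<open>
  The image under \<open>f\<close> of the measure with density \<open>h\<close> is absolutely continuous as
  \<open>f\<close> is nonsingular, and \<open>h'\<close> is its Radon-Nikodym derivative.
\<close>
lemma transfers_nonneg_exists:
  assumes f: "f \<in> measurable mI mI" "nonsingular f"
    and h: "integrable mI h" "AE x in mI. 0 \<le> h x"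
  obtains h' where "transfers f h h'" "\<And>x. 0 \<le> h' x"
proof -
  interpret prob_space mI by (rule prob_space_mI)
  have [measurable]: "f \<in> measurable mI mI" "h \<in> borel_measurable mI" using f h by auto
  define N where "N = distr (density mI (\<lambda>x. ennreal (h x))) mI f"
  have dens: "emeasure (density mI (\<lambda>x. ennreal (k x))) {0..1} = (\<integral>\<^sup>+x. ennreal (k x) \<partial>mI)"
    if [measurable]: "k \<in> borel_measurable mI" for k :: "real \<Rightarrow> real"
  proof -
    have "emeasure (density mI (\<lambda>x. ennreal (k x))) {0..1} = (\<integral>\<^sup>+x. ennreal (k x) * indicator {0..1} x \<partial>mI)"
      by (rule emeasure_density) (auto simp: sets_mI)
    also have "\<dots> = (\<integral>\<^sup>+x. ennreal (k x) \<partial>mI)" by (rule nn_integral_cong) auto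
    finally show ?thesis .
  qed
  have fin: "finite_measure N"
  proof (unfold N_def, intro finite_measure.finite_measure_distr finite_measureI)
    have "emeasure (density mI (\<lambda>x. ennreal (h x))) (space mI) = (\<integral>\<^sup>+x. ennreal (h x) \<partial>mI)"
      by (simp add: dens)
    also have "\<dots> < \<infinity>" using h by (simp add: nn_integral_eq_integral)
    finally show "emeasure (density mI (\<lambda>x. ennreal (h x))) (space (density mI (\<lambda>x. ennreal (h x)))) \<noteq> \<infinity>"
      by simp
  qed simp
  have ac: "absolutely_continuous mI N"
    unfolding absolutely_continuous_def
  proof
    fix A assume A: "A \<in> null_sets mI"
    then have Am [measurable]: "A \<in> sets mI" by auto
    have "A \<in> null_sets (distr mI mI f)"
      using A f(2) by (auto simp: nonsingular_def absolutely_continuous_def)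
    then have "f -` A \<inter> space mI \<in> null_sets mI"
      using A measurable_sets[OF f(1), of A] by (auto simp: null_sets_def emeasure_distr)
    then have "AE x in mI. x \<notin> f -` A \<inter> space mI" by (rule AE_not_in)
    then have "AE x in mI. x \<in> f -` A \<inter> space mI \<longrightarrow> ennreal (h x) = 0" by eventually_elim auto
    moreover have "f -` A \<inter> space mI \<in> sets mI" by (rule measurable_sets[OF f(1) Am])
    ultimately have "f -` A \<inter> space mI \<in> null_sets (density mI (\<lambda>x. ennreal (h x)))"
      by (subst null_sets_density_iff) auto
    then show "A \<in> null_sets N" unfolding N_def
      by (simp add: null_sets_def emeasure_distr)
  qed
  obtain D where D: "D \<in> borel_measurable mI" "AE x in mI. RN_deriv mI N x = ennreal (D x)" "\<And>x. 0 \<le> D x"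
    using real_RN_deriv[OF fin ac] by (auto simp: N_def)
  have [measurable]: "D \<in> borel_measurable mI" by (rule D)
  have "density mI (RN_deriv mI N) = N" by (rule density_RN_deriv[OF ac]) (simp add: N_def)
  moreover have "density mI (RN_deriv mI N) = density mI (\<lambda>x. ennreal (D x))"
    by (rule density_cong) (use D in auto)
  ultimately have N: "N = density mI (\<lambda>x. ennreal (D x))" by simp
  have "(\<integral>\<^sup>+x. ennreal (D x) \<partial>mI) = emeasure N (space N)"
    unfolding N by (simp add: dens)
  also have "\<dots> < \<infinity>" using finite_measure.emeasure_finite[OF fin, of "space N"] by (simp add: top.not_eq_extremum)
  finally have iD: "integrable mI D" using D by (simp add: integrable_iff_bounded)
  have "(\<integral>x. u x * D x \<partial>mI) = (\<integral>x. u (f x) * h x \<partial>mI)"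
    if [measurable]: "u \<in> borel_measurable mI" for u :: "real \<Rightarrow> real"
  proof -
    have "(\<integral>x. u x * D x \<partial>mI) = (\<integral>x. u x \<partial>N)"
      unfolding N by (subst integral_density) (use D in \<open>auto simp: mult.commute\<close>)
    also have "\<dots> = (\<integral>x. u (f x) \<partial>density mI (\<lambda>x. ennreal (h x)))"
      unfolding N_def by (subst integral_distr) auto
    also have "\<dots> = (\<integral>x. u (f x) * h x \<partial>mI)"
      by (subst integral_density) (use h in \<open>auto simp: mult.commute\<close>)
    finally show ?thesis .
  qed
  then have "transfers f h D" by (simp add: transfers_def iD)
  then show ?thesis using that D by blast
qed

text \<open>
  The operator \<open>PF\<close> is a choice of representative, meaningful only where one exists; here
  existence is carried along the iteration with the help of nonnegativity.
\<close>
lemma PF_iterates_one: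
  assumes f: "f \<in> measurable mI mI" "nonsingular f"
  shows "integrable mI ((PF f ^^ n) (\<lambda>_. 1)) \<and> (AE x in mI. 0 \<le> (PF f ^^ n) (\<lambda>_. 1) x) \<and>
    transfers (f ^^ n) (\<lambda>_. 1) ((PF f ^^ n) (\<lambda>_. 1))"
proof (induction n)
  case 0
  interpret prob_space mI by (rule prob_space_mI)
  show ?case by (simp add: transfers_def)
next
  case (Suc n)
  define h where "h = (PF f ^^ n) (\<lambda>_. 1)"
  obtain h' where h': "transfers f h h'" "\<And>x. 0 \<le> h' x"
    using transfers_nonneg_exists[OF f, of h] Suc by (auto simp: h_def)
  have t: "transfers f h (PF f h)" using transfers_PF[OF h'(1)] .
  have nn: "AE x in mI. 0 \<le> PF f h x" using transfers_unique[OF h'(1) t]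
  proof (eventually_elim)
    fix x assume "h' x = PF f h x"
    then show "0 \<le> PF f h x" using h'(2)[of x] by simp
  qed
  have "transfers (f ^^ Suc n) (\<lambda>_. 1) (PF f h)"
    unfolding transfers_def
  proof (intro conjI ballI impI)
    show "integrable mI (PF f h)" using t by (simp add: transfers_def)
    fix u :: "real \<Rightarrow> real" assume u: "u \<in> borel_measurable mI" "\<exists>C. \<forall>x\<in>{0..1}. \<bar>u x\<bar> \<le> C"
    then obtain C where C: "\<And>x. x \<in> {0..1} \<Longrightarrow> \<bar>u x\<bar> \<le> C" by blast
    have uf: "(\<lambda>x. u (f x)) \<in> borel_measurable mI" using f(1) u(1) by measurable
    have fC: "\<bar>u (f x)\<bar> \<le> C" if "x \<in> {0..1}" for x
      using C measurable_space[OF f(1), of x] that by simp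
    have "transfers (f ^^ n) (\<lambda>_. 1) h" using Suc by (simp add: h_def)
    from transfers_integral[OF this uf fC]
    have "(\<integral>x. u (f x) * h x \<partial>mI) = (\<integral>x. u (f ((f ^^ n) x)) * 1 \<partial>mI)" .
    moreover have "(\<integral>x. u x * PF f h x \<partial>mI) = (\<integral>x. u (f x) * h x \<partial>mI)"
      by (rule transfers_integral[OF t u(1) C])
    ultimately show "(\<integral>x. u x * PF f h x \<partial>mI) = (\<integral>x. u ((f ^^ Suc n) x) * 1 \<partial>mI)" by simp
  qed
  then show ?case using t nn by (simp add: transfers_def h_def)
qed

text \<open>
  The measure of the preimage of \<open>E\<close> under \<open>f\<^sup>n\<close> is the integral over
  \<open>E\<close> of the \<open>n\<close>-th iterate of the constant \<open>1\<close>, which its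
  \<open>BV\<close>-norm bounds.
\<close>
lemma measure_preimage_le:
  assumes f: "f \<in> measurable mI mI" "nonsingular f"
    and c: "BV_norm ((PF f ^^ n) (\<lambda>_. 1)) < ennreal c" and E: "E \<in> sets mI"
  shows "measure mI ((f ^^ n) -` E \<inter> {0..1}) \<le> c * measure mI E"
proof -
  interpret prob_space mI by (rule prob_space_mI)
  define p where "p = (PF f ^^ n) (\<lambda>_. 1)"
  have p: "integrable mI p" "transfers (f ^^ n) (\<lambda>_. 1) p"
    using PF_iterates_one[OF f, of n] by (auto simp: p_def)
  have [measurable]: "p \<in> borel_measurable mI" using p by auto
  obtain p' where p': "AE x in mI. p' x = p x" "\<And>x. x \<in> {0..1} \<Longrightarrow> \<bar>p' x\<bar> \<le> c"
    using BV_representative[of p c] c by (auto simp: p_def[symmetric])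
  have pc: "AE x in mI. p x \<le> c"
    using p'(1) AE_space by eventually_elim (use p'(2) in \<open>fastforce simp: abs_le_iff\<close>)
  have [measurable]: "f ^^ n \<in> measurable mI mI" "E \<in> sets mI" using funpow_measurable[OF f(1)] E by auto
  have "measure mI ((f ^^ n) -` E \<inter> {0..1}) = (\<integral>x. indicator ((f ^^ n) -` E \<inter> {0..1}) x \<partial>mI)"
    using measurable_sets[OF \<open>f ^^ n \<in> measurable mI mI\<close> E] by simp
  also have "\<dots> = (\<integral>x. indicator E ((f ^^ n) x) * 1 \<partial>mI)"
    by (rule Bochner_Integration.integral_cong) (auto simp: indicator_def)
  also have "\<dots> = (\<integral>x. indicator E x * p x \<partial>mI)"
    by (rule transfers_integral[OF p(2), where C = 1, symmetric]) (use E in \<open>auto simp: indicator_def\<close>)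
  also have "\<dots> \<le> (\<integral>x. indicator E x * c \<partial>mI)"
  proof (rule integral_mono_AE)
    show "integrable mI (\<lambda>x. indicator E x * p x)"
      by (rule integrable_bounded_mult[where C=1]) (auto intro: p simp: indicator_def)
    show "AE x in mI. indicator E x * p x \<le> indicator E x * c"
      using pc by eventually_elim (auto simp: indicator_def)
    show "integrable mI (\<lambda>x. indicator E x * c)"
      by (rule integrable_bounded_mult[where C=1]) (auto simp: indicator_def)
  qed
  also have "\<dots> = c * measure mI E"
    using E by (simp add: sets_mI Int_absorb2 mult.commute)
  finally show ?thesis .
qed

lemma PF_iterates_fixed:
  assumes f: "f \<in> measurable mI mI" and h: "transfers f h h" 
  shows "transfers f h ((PF f ^^ n) h) \<and> (AE x in mI. (PF f ^^ n) h x = h x)"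
proof (induction n)
  case 0 then show ?case using h by simp
next
  case (Suc n)
  define k where "k = (PF f ^^ n) h"
  have i: "integrable mI h" "integrable mI k" using h Suc by (auto simp: transfers_def k_def)
  have kh: "AE x in mI. k x = h x" using Suc by (simp add: k_def)
  then have "AE x in mI. h x = k x" by eventually_elim simp
  then have "transfers f k h" using transfers_cong_AE[OF _ _ _ f h] i by blast
  then have "transfers f k (PF f k)" by (rule transfers_PF)
  then have "transfers f h (PF f k)" using transfers_cong_AE[OF kh _ _ f] i by blast
  moreover from transfers_unique[OF this h] have "AE x in mI. PF f k x = h x" .
  ultimately show ?case by (simp add: k_def)
qed

text \<open>
  For a fixed point the left-hand side of the Lasota-Yorke inequality does not depend on \<open>n\<close>, and
  the term with \<open>q ^ n\<close> vanishes as \<open>n\<close> grows.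
\<close>
lemma BV_norm_fixed_le:
  assumes f: "f \<in> measurable mI mI" and h: "transfers f h h" "h \<in> BV" and D: "0 < D" "0 < q" "q < 1"
    and LY: "\<And>n. 1 \<le> n \<Longrightarrow>
      BV_norm ((PF f ^^ n) h) \<le> ennreal (D * q ^ n) * BV_norm h + ennreal D * L1_norm h"
  shows "BV_norm h \<le> ennreal D * L1_norm h"
proof -
  have fin: "BV_norm h < \<infinity>" using h(2)
    by (auto simp: BV_def BV_norm_def L1_norm_def integrable_iff_bounded)
  have eq: "BV_norm ((PF f ^^ n) h) = BV_norm h" for n
    using PF_iterates_fixed[OF f h(1), of n] by (intro BV_norm_cong_AE) auto
  obtain b where b: "BV_norm h = ennreal b" "0 \<le> b" using fin by (cases "BV_norm h") auto
  have "(\<lambda>n. ennreal (D * q ^ n) * BV_norm h + ennreal D * L1_norm h) \<longlonglongrightarrow>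
      ennreal (D * 0 * b) + ennreal D * L1_norm h"
  proof (rule tendsto_add[OF _ tendsto_const])
    have "(\<lambda>n. ennreal (D * q ^ n * b)) \<longlonglongrightarrow> ennreal (D * 0 * b)"
      using D by (intro tendsto_ennrealI tendsto_intros LIMSEQ_realpow_zero) auto
    then show "(\<lambda>n. ennreal (D * q ^ n) * BV_norm h) \<longlonglongrightarrow> ennreal (D * 0 * b)"
      using b D by (simp add: ennreal_mult)
  qed
  then show ?thesis
    by (rule order_trans[OF LIMSEQ_le_const])
       (use LY eq in \<open>auto intro!: exI[of _ 1]\<close>)
qed

section \<open>Branches, change of variables and the transfer operator\<close>

lemma ival_props [simp]: "open (ival i)" "is_interval (ival i)" "connected (ival i)" "path_connected (ival i)"
    "ival i \<in> sets borel"
  by (auto simp: ival_def is_interval_oo)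

text \<open>
  An open interval that contained an end point of \<open>ival i\<close> would meet \<open>ival i\<close>. This
  is why the weight of the branches vanishes at the end points of every interval of the partition.
\<close>
lemma endpoint_notin_intervals:
  assumes "interval_partition Q" "i \<in> Q" shows "fst i \<notin> (\<Union>j\<in>Q. ival j)" "snd i \<notin> (\<Union>j\<in>Q. ival j)"
proof -
  have b: "\<And>j. j \<in> Q \<Longrightarrow> fst j < snd j" and d: "disjoint_family_on ival Q"
    using assms by (auto simp: interval_partition_def)
  have "\<not> (fst j < fst i \<and> fst i < snd j)" "\<not> (fst j < snd i \<and> snd i < snd j)" if "j \<in> Q" for j
  proof -
    have "i = j \<or> snd i \<le> fst j \<or> snd j \<le> fst i"
      using disjoint_intervals_ordered[OF d assms(2) that] disjoint_intervals_ordered[OF d that assms(2)]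
        b[OF that] b[OF assms(2)] by force
    then show "\<not> (fst j < fst i \<and> fst i < snd j)" "\<not> (fst j < snd i \<and> snd i < snd j)"
      using b[OF that] b[OF assms(2)] by auto
  qed
  then show "fst i \<notin> (\<Union>j\<in>Q. ival j)" "snd i \<notin> (\<Union>j\<in>Q. ival j)" by (auto simp: ival_def)
qed

lemma borel_measurable_nn_integral_count_space:
  fixes F :: "'i \<Rightarrow> 'a \<Rightarrow> ennreal"
  assumes "countable I" "\<And>i. i \<in> I \<Longrightarrow> F i \<in> borel_measurable M"
  shows "(\<lambda>x. \<integral>\<^sup>+i. F i x \<partial>count_space I) \<in> borel_measurable M"
proof -
  interpret sigma_finite_measure "count_space I"
    by (rule sigma_finite_measure_count_space_countable[OF assms(1)])
  have "(\<lambda>(x, i). F i x) \<in> borel_measurable (M \<Otimes>\<^sub>M count_space I)"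
    using measurable_compose_countable'[where f="\<lambda>i p. F i (fst p)" and g=snd and I=I
        and M="M \<Otimes>\<^sub>M count_space I" and N=borel] assms
    by (simp add: case_prod_unfold)
  then show ?thesis by (intro borel_measurable_nn_integral) auto
qed

locale branched =
  fixes Q :: "(real \<times> real) set" and \<tau> :: "real \<Rightarrow> real"
  assumes part: "interval_partition Q" and reg: "regular_branches Q \<tau>" and meas: "\<tau> \<in> measurable mI mI"
begin

definition g :: "real \<Rightarrow> real" where "g = inv_deriv Q \<tau>"

lemma cntbl: "countable Q" and disj: "disjoint_family_on ival Q"
  and bounds_ball: "\<forall>i\<in>Q. 0 \<le> fst i \<and> fst i < snd i \<and> snd i \<le> 1"
  using part unfolding interval_partition_def by simp_all

lemma bounds: "i \<in> Q \<Longrightarrow> 0 \<le> fst i" "i \<in> Q \<Longrightarrow> fst i < snd i" "i \<in> Q \<Longrightarrow> snd i \<le> 1"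
  using bounds_ball by simp_all

lemma ival_subset: "i \<in> Q \<Longrightarrow> ival i \<subseteq> {0..1}"
proof
  fix x assume "i \<in> Q" "x \<in> ival i"
  then show "x \<in> {0..1}" using bounds(1,3)[of i] by (simp add: ival_def)
qed

lemma AE_ival: "AE x in mI. x \<in> (\<Union>i\<in>Q. ival i)"
proof -
  have "AE x in lborel. x \<notin> {0..1} - (\<Union>i\<in>Q. ival i)"
    using part by (intro AE_not_in) (auto simp: interval_partition_def null_sets_def intro!: sets.countable_UN'')
  then show ?thesis unfolding AE_mI by eventually_elim auto
qed

lemma deriv: "i \<in> Q \<Longrightarrow> x \<in> ival i \<Longrightarrow> (\<tau> has_field_derivative deriv \<tau> x) (at x)"
    "i \<in> Q \<Longrightarrow> x \<in> ival i \<Longrightarrow> deriv \<tau> x \<noteq> 0"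
    "i \<in> Q \<Longrightarrow> inj_on \<tau> (ival i)"
  using reg by (auto simp: regular_branches_def DERIV_deriv_iff_real_differentiable)

lemma g_nonneg [simp]: "0 \<le> g x" by (simp add: g_def inv_deriv_def)

lemma g_ival: "i \<in> Q \<Longrightarrow> x \<in> ival i \<Longrightarrow> g x = 1 / \<bar>deriv \<tau> x\<bar>"
  by (auto simp: g_def inv_deriv_def)

lemma g_pos: "i \<in> Q \<Longrightarrow> x \<in> ival i \<Longrightarrow> 0 < g x"
  using deriv(2) by (simp add: g_ival)

lemma g_endpoint: "i \<in> Q \<Longrightarrow> g (fst i) = 0" "i \<in> Q \<Longrightarrow> g (snd i) = 0"
  using endpoint_notin_intervals[OF part] by (auto simp: g_def inv_deriv_def)

lemma cont: "i \<in> Q \<Longrightarrow> continuous_on (ival i) \<tau>"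
  using deriv(1) by (meson DERIV_continuous_on has_field_derivative_at_within)

lemma image_subset: "i \<in> Q \<Longrightarrow> \<tau> ` ival i \<subseteq> {0..1}"
proof
  fix y assume "i \<in> Q" "y \<in> \<tau> ` ival i"
  then obtain x where "x \<in> {0..1}" "y = \<tau> x" using ival_subset by blast
  then show "y \<in> {0..1}" using measurable_space[OF meas, of x] by simp
qed

lemma image_open: "i \<in> Q \<Longrightarrow> open (\<tau> ` ival i)"
  using injective_eq_1d_open_map_UNIV[OF cont, of i] deriv(3)[of i] by auto

lemma preim: "i \<in> Q \<Longrightarrow> x \<in> \<tau> ` ival i \<Longrightarrow> preim \<tau> i x \<in> ival i"
    "i \<in> Q \<Longrightarrow> x \<in> \<tau> ` ival i \<Longrightarrow> \<tau> (preim \<tau> i x) = x"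
    "i \<in> Q \<Longrightarrow> y \<in> ival i \<Longrightarrow> preim \<tau> i (\<tau> y) = y"
  using deriv(3)[of i] by (auto simp: preim_def the_inv_into_f_f)

lemma preim_inj: "i \<in> Q \<Longrightarrow> inj_on (preim \<tau> i) (\<tau> ` ival i)"
  by (auto simp: inj_on_def preim)

lemma preim_cont: "i \<in> Q \<Longrightarrow> continuous_on (\<tau> ` ival i) (preim \<tau> i)"
proof -
  assume i: "i \<in> Q"
  obtain \<sigma> where "homeomorphism (ival i) (\<tau> ` ival i) \<tau> \<sigma>"
    using injective_into_1d_eq_homeomorphism[OF cont[OF i]] deriv(3)[OF i] by auto
  then have "continuous_on (\<tau> ` ival i) \<sigma>" "\<And>x. x \<in> \<tau> ` ival i \<Longrightarrow> \<sigma> x = preim \<tau> i x"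
    by (auto simp: homeomorphism_def preim i)
  then show ?thesis by (simp cong: continuous_on_cong)
qed

lemma preim_deriv:
  assumes i: "i \<in> Q" and x: "x \<in> \<tau> ` ival i"
  shows "(preim \<tau> i has_field_derivative inverse (deriv \<tau> (preim \<tau> i x))) (at x)"
proof -
  obtain e where e: "e > 0" "ball x e \<subseteq> \<tau> ` ival i"
    using image_open[OF i] x by (auto simp: open_contains_ball)
  have ball: "ball x e = {x - e<..<x + e}" by (auto simp: dist_real_def)
  show ?thesis
  proof (rule DERIV_inverse_function[where f = \<tau> and a = "x - e" and b = "x + e"])
    show "DERIV \<tau> (preim \<tau> i x) :> deriv \<tau> (preim \<tau> i x)" "deriv \<tau> (preim \<tau> i x) \<noteq> 0"
      using deriv(1,2)[OF i preim(1)[OF i x]] by auto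
    show "\<tau> (preim \<tau> i y) = y" if "x - e < y" "y < x + e" for y
      using e(2) that i unfolding ball by (intro preim) auto
    show "isCont (preim \<tau> i) x"
      using preim_cont[OF i] continuous_on_eq_continuous_at[OF image_open[OF i]] x by blast
  qed (use e in auto)
qed

text \<open>
  On the intervals of the partition the derivative is a pointwise limit of difference quotients of
  \<open>\<tau>\<close>, cut off outside of the unit interval, where nothing is known about
  \<open>\<tau>\<close>.
\<close>
lemma g_measurable: "g \<in> borel_measurable mI"
proof -
  define \<tau>' where "\<tau>' x = \<tau> x * indicator {0..1} x" for x
  have "\<tau> \<in> borel_measurable mI"
    using measurable_comp[OF meas, of "\<lambda>x. x" borel] by (simp add: measurable_mI comp_def)
  then have [measurable]: "\<tau>' \<in> borel_measurable borel"
    unfolding mI_def \<tau>'_def by (subst (asm) borel_measurable_restrict_space_iff) (auto simp: mult.commute)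
  define D where "D x = lim (\<lambda>n. (\<tau>' (x + 1 / real (Suc n)) - \<tau>' x) * real (Suc n))" for x
  have D: "D x = deriv \<tau> x" if i: "i \<in> Q" "x \<in> ival i" for i x
  proof -
    have "eventually (\<lambda>y. y \<in> ival i) (nhds x)" using i(2) by (intro eventually_nhds_in_open) auto
    then have ev: "eventually (\<lambda>y. \<tau> y = \<tau>' y) (nhds x)"
      by eventually_elim (use ival_subset[OF i(1)] in \<open>auto simp: \<tau>'_def\<close>)
    have "(\<tau>' has_field_derivative deriv \<tau> x) (at x)"
      using deriv(1)[OF i] DERIV_cong_ev[OF refl ev refl] by simp
    then have lim: "((\<lambda>h. (\<tau>' (x + h) - \<tau>' x) / h) \<longlongrightarrow> deriv \<tau> x) (at 0)"
      by (simp add: DERIV_def)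
    have "filterlim (\<lambda>n. 1 / real (Suc n)) (at 0) sequentially"
      using lim_1_over_n[THEN LIMSEQ_Suc] by (auto simp: filterlim_at)
    from filterlim_compose[OF lim this]
    have "(\<lambda>n. (\<tau>' (x + 1 / real (Suc n)) - \<tau>' x) * real (Suc n)) \<longlonglongrightarrow> deriv \<tau> x" by simp
    then show ?thesis unfolding D_def by (rule limI)
  qed
  have "(\<Union>i\<in>Q. ival i) \<in> sets borel" by (intro sets.countable_UN'' cntbl) auto
  moreover have "D \<in> borel_measurable borel" unfolding D_def by measurable
  ultimately have "(\<lambda>x. if x \<in> (\<Union>i\<in>Q. ival i) then 1 / \<bar>D x\<bar> else 0) \<in> borel_measurable borel"
    by measurable
  moreover have "(if x \<in> (\<Union>i\<in>Q. ival i) then 1 / \<bar>D x\<bar> else 0) = g x" for x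
    by (auto simp: g_def inv_deriv_def D)
  ultimately show ?thesis by (simp add: measurable_mI)
qed

text \<open>
  The contribution of the \<open>i\<close>-th branch to the transfer operator of \<open>\<tau>\<close>.
  Branches without a preimage of \<open>x\<close> contribute \<open>0\<close>, so that all the sums run over
  the same index set.
\<close>
definition branch_term :: "(real \<Rightarrow> real) \<Rightarrow> real \<times> real \<Rightarrow> real \<Rightarrow> real" where
  "branch_term q i x = (if x \<in> \<tau> ` ival i then g (preim \<tau> i x) * q (preim \<tau> i x) else 0)"

lemma preim_measurable: "i \<in> Q \<Longrightarrow> preim \<tau> i \<in> measurable (restrict_space mI (\<tau> ` ival i)) mI"
proof -
  assume i: "i \<in> Q"
  have "preim \<tau> i \<in> measurable (restrict_space borel (\<tau> ` ival i)) borel"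
    by (rule borel_measurable_continuous_on_restrict[OF preim_cont[OF i]])
  then have "preim \<tau> i \<in> measurable (restrict_space borel (\<tau> ` ival i)) (restrict_space borel {0..1})"
    using ival_subset[OF i] preim(1)[OF i]
    by (intro measurable_restrict_space2) (fastforce simp: space_restrict_space)+
  moreover have "sets (restrict_space mI (\<tau> ` ival i)) = sets (restrict_space borel (\<tau> ` ival i))"
    using image_subset[OF i] image_open[OF i]
    by (auto simp: mI_def restrict_restrict_space Int_absorb1 intro!: sets_restrict_space_cong)
  moreover have "sets mI = sets (restrict_space borel {0..1})"
    by (auto simp: mI_def intro!: sets_restrict_space_cong)
  ultimately show ?thesis by (subst measurable_cong_sets) 
qed

lemma image_sets: "i \<in> Q \<Longrightarrow> \<tau> ` ival i \<in> sets mI"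
  using image_open image_subset by (simp add: sets_mI)

lemma branch_term_measurable:
  assumes q: "q \<in> borel_measurable mI" and i: "i \<in> Q"
  shows "branch_term q i \<in> borel_measurable mI"
proof -
  have s: "{x \<in> space mI. x \<in> \<tau> ` ival i} \<in> sets mI"
  proof -
    have "{x \<in> space mI. x \<in> \<tau> ` ival i} = \<tau> ` ival i" using image_subset[OF i] by auto
    then show ?thesis using image_sets[OF i] by simp
  qed
  show ?thesis unfolding branch_term_def
    by (subst measurable_If_restrict_space_iff[OF s])
      (auto intro!: borel_measurable_times measurable_compose[OF preim_measurable[OF i]] g_measurable q)
qed

text \<open>
  The change of variables for the inverse branch, whose derivative is \<open>1 / \<tau>'\<close>. The
  derivative need not be continuous, so this is the formula for injective differentiable maps. Indicators
  \<open>E\<close> suffice, since they determine a measure.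
\<close>
lemma emeasure_branch:
  assumes i: "i \<in> Q" and E: "E \<in> sets borel" "E \<subseteq> ival i"
  shows "(\<integral>\<^sup>+x. ennreal (branch_term (indicator E) i x) \<partial>mI) = emeasure lborel E"
proof -
  define S where "S = \<tau> ` E"
  have Sp: "S = {x \<in> \<tau> ` ival i. preim \<tau> i x \<in> E}"
    using E(2) by (auto simp: S_def preim[OF i])
  have pE: "preim \<tau> i ` S = E"
    using E(2) unfolding S_def by (force simp: preim[OF i] image_iff)
  have bte: "branch_term (indicator E) i x = indicator S x * \<bar>inverse (deriv \<tau> (preim \<tau> i x))\<bar>" for x
    by (auto simp: branch_term_def Sp g_ival[OF i] preim[OF i] indicator_def abs_inverse divide_inverse)
  have indm: "(indicator E :: real \<Rightarrow> real) \<in> borel_measurable mI" using E by (intro measurable_mI) auto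
  have Smi: "S \<in> sets mI"
  proof -
    have "preim \<tau> i -` E \<inter> space (restrict_space mI (\<tau> ` ival i)) \<in> sets (restrict_space mI (\<tau> ` ival i))"
      by (rule measurable_sets[OF preim_measurable[OF i]]) (use E ival_subset[OF i] in \<open>auto simp: sets_mI\<close>)
    moreover have "preim \<tau> i -` E \<inter> space (restrict_space mI (\<tau> ` ival i)) = S"
      using image_subset[OF i] by (auto simp: space_restrict_space Sp)
    ultimately show ?thesis
      using image_sets[OF i] by (auto simp: sets_restrict_space)
  qed
  then have Sb: "S \<in> sets borel" "S \<subseteq> {0..1}" by (auto simp: sets_mI)
  have Efin: "emeasure lborel E < \<infinity>"
  proof -
    have "emeasure lborel E \<le> emeasure lborel (ival i)" by (rule emeasure_mono) (use E in auto)
    also have "\<dots> < \<infinity>" by (simp add: ival_def emeasure_lborel_Ioo bounds[OF i] less_imp_le)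
    finally show ?thesis .
  qed
  have lm: "E \<in> lmeasurable" using E(1) Efin by (simp add: fmeasurable_def)
  have "(\<lambda>x. \<bar>inverse (deriv \<tau> (preim \<tau> i x))\<bar> * (\<lambda>_. 1) (preim \<tau> i x)) absolutely_integrable_on S \<and>
        integral S (\<lambda>x. \<bar>inverse (deriv \<tau> (preim \<tau> i x))\<bar> * (\<lambda>_. 1) (preim \<tau> i x)) = measure lebesgue E"
  proof (rule has_absolute_integral_change_of_variables_1'[of S "preim \<tau> i"
      "\<lambda>x. inverse (deriv \<tau> (preim \<tau> i x))" "\<lambda>_. 1" "measure lebesgue E", THEN iffD2])
    show "S \<in> sets lebesgue" using Sb by simp
    show "(preim \<tau> i has_field_derivative inverse (deriv \<tau> (preim \<tau> i x))) (at x within S)" if "x \<in> S" for x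
      using preim_deriv[OF i] that by (auto simp: Sp intro: has_field_derivative_at_within)
    show "inj_on (preim \<tau> i) S" by (rule inj_on_subset[OF preim_inj[OF i]]) (auto simp: Sp)
    show "(\<lambda>_. 1 :: real) absolutely_integrable_on preim \<tau> i ` S \<and>
          integral (preim \<tau> i ` S) (\<lambda>_. 1) = measure lebesgue E"
      unfolding pE using lm by (simp add: lmeasure_integral absolutely_integrable_on_const)
  qed
  then have ai: "(\<lambda>x. \<bar>inverse (deriv \<tau> (preim \<tau> i x))\<bar>) absolutely_integrable_on S"
    and int: "integral S (\<lambda>x. \<bar>inverse (deriv \<tau> (preim \<tau> i x))\<bar>) = measure lebesgue E" by auto
  have "(\<integral>\<^sup>+x. ennreal (branch_term (indicator E) i x) \<partial>mI) =
        (\<integral>\<^sup>+x. ennreal (indicator S x * \<bar>inverse (deriv \<tau> (preim \<tau> i x))\<bar>) \<partial>lborel)"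
    unfolding nn_integral_mI bte using Sb by (intro nn_integral_cong) (auto simp: indicator_def)
  also have "\<dots> = (\<integral>\<^sup>+x. ennreal (indicator S x * \<bar>inverse (deriv \<tau> (preim \<tau> i x))\<bar>) \<partial>lebesgue)"
    by (simp add: nn_integral_completion)
  also have "\<dots> = ennreal (\<integral>x. indicator S x * \<bar>inverse (deriv \<tau> (preim \<tau> i x))\<bar> \<partial>lebesgue)"
    using ai by (intro nn_integral_eq_integral) (auto simp: set_integrable_def)
  also have "(\<integral>x. indicator S x * \<bar>inverse (deriv \<tau> (preim \<tau> i x))\<bar> \<partial>lebesgue) = measure lebesgue E"
    using set_lebesgue_integral_eq_integral(2)[OF ai] int by (simp add: set_lebesgue_integral_def)
  also have "ennreal (measure lebesgue E) = emeasure lborel E"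
    using Efin E(1) by (simp add: emeasure_eq_ennreal_measure measure_completion)
  finally show ?thesis .
qed

lemma nn_integral_branch:
  assumes i: "i \<in> Q" and q: "q \<in> borel_measurable mI"
  shows "(\<integral>\<^sup>+x. ennreal (branch_term (\<lambda>_. 1) i x) * q (preim \<tau> i x) \<partial>mI) = (\<integral>\<^sup>+x. q x * indicator (ival i) x \<partial>mI)"
proof -
  define N where "N = distr (density (restrict_space mI (\<tau> ` ival i)) (\<lambda>x. ennreal (branch_term (\<lambda>_. 1) i x))) mI (preim \<tau> i)"
  have btm: "branch_term (\<lambda>_. 1) i \<in> borel_measurable mI" by (rule branch_term_measurable[OF _ i]) simp
  have btr [measurable]: "branch_term (\<lambda>_. 1) i \<in> borel_measurable (restrict_space mI (\<tau> ` ival i))"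
    by (rule measurable_restrict_space1[OF btm])
  have pm [measurable]: "preim \<tau> i \<in> measurable (restrict_space mI (\<tau> ` ival i)) mI"
    by (rule preim_measurable[OF i])
  have bt0: "branch_term (\<lambda>_. 1) i x = 0" if "x \<notin> \<tau> ` ival i" for x using that by (simp add: branch_term_def)
  have im: "\<tau> ` ival i \<inter> space mI \<in> sets mI"
    using image_sets[OF i] image_subset[OF i] by (simp add: Int_absorb2)
  have im': "\<tau> ` ival i \<in> sets mI" "\<tau> ` ival i \<subseteq> {0..1}" by (rule image_sets[OF i], rule image_subset[OF i])
  have ism: "ival i \<in> sets mI" using ival_subset[OF i] by (simp add: sets_mI)
  have N: "N = density mI (indicator (ival i))"
  proof (rule measure_eqI)
    show "sets N = sets (density mI (indicator (ival i)))" by (simp add: N_def)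
    fix A assume "A \<in> sets N"
    then have A: "A \<in> sets mI" by (simp add: N_def)
    have "emeasure N A = (\<integral>\<^sup>+x. ennreal (branch_term (\<lambda>_. 1) i x) * indicator (preim \<tau> i -` A \<inter> \<tau> ` ival i) x \<partial>restrict_space mI (\<tau> ` ival i))"
      unfolding N_def using A measurable_sets[OF pm A] im'(2)
      by (subst emeasure_distr) (auto simp: emeasure_density space_restrict_space Int_absorb2)
    also have "\<dots> = (\<integral>\<^sup>+x. ennreal (branch_term (\<lambda>_. 1) i x) * indicator (preim \<tau> i -` A \<inter> \<tau> ` ival i) x * indicator (\<tau> ` ival i) x \<partial>mI)"
      by (rule nn_integral_restrict_space[OF im])
    also have "\<dots> = (\<integral>\<^sup>+x. ennreal (branch_term (indicator (A \<inter> ival i)) i x) \<partial>mI)"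
    proof (rule nn_integral_cong)
      fix x
      show "ennreal (branch_term (\<lambda>_. 1) i x) * indicator (preim \<tau> i -` A \<inter> \<tau> ` ival i) x * indicator (\<tau> ` ival i) x
        = ennreal (branch_term (indicator (A \<inter> ival i)) i x)"
        using preim(1)[OF i, of x] by (auto simp: branch_term_def indicator_def)
    qed
    also have "\<dots> = emeasure lborel (A \<inter> ival i)"
      using A by (intro emeasure_branch[OF i]) (auto simp: sets_mI)
    also have "\<dots> = emeasure (density mI (indicator (ival i))) A"
    proof -
      have "emeasure (density mI (indicator (ival i))) A = (\<integral>\<^sup>+x. indicator (ival i) x * indicator A x \<partial>mI)"
        using A ism by (intro emeasure_density) auto
      also have "\<dots> = (\<integral>\<^sup>+x. indicator (A \<inter> ival i) x \<partial>mI)"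
        by (intro nn_integral_cong) (auto simp: indicator_def)
      also have "\<dots> = emeasure mI (A \<inter> ival i)" using A ism by simp
      also have "\<dots> = emeasure lborel (A \<inter> ival i)" using ival_subset[OF i] by (intro emeasure_mI) auto
      finally show ?thesis by simp
    qed
    finally show "emeasure N A = emeasure (density mI (indicator (ival i))) A" .
  qed
  have "(\<integral>\<^sup>+x. ennreal (branch_term (\<lambda>_. 1) i x) * q (preim \<tau> i x) \<partial>mI) =
     (\<integral>\<^sup>+x. ennreal (branch_term (\<lambda>_. 1) i x) * q (preim \<tau> i x) * indicator (\<tau> ` ival i) x \<partial>mI)"
    by (rule nn_integral_cong) (auto simp: indicator_def bt0)
  also have "\<dots> = (\<integral>\<^sup>+x. ennreal (branch_term (\<lambda>_. 1) i x) * q (preim \<tau> i x) \<partial>restrict_space mI (\<tau> ` ival i))"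
    by (rule nn_integral_restrict_space[OF im, symmetric])
  also have "\<dots> = (\<integral>\<^sup>+x. q x \<partial>N)"
    unfolding N_def using q by (simp add: nn_integral_distr nn_integral_density)
  also have "\<dots> = (\<integral>\<^sup>+x. q x * indicator (ival i) x \<partial>mI)"
    unfolding N using q ism by (subst nn_integral_density) (auto simp: mult.commute)
  finally show ?thesis .
qed

lemma nn_integral_ival_sum:
  assumes q: "q \<in> borel_measurable mI"
  shows "(\<integral>\<^sup>+i. (\<integral>\<^sup>+x. q x * indicator (ival i) x \<partial>mI) \<partial>count_space Q) = (\<integral>\<^sup>+x. q x \<partial>mI)"
proof -
  have ism: "ival i \<in> sets mI" if "i \<in> Q" for i using ival_subset[OF that] by (simp add: sets_mI)
  have "(\<integral>\<^sup>+i. (\<integral>\<^sup>+x. q x * indicator (ival i) x \<partial>mI) \<partial>count_space Q) =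
     (\<integral>\<^sup>+x. (\<integral>\<^sup>+i. q x * indicator (ival i) x \<partial>count_space Q) \<partial>mI)"
    by (rule nn_integral_count_space_nn_integral[OF cntbl, symmetric]) (use q ism in auto)
  also have "\<dots> = (\<integral>\<^sup>+x. q x \<partial>mI)"
  proof (rule nn_integral_cong_AE)
    show "AE x in mI. (\<integral>\<^sup>+i. q x * indicator (ival i) x \<partial>count_space Q) = q x"
      using AE_ival
    proof eventually_elim
      fix x assume "x \<in> (\<Union>i\<in>Q. ival i)"
      then obtain j where j: "j \<in> Q" "x \<in> ival j" by auto
      have "(\<integral>\<^sup>+i. q x * indicator (ival i) x \<partial>count_space Q) = (\<integral>\<^sup>+i. q x * indicator {j} i \<partial>count_space Q)"
        using disj j by (intro nn_integral_cong) (auto simp: indicator_def disjoint_family_on_def)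
      also have "\<dots> = q x" using j by (subst nn_integral_cmult) auto
      finally show "(\<integral>\<^sup>+i. q x * indicator (ival i) x \<partial>count_space Q) = q x" .
    qed
  qed
  finally show ?thesis .
qed

lemma branch_term_nonneg: "i \<in> Q \<Longrightarrow> (\<And>x. x \<in> {0..1} \<Longrightarrow> 0 \<le> q x) \<Longrightarrow> 0 \<le> branch_term q i x"
  using preim(1)[of i x] ival_subset[of i] by (auto simp: branch_term_def)

text \<open>
  The change of variables is summed over the branches, whose domains fill the unit interval up to a null set.
\<close>
lemma nn_integral_transfer:
  assumes q: "q \<in> borel_measurable mI" "\<And>x. x \<in> {0..1} \<Longrightarrow> 0 \<le> q x"
  shows "(\<integral>\<^sup>+x. (\<integral>\<^sup>+i. ennreal (branch_term q i x) \<partial>count_space Q) \<partial>mI) = (\<integral>\<^sup>+x. ennreal (q x) \<partial>mI)"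
proof -
  have "(\<integral>\<^sup>+x. (\<integral>\<^sup>+i. ennreal (branch_term q i x) \<partial>count_space Q) \<partial>mI) =
     (\<integral>\<^sup>+i. (\<integral>\<^sup>+x. ennreal (branch_term q i x) \<partial>mI) \<partial>count_space Q)"
    by (rule nn_integral_count_space_nn_integral[OF cntbl]) (use branch_term_measurable[OF q(1)] in auto)
  also have "\<dots> = (\<integral>\<^sup>+i. (\<integral>\<^sup>+x. ennreal (q x) * indicator (ival i) x \<partial>mI) \<partial>count_space Q)"
  proof (rule nn_integral_cong)
    fix i assume "i \<in> space (count_space Q)"
    then have i: "i \<in> Q" by simp
    have "ennreal (branch_term q i x) = ennreal (branch_term (\<lambda>_. 1) i x) * ennreal (q (preim \<tau> i x))" for x
      by (simp add: branch_term_def ennreal_mult')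
    then show "(\<integral>\<^sup>+x. ennreal (branch_term q i x) \<partial>mI) = (\<integral>\<^sup>+x. ennreal (q x) * indicator (ival i) x \<partial>mI)"
      using nn_integral_branch[OF i, of "\<lambda>x. ennreal (q x)"] q(1) by simp
  qed
  also have "\<dots> = (\<integral>\<^sup>+x. ennreal (q x) \<partial>mI)"
    by (rule nn_integral_ival_sum) (use q in auto)
  finally show ?thesis .
qed

definition pushforward :: "(real \<Rightarrow> real) \<Rightarrow> real \<Rightarrow> real" where
  "pushforward q x = (\<Sum>\<^sub>\<infinity>i\<in>Q. branch_term q i x)"

lemma summable_iff_nn_integral:
  fixes t :: "real \<times> real \<Rightarrow> real"
  assumes "\<And>i. i \<in> Q \<Longrightarrow> 0 \<le> t i"
  shows "t summable_on Q \<longleftrightarrow> (\<integral>\<^sup>+i. ennreal (t i) \<partial>count_space Q) < \<infinity>" (is ?iff)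
    and "infsum t Q = enn2real (\<integral>\<^sup>+i. ennreal (t i) \<partial>count_space Q)"
proof -
  have ab: "(\<lambda>x. norm (t x)) summable_on Q \<longleftrightarrow> t summable_on Q"
    by (rule summable_on_cong) (use assms in auto)
  have "(\<lambda>x. norm (t x)) summable_on Q \<longleftrightarrow> integrable (count_space Q) t"
    using abs_summable_equivalent[of t Q] by (simp add: Infinite_Set_Sum.abs_summable_on_def)
  moreover have "integrable (count_space Q) t \<longleftrightarrow> (\<integral>\<^sup>+i. ennreal (norm (t i)) \<partial>count_space Q) < \<infinity>"
    by (simp add: integrable_iff_bounded)
  moreover have "(\<integral>\<^sup>+i. ennreal (norm (t i)) \<partial>count_space Q) = (\<integral>\<^sup>+i. ennreal (t i) \<partial>count_space Q)"
    by (rule nn_integral_cong) (use assms in auto)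
  ultimately show iff: ?iff using ab by simp
  show "infsum t Q = enn2real (\<integral>\<^sup>+i. ennreal (t i) \<partial>count_space Q)"
  proof (cases "t summable_on Q")
    case True
    then have "Infinite_Set_Sum.abs_summable_on t Q" using abs_summable_equivalent[of t Q] ab by simp
    then have "infsum t Q = infsetsum t Q" by (simp add: infsetsum_infsum)
    also have "\<dots> = enn2real (\<integral>\<^sup>+i. ennreal (t i) \<partial>count_space Q)"
      by (rule infsetsum_conv_nn_integral) (use True iff assms in auto)
    finally show ?thesis .
  next
    case False
    then have "(\<integral>\<^sup>+i. ennreal (t i) \<partial>count_space Q) = top" using iff by (simp add: not_less top_unique)
    then show ?thesis using False by (simp add: infsum_not_exists)
  qed
qed

text \<open>
  For nonnegative \<open>q\<close> the sum over the branches may be computed in the extended nonnegative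
  reals; where it diverges, both the real infinite sum and \<open>enn2real\<close> return \<open>0\<close>,
  which makes \<open>pushforward q\<close> measurable everywhere.
\<close>
lemma pushforward_nonneg_props:
  assumes q: "integrable mI q" "\<And>x. x \<in> {0..1} \<Longrightarrow> 0 \<le> q x"
  shows "AE x in mI. (\<lambda>i. branch_term q i x) summable_on Q"
    and "integrable mI (pushforward q)" and "(\<integral>x. pushforward q x \<partial>mI) = (\<integral>x. q x \<partial>mI)"
    and "\<And>x. 0 \<le> pushforward q x"
proof -
  define S where "S x = (\<integral>\<^sup>+i. ennreal (branch_term q i x) \<partial>count_space Q)" for x
  have qm: "q \<in> borel_measurable mI" using q(1) by auto
  have nn: "0 \<le> branch_term q i x" if "i \<in> Q" for i x by (rule branch_term_nonneg[OF that q(2)])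
  have Sm [measurable]: "S \<in> borel_measurable mI"
    unfolding S_def by (rule borel_measurable_nn_integral_count_space) (use branch_term_measurable[OF qm] cntbl in auto)
  have int: "(\<integral>\<^sup>+x. S x \<partial>mI) = (\<integral>\<^sup>+x. ennreal (q x) \<partial>mI)"
    unfolding S_def by (rule nn_integral_transfer[OF qm q(2)])
  also have qint: "\<dots> = ennreal (\<integral>x. q x \<partial>mI)"
    by (rule nn_integral_eq_integral[OF q(1)]) (use q(2) in auto)
  finally have int': "(\<integral>\<^sup>+x. S x \<partial>mI) = ennreal (\<integral>x. q x \<partial>mI)" .
  then have fin: "AE x in mI. S x \<noteq> \<infinity>" by (intro nn_integral_PInf_AE) auto
  then show "AE x in mI. (\<lambda>i. branch_term q i x) summable_on Q"
    by eventually_elim (use nn in \<open>simp add: summable_iff_nn_integral(1) S_def top.not_eq_extremum\<close>)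
  have pS: "pushforward q x = enn2real (S x)" for x
    unfolding pushforward_def S_def by (rule summable_iff_nn_integral(2)) (use nn in auto)
  then show "0 \<le> pushforward q x" for x by simp
  have pm: "pushforward q \<in> borel_measurable mI" unfolding pS[abs_def] by measurable
  have "(\<integral>\<^sup>+x. ennreal (pushforward q x) \<partial>mI) = (\<integral>\<^sup>+x. S x \<partial>mI)"
  proof (rule nn_integral_cong_AE)
    show "AE x in mI. ennreal (pushforward q x) = S x"
      using fin by eventually_elim (simp add: pS top.not_eq_extremum)
  qed
  then have pi: "(\<integral>\<^sup>+x. ennreal (pushforward q x) \<partial>mI) = ennreal (\<integral>x. q x \<partial>mI)" using int' by simp
  have "integrable mI (pushforward q) \<and> (\<integral>x. pushforward q x \<partial>mI) = (\<integral>x. q x \<partial>mI)"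
  proof (intro conjI)
    have pn: "0 \<le> pushforward q x" for x by (simp add: pS)
    show "integrable mI (pushforward q)" using pn by (intro integrableI_nonneg[OF pm]) (auto simp: pi)
    have "0 \<le> (\<integral>x. q x \<partial>mI)" using q(2) by (intro Bochner_Integration.integral_nonneg_AE AE_I2) simp
    then show "(\<integral>x. pushforward q x \<partial>mI) = (\<integral>x. q x \<partial>mI)"
      using pn by (subst integral_eq_nn_integral[OF pm]) (auto simp: pi)
  qed
  then show "integrable mI (pushforward q)" "(\<integral>x. pushforward q x \<partial>mI) = (\<integral>x. q x \<partial>mI)" by auto
qed

text \<open>
  The transfer of the indicator of a null set has integral \<open>0\<close>, and its terms have positive
  weights. Hence almost no point has a preimage in the null set.
\<close>
lemma AE_pullback:
  assumes "AE x in mI. R x"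
  shows "AE x in mI. \<forall>i\<in>Q. x \<in> \<tau> ` ival i \<longrightarrow> R (preim \<tau> i x)"
proof -
  obtain N where N: "{x \<in> space mI. \<not> R x} \<subseteq> N" "emeasure mI N = 0" "N \<in> sets mI" using assms by (rule AE_E)
  have Nm: "(indicator N :: real \<Rightarrow> real) \<in> borel_measurable mI" using N by simp
  have "(\<integral>\<^sup>+x. (\<integral>\<^sup>+i. ennreal (branch_term (indicator N) i x) \<partial>count_space Q) \<partial>mI) = 0"
    using N by (subst nn_integral_transfer) (auto simp: ennreal_indicator)
  then have "AE x in mI. (\<integral>\<^sup>+i. ennreal (branch_term (indicator N) i x) \<partial>count_space Q) = 0"
    by (subst (asm) nn_integral_0_iff_AE)
      (use branch_term_measurable[OF Nm] cntbl in \<open>auto intro!: borel_measurable_nn_integral_count_space\<close>)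
  then show ?thesis
  proof eventually_elim
    fix x assume "(\<integral>\<^sup>+i. ennreal (branch_term (indicator N) i x) \<partial>count_space Q) = 0"
    then have z: "branch_term (indicator N) i x \<le> 0" if "i \<in> Q" for i
      using that by (auto simp: nn_integral_0_iff_AE AE_count_space ennreal_eq_0_iff)
    show "\<forall>i\<in>Q. x \<in> \<tau> ` ival i \<longrightarrow> R (preim \<tau> i x)"
    proof (intro ballI impI)
      fix i assume i: "i \<in> Q" "x \<in> \<tau> ` ival i"
      have "preim \<tau> i x \<notin> N"
        using z[OF i(1)] g_pos[OF i(1) preim(1)[OF i]] i(2) by (auto simp: branch_term_def)
      moreover have "preim \<tau> i x \<in> space mI" using preim(1)[OF i] ival_subset[OF i(1)] by auto
      ultimately show "R (preim \<tau> i x)" using N(1) by blast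
    qed
  qed
qed

text \<open>
  Properties that hold almost everywhere are needed at all preimages of all orders at once; \<open>J\<close>
  consists of the points all of whose iterated preimages satisfy \<open>R\<close>. It need not be measurable.
\<close>
lemma backward_closed_set:
  assumes "AE x in mI. R x"
  obtains J where "AE x in mI. x \<in> J" "\<And>x. x \<in> J \<Longrightarrow> R x" "J \<subseteq> {0..1}"
    "\<And>x i. x \<in> J \<Longrightarrow> i \<in> Q \<Longrightarrow> x \<in> \<tau> ` ival i \<Longrightarrow> preim \<tau> i x \<in> J"
proof -
  define K where "K = rec_nat {x \<in> {0..1}. R x} (\<lambda>_ A. {x \<in> A. \<forall>i\<in>Q. x \<in> \<tau> ` ival i \<longrightarrow> preim \<tau> i x \<in> A})"
  have K0: "K 0 = {x \<in> {0..1}. R x}"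
    and KS: "K (Suc n) = {x \<in> K n. \<forall>i\<in>Q. x \<in> \<tau> ` ival i \<longrightarrow> preim \<tau> i x \<in> K n}" for n
    by (simp_all add: K_def)
  have AEK: "AE x in mI. x \<in> K n" for n
  proof (induction n)
    case 0 show ?case using assms AE_space by eventually_elim (auto simp: K0)
  next
    case (Suc n) show ?case using Suc AE_pullback[OF Suc] by eventually_elim (auto simp: KS)
  qed
  show ?thesis
  proof (rule that[of "\<Inter>n. K n"])
    show "AE x in mI. x \<in> (\<Inter>n. K n)" using AEK by (simp add: AE_all_countable)
    show "R x" if "x \<in> (\<Inter>n. K n)" for x using that K0 by auto
    show "(\<Inter>n. K n) \<subseteq> {0..1}" using K0 by auto
    show "preim \<tau> i x \<in> (\<Inter>n. K n)" if x: "x \<in> (\<Inter>n. K n)" and "i \<in> Q" "x \<in> \<tau> ` ival i" for x i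
    proof
      fix n have "x \<in> K (Suc n)" using x by blast
      then show "preim \<tau> i x \<in> K n" using that(2,3) by (simp add: KS)
    qed
  qed
qed

text \<open>
  The image of a branch has length at most \<open>1\<close>, and it is the integral over the interval of
  \<open>1 / g\<close>, which is almost everywhere at least \<open>1 / s\<close>.
\<close>
lemma length_le_esssup:
  assumes i: "i \<in> Q" and s: "AE x in mI. g x \<le> s"
  shows "snd i - fst i \<le> s"
proof -
  have gm [measurable]: "g \<in> borel_measurable mI" by (rule g_measurable)
  have ism: "ival i \<in> sets mI" using ival_subset[OF i] by (simp add: sets_mI)
  have len: "emeasure mI (ival i) = ennreal (snd i - fst i)"
    using bounds[OF i] ival_subset[OF i] by (simp add: emeasure_mI) (simp add: ival_def less_imp_le)
  have "ennreal (snd i - fst i) = (\<integral>\<^sup>+x. indicator (ival i) x \<partial>mI)" using len ism by simp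
  also have "\<dots> \<le> (\<integral>\<^sup>+x. ennreal s * (ennreal (1 / g x) * indicator (ival i) x) \<partial>mI)"
  proof (rule nn_integral_mono_AE)
    show "AE x in mI. indicator (ival i) x \<le> ennreal s * (ennreal (1 / g x) * indicator (ival i) x)"
      using s
    proof eventually_elim
      fix x assume "g x \<le> s"
      show "indicator (ival i) x \<le> ennreal s * (ennreal (1 / g x) * indicator (ival i) x)"
      proof (cases "x \<in> ival i")
        case True
        then have "1 \<le> s * (1 / g x)" using g_pos[OF i True] \<open>g x \<le> s\<close> by (simp add: field_simps)
        then have "ennreal 1 \<le> ennreal (s * (1 / g x))" by (rule ennreal_leI)
        then show ?thesis using True g_pos[OF i True] \<open>g x \<le> s\<close> by (simp add: ennreal_mult''[symmetric])
      qed simp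
    qed
  qed
  also have "\<dots> = ennreal s * (\<integral>\<^sup>+x. ennreal (1 / g x) * indicator (ival i) x \<partial>mI)"
    using ism by (intro nn_integral_cmult) auto
  also have "(\<integral>\<^sup>+x. ennreal (1 / g x) * indicator (ival i) x \<partial>mI) = 
      (\<integral>\<^sup>+x. ennreal (branch_term (\<lambda>_. 1) i x) * ennreal (1 / g (preim \<tau> i x)) \<partial>mI)"
    by (rule nn_integral_branch[OF i, symmetric]) simp
  also have "\<dots> \<le> (\<integral>\<^sup>+x. 1 \<partial>mI)"
  proof (rule nn_integral_mono)
    fix x show "ennreal (branch_term (\<lambda>_. 1) i x) * ennreal (1 / g (preim \<tau> i x)) \<le> 1"
      using g_pos[OF i preim(1)[OF i]] by (auto simp: branch_term_def ennreal_mult'[symmetric])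
  qed
  also have "\<dots> = 1" using prob_space.emeasure_space_1[OF prob_space_mI] by simp
  finally have "ennreal (snd i - fst i) \<le> ennreal s * 1" by (simp add: mult_left_mono)
  moreover have "0 < snd i - fst i" using bounds(2)[OF i] by simp
  ultimately show ?thesis by (simp add: ennreal_le_iff2)
qed

end

section \<open>A Lasota-Yorke inequality for paths of functionals\<close>

lemma infsum_dominated:
  fixes f b :: "'i \<Rightarrow> real"
  assumes "b summable_on A" "\<And>i. i \<in> A \<Longrightarrow> \<bar>f i\<bar> \<le> b i"
  shows "f summable_on A" "\<bar>infsum f A\<bar> \<le> infsum b A"
proof -
  show s: "f summable_on A"
    by (rule abs_summable_summable, rule Infinite_Sum.abs_summable_on_comparison_test'[OF assms(1)]) (use assms(2) in simp)
  show "\<bar>infsum f A\<bar> \<le> infsum b A"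
    using norm_infsum_le[OF has_sum_infsum[OF s] has_sum_infsum[OF assms(1)]] assms(2) by simp
qed

lemma continuous_inj_strictly_monotone:
  fixes f :: "real \<Rightarrow> real"
  assumes "continuous_on {a<..<b} f" "inj_on f {a<..<b}"
  shows "strict_mono_on {a<..<b} f \<or> strict_antimono_on {a<..<b} f"
proof (rule ccontr)
  assume "\<not> ?thesis"
  then obtain u v u' v' where uv: "u \<in> {a<..<b}" "v \<in> {a<..<b}" "u < v" "\<not> f u < f v"
    and uv': "u' \<in> {a<..<b}" "v' \<in> {a<..<b}" "u' < v'" "\<not> f v' < f u'"
    by (auto simp: monotone_on_def)
  obtain c where c: "a < c" "c < u" "c < u'" using dense[of a "min u u'"] uv uv' by auto
  obtain d where d: "d < b" "v < d" "v' < d" using dense[of "max v v'" b] uv uv' by auto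
  have sub: "{x..y} \<subseteq> {a<..<b}" if "c \<le> x" "y \<le> d" for x y using that c d by auto
  have *: "(f x < f y \<and> f y < f z) \<or> (f z < f y \<and> f y < f x)" if "c \<le> x" "x < y" "y < z" "z \<le> d" for x y z
    by (rule continuous_inj_imp_mono[OF that(2,3)])
      (use sub[OF that(1,4)] assms in \<open>auto intro: continuous_on_subset inj_on_subset\<close>)
  have same: "f x < f y \<longleftrightarrow> f c < f d" if "c < x" "x < y" "y < d" for x y
    using *[of c x y] *[of c y d] that by force
  have "f u \<noteq> f v" "f u' \<noteq> f v'" 
    using inj_onD[OF assms(2), of u v] inj_onD[OF assms(2), of u' v'] uv uv' by auto
  then show False using same[of u v] same[of u' v'] uv uv' c d by auto
qed

text \<open>
  Outside of the interval \<open>X\<close> the extension takes the lower bound on the left and the upper bound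
  on the right.
\<close>
lemma mono_extension_of_interval:
  fixes p :: "real \<Rightarrow> real"
  assumes X: "is_interval X" and p: "\<And>x y. x \<in> X \<Longrightarrow> y \<in> X \<Longrightarrow> x \<le> y \<Longrightarrow> p x \<le> p y"
    and ab: "\<And>x. x \<in> X \<Longrightarrow> a \<le> p x \<and> p x \<le> b" "a \<le> b"
  obtains \<psi> where "mono \<psi>" "\<And>x. x \<in> X \<Longrightarrow> \<psi> x = p x" "\<And>x. x \<notin> X \<Longrightarrow> \<psi> x = a \<or> \<psi> x = b"
    "\<And>x. a \<le> \<psi> x \<and> \<psi> x \<le> b"
proof
  define \<psi> where "\<psi> x = (if x \<in> X then p x else if \<exists>z\<in>X. z < x then b else a)" for x
  show "x \<in> X \<Longrightarrow> \<psi> x = p x" "x \<notin> X \<Longrightarrow> \<psi> x = a \<or> \<psi> x = b" "a \<le> \<psi> x \<and> \<psi> x \<le> b" for x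
    using ab by (auto simp: \<psi>_def)
  show "mono \<psi>"
  proof (rule monoI)
    fix x y :: real assume xy: "x \<le> y"
    consider "x \<in> X" "y \<in> X" | "x \<in> X" "y \<notin> X" | "x \<notin> X" "y \<in> X" | "x \<notin> X" "y \<notin> X" by blast
    then show "\<psi> x \<le> \<psi> y"
    proof cases
      case 1 then show ?thesis using p xy by (simp add: \<psi>_def)
    next
      case 2
      then have "\<exists>z\<in>X. z < y" using xy by (metis order_le_less)
      then show ?thesis using 2 ab by (simp add: \<psi>_def)
    next
      case 3
      have "\<not> (\<exists>z\<in>X. z < x)"
        using 3 xy X unfolding is_interval_1 by (meson less_imp_le)
      then show ?thesis using 3 ab by (simp add: \<psi>_def)
    next
      case 4
      moreover have "(\<exists>z\<in>X. z < x) \<Longrightarrow> (\<exists>z\<in>X. z < y)" using xy order.strict_trans2 by blast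
      ultimately show ?thesis using ab(2) unfolding \<psi>_def by auto
    qed
  qed
qed

context branched begin

text \<open>
  The inverse branch is extended by the end points of the interval of the partition. A point without preimage
  is thus sent to a place where the weight \<open>g\<close> vanishes, and monotonicity is kept.
\<close>
lemma preim_extension:
  assumes i: "i \<in> Q"
  obtains \<psi> where "\<And>x. x \<in> \<tau> ` ival i \<Longrightarrow> \<psi> x = preim \<tau> i x"
    "\<And>x. x \<notin> \<tau> ` ival i \<Longrightarrow> \<psi> x = fst i \<or> \<psi> x = snd i"
    "\<And>x. fst i \<le> \<psi> x \<and> \<psi> x \<le> snd i" "mono \<psi> \<or> antimono \<psi>"
proof -
  let ?X = "\<tau> ` ival i" and ?p = "preim \<tau> i"
  have iv: "is_interval ?X"
    using connected_continuous_image[OF cont[OF i]] by (simp add: is_interval_connected_1)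
  have pin: "fst i \<le> ?p x" "?p x \<le> snd i" if "x \<in> ?X" for x
    using preim(1)[OF i that] by (auto simp: ival_def less_imp_le)
  consider (inc) "strict_mono_on (ival i) \<tau>" | (dec) "strict_antimono_on (ival i) \<tau>"
    using continuous_inj_strictly_monotone[of "fst i" "snd i" \<tau>] cont[OF i] deriv(3)[OF i]
    by (auto simp: ival_def)
  then show ?thesis
  proof cases
    case inc
    have pm: "?p x \<le> ?p y" if "x \<in> ?X" "y \<in> ?X" "x \<le> y" for x y
    proof (rule ccontr)
      assume "\<not> ?thesis"
      then have "\<tau> (?p y) < \<tau> (?p x)"
        using inc preim(1)[OF i that(1)] preim(1)[OF i that(2)] by (auto simp: monotone_on_def)
      then show False using that preim(2)[OF i] by simp
    qed
    obtain \<psi> where \<psi>: "mono \<psi>" "\<And>x. x \<in> ?X \<Longrightarrow> \<psi> x = ?p x" "\<And>x. x \<notin> ?X \<Longrightarrow> \<psi> x = fst i \<or> \<psi> x = snd i"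
      "\<And>x. fst i \<le> \<psi> x \<and> \<psi> x \<le> snd i"
      by (rule mono_extension_of_interval[OF iv pm, where a = "fst i" and b = "snd i"])
        (use pin bounds(2)[OF i] in auto)
    then show ?thesis by (intro that[of \<psi>]) auto
  next
    case dec
    have pm: "- ?p x \<le> - ?p y" if "x \<in> ?X" "y \<in> ?X" "x \<le> y" for x y
    proof (rule ccontr)
      assume "\<not> ?thesis"
      then have "\<tau> (?p y) < \<tau> (?p x)"
        using dec preim(1)[OF i that(1)] preim(1)[OF i that(2)] by (auto simp: monotone_on_def)
      then show False using that preim(2)[OF i] by simp
    qed
    obtain \<psi> where \<psi>: "mono \<psi>" "\<And>x. x \<in> ?X \<Longrightarrow> \<psi> x = - ?p x" "\<And>x. x \<notin> ?X \<Longrightarrow> \<psi> x = - snd i \<or> \<psi> x = - fst i"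
      "\<And>x. - snd i \<le> \<psi> x \<and> \<psi> x \<le> - fst i"
      by (rule mono_extension_of_interval[OF iv pm, where a = "- snd i" and b = "- fst i"])
        (use pin bounds(2)[OF i] in auto)
    have bd: "fst i \<le> - \<psi> x \<and> - \<psi> x \<le> snd i" for x using \<psi>(4)[of x] by linarith
    have "antimono (\<lambda>x. - \<psi> x)" using \<psi>(1) by (auto simp: monotone_def)
    moreover have "- \<psi> x = fst i \<or> - \<psi> x = snd i" if "x \<notin> ?X" for x using \<psi>(3)[OF that] by auto
    ultimately show ?thesis using \<psi>(2) bd by (intro that[of "\<lambda>x. - \<psi> x"]) auto
  qed
qed

text \<open>
  Along a monotone or antitone \<open>\<psi>\<close> the variation of \<open>W \<circ> \<psi>\<close>
  telescopes, and the total is at most the increment of \<open>W\<close> over the interval \<open>i\<close>.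
\<close>
lemma branch_increment:
  fixes W :: "real \<Rightarrow> real"
  assumes i: "i \<in> Q" and W: "mono W"
  obtains \<psi> V where "\<And>x. x \<in> \<tau> ` ival i \<Longrightarrow> \<psi> x = preim \<tau> i x"
    "\<And>x. x \<notin> \<tau> ` ival i \<Longrightarrow> \<psi> x = fst i \<or> \<psi> x = snd i"
    "mono V" "\<And>x. 0 \<le> V x" "\<And>x. V x \<le> W (snd i) - W (fst i)"
    "\<And>x y. x \<le> y \<Longrightarrow> \<bar>W (\<psi> y) - W (\<psi> x)\<bar> = V y - V x"
proof -
  obtain \<psi> where \<psi>: "\<And>x. x \<in> \<tau> ` ival i \<Longrightarrow> \<psi> x = preim \<tau> i x"
    "\<And>x. x \<notin> \<tau> ` ival i \<Longrightarrow> \<psi> x = fst i \<or> \<psi> x = snd i"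
    "\<And>x. fst i \<le> \<psi> x \<and> \<psi> x \<le> snd i" "mono \<psi> \<or> antimono \<psi>"
    using preim_extension[OF i] by blast
  have r: "W (fst i) \<le> W (\<psi> x)" "W (\<psi> x) \<le> W (snd i)" for x
    using \<psi>(3) W by (auto dest: monoD)
  from \<psi>(4) show ?thesis
  proof
    assume m: "mono \<psi>"
    have m': "W (\<psi> x) \<le> W (\<psi> y)" if "x \<le> y" for x y using monoD[OF W monoD[OF m that]] .
    show ?thesis
      by (rule that[of \<psi> "\<lambda>x. W (\<psi> x) - W (fst i)"])
        (use \<psi>(1,2) r m' in \<open>auto intro!: monoI\<close>)
  next
    assume m: "antimono \<psi>"
    have m': "W (\<psi> y) \<le> W (\<psi> x)" if "x \<le> y" for x y using monoD[OF W antimonoD[OF m that]] .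
    show ?thesis
      by (rule that[of \<psi> "\<lambda>x. W (snd i) - W (\<psi> x)"])
        (use \<psi>(1,2) r m' in \<open>auto intro!: monoI\<close>)
  qed
qed

end

text \<open>
  The functions in the supremum that defines the Wasserstein distance.
\<close>
definition test_fn :: "('k::metric_space \<Rightarrow> real) \<Rightarrow> bool" where
  "test_fn h \<longleftrightarrow> (\<forall>y. \<bar>h y\<bar> \<le> 1) \<and> (\<forall>y z. \<bar>h y - h z\<bar> \<le> dist y z)"

text \<open>
  The operator on paths of functionals, iterated on \<open>\<phi>\<close> times the point mass at
  \<open>y0\<close>. A path is encoded by its values on functions \<open>h\<close> on the fiber: the recursion
  pulls \<open>h\<close> back by \<open>H u\<close>, and infinite sums of measures become infinite sums of
  reals.
\<close>
locale skewed = branched Q \<tau> for Q \<tau> +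
  fixes H :: "real \<Rightarrow> 'k::{metric_space, second_countable_topology} \<Rightarrow> 'k" and \<phi> :: "real \<Rightarrow> real" and y0 :: 'k
begin

primrec iter_path :: "nat \<Rightarrow> real \<Rightarrow> ('k \<Rightarrow> real) \<Rightarrow> real" where
  "iter_path 0 x h = \<phi> x * h y0"
| "iter_path (Suc n) x h = pushforward (\<lambda>u. iter_path n u (\<lambda>z. h (H u z))) x"

end

text \<open>
  The set \<open>J\<close> is a backward closed set of full measure on which everything that is known almost
  everywhere holds. Variation enters through the majorants \<open>w\<phi>\<close> of the density and
  \<open>wg\<close> of the weight.
\<close>
locale lasota_yorke = skewed Q \<tau> H \<phi> y0
  for Q \<tau> and H :: "real \<Rightarrow> 'k::{metric_space, second_countable_topology} \<Rightarrow> 'k" and \<phi> y0 +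
  fixes J :: "real set" and a s L C v U :: real and w\<phi> wg :: "real \<Rightarrow> real"
  assumes nonneg: "0 \<le> a" "0 \<le> s" "0 \<le> L" "0 \<le> C" "0 \<le> v" "0 \<le> U"
    and J_sub: "J \<subseteq> {0..1}"
    and J_closed: "\<And>x i. x \<in> J \<Longrightarrow> i \<in> Q \<Longrightarrow> x \<in> \<tau> ` ival i \<Longrightarrow> preim \<tau> i x \<in> J"
    and \<phi>_bound: "\<And>x. x \<in> J \<Longrightarrow> 0 \<le> \<phi> x" "\<And>x. x \<in> J \<Longrightarrow> \<phi> x \<le> C"
    and \<phi>_sum: "\<And>x. x \<in> J \<Longrightarrow> (\<lambda>i. branch_term \<phi> i x) summable_on Q" "\<And>x. x \<in> J \<Longrightarrow> pushforward \<phi> x = \<phi> x"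
    and g_le: "\<And>x. x \<in> J \<Longrightarrow> g x \<le> s"
    and H_contr: "\<And>x z z'. x \<in> J \<Longrightarrow> dist (H x z) (H x z') \<le> a * dist z z'"
    and H_lip: "\<And>i x x' z. i \<in> Q \<Longrightarrow> x \<in> J \<inter> ival i \<Longrightarrow> x' \<in> J \<inter> ival i \<Longrightarrow>
       dist (H x z) (H x' z) \<le> L * \<bar>\<tau> x - \<tau> x'\<bar>"
    and diam: "\<And>z z' :: 'k. dist z z' \<le> 1"
    and w\<phi>: "mono w\<phi>" "\<And>x. 0 \<le> w\<phi> x" "\<And>x. w\<phi> x \<le> v"
      "\<And>x y. x \<in> J \<Longrightarrow> y \<in> J \<Longrightarrow> x \<le> y \<Longrightarrow> \<bar>\<phi> x - \<phi> y\<bar> \<le> w\<phi> y - w\<phi> x"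
    and wg: "mono wg" "\<And>x. 0 \<le> wg x" "\<And>x. wg x \<le> U"
      "\<And>x y. x \<in> {0..1} \<Longrightarrow> y \<in> {0..1} \<Longrightarrow> x \<le> y \<Longrightarrow> \<bar>g x - g y\<bar> \<le> wg y - wg x"
begin

text \<open>
  Since the weights at the preimages of \<open>x\<close>, multiplied by \<open>\<phi>\<close>, sum up to
  \<open>\<phi> x\<close>, affinity and the bound by the density pass from one iterate to the next; together
  they dominate the sum that defines the next iterate. The constant \<open>c\<close> is separated because only
  functions of small oscillation profit from the contraction.
\<close>
lemma iter_path_props:
  shows "x \<in> J \<Longrightarrow> \<forall>y. \<bar>h y\<bar> \<le> K \<Longrightarrow> iter_path n x (\<lambda>y. c + r * h y) = c * \<phi> x + r * iter_path n x h"
    and "x \<in> J \<Longrightarrow> \<forall>y. \<bar>h y\<bar> \<le> K \<Longrightarrow> \<forall>y. \<bar>h' y\<bar> \<le> K' \<Longrightarrow> \<forall>y. \<bar>h y - h' y\<bar> \<le> e \<Longrightarrow>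
       \<bar>iter_path n x h - iter_path n x h'\<bar> \<le> \<phi> x * e"
    and "x \<in> J \<Longrightarrow> \<forall>y. \<bar>h y\<bar> \<le> K \<Longrightarrow> (\<lambda>i. branch_term (\<lambda>u. iter_path n u (\<lambda>z. h (H u z))) i x) summable_on Q"
proof (induction n arbitrary: x h h' c r K K' e)
  have aux: "(\<lambda>i. branch_term (\<lambda>u. S u (\<lambda>z. h (H u z))) i x) summable_on Q"
    if x: "x \<in> J" and h: "\<forall>y. \<bar>h y\<bar> \<le> K"
      and lin: "\<And>x h c r K. x \<in> J \<Longrightarrow> \<forall>y. \<bar>h y\<bar> \<le> K \<Longrightarrow> S x (\<lambda>y. c + r * h y) = c * \<phi> x + r * S x h"
      and bd: "\<And>x h h' K K' e. x \<in> J \<Longrightarrow> \<forall>y. \<bar>h y\<bar> \<le> K \<Longrightarrow> \<forall>y. \<bar>h' y\<bar> \<le> K' \<Longrightarrow> \<forall>y. \<bar>h y - h' y\<bar> \<le> e \<Longrightarrow>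
         \<bar>S x h - S x h'\<bar> \<le> \<phi> x * e"
    for S :: "real \<Rightarrow> ('k \<Rightarrow> real) \<Rightarrow> real" and x h K
  proof (rule infsum_dominated(1))
    show "(\<lambda>i. K * branch_term \<phi> i x) summable_on Q" by (intro summable_on_cmult_right \<phi>_sum x)
    fix i assume i: "i \<in> Q"
    show "\<bar>branch_term (\<lambda>u. S u (\<lambda>z. h (H u z))) i x\<bar> \<le> K * branch_term \<phi> i x"
    proof (cases "x \<in> \<tau> ` ival i")
      case True
      define u where "u = preim \<tau> i x"
      have u: "u \<in> J" unfolding u_def by (rule J_closed[OF x i True])
      have "S u (\<lambda>_. 0) = 0" using lin[OF u, of "\<lambda>_. 0" 0 0 0] by simp
      then have "\<bar>S u (\<lambda>z. h (H u z))\<bar> \<le> \<phi> u * K"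
        using bd[OF u, of "\<lambda>z. h (H u z)" K "\<lambda>_. 0" 0 K] h by simp
      then have "g u * \<bar>S u (\<lambda>z. h (H u z))\<bar> \<le> g u * (\<phi> u * K)" by (rule mult_left_mono) simp
      then show ?thesis using True by (simp add: branch_term_def abs_mult u_def[symmetric] mult_ac)
    qed (simp add: branch_term_def)
  qed
  have bd0: "\<bar>iter_path 0 x h - iter_path 0 x h'\<bar> \<le> \<phi> x * e" if x: "x \<in> J" and d: "\<forall>y. \<bar>h y - h' y\<bar> \<le> e" for x h h' e
  proof -
    have "\<phi> x * \<bar>h y0 - h' y0\<bar> \<le> \<phi> x * e" using \<phi>_bound(1)[OF x] d by (intro mult_left_mono) auto
    moreover have "\<bar>\<phi> x * h y0 - \<phi> x * h' y0\<bar> = \<phi> x * \<bar>h y0 - h' y0\<bar>"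
      using \<phi>_bound(1)[OF x] by (simp add: abs_mult flip: right_diff_distrib)
    ultimately show ?thesis by simp
  qed
  case 0
  {
    case 1 then show ?case by (simp add: algebra_simps)
  next
    case 2 then show ?case by (intro bd0)
  next
    case 3 then show ?case by (rule aux) (simp add: algebra_simps, rule bd0)
  }
  case (Suc n)
  {
    fix x c r K :: real and h :: "'k \<Rightarrow> real" assume x: "x \<in> J" and h: "\<forall>y. \<bar>h y\<bar> \<le> K"
    have t: "branch_term (\<lambda>u. iter_path n u (\<lambda>z. c + r * h (H u z))) i x = c * branch_term \<phi> i x + r * branch_term (\<lambda>u. iter_path n u (\<lambda>z. h (H u z))) i x"
      if i: "i \<in> Q" for i
    proof (cases "x \<in> \<tau> ` ival i")
      case True
      have "preim \<tau> i x \<in> J" by (rule J_closed[OF x i True])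
      then show ?thesis using Suc(1)[of "preim \<tau> i x" "\<lambda>z. h (H (preim \<tau> i x) z)" K c r] h
        by (simp add: branch_term_def algebra_simps)
    qed (simp add: branch_term_def)
    have "iter_path (Suc n) x (\<lambda>y. c + r * h y) = (\<Sum>\<^sub>\<infinity>i\<in>Q. c * branch_term \<phi> i x + r * branch_term (\<lambda>u. iter_path n u (\<lambda>z. h (H u z))) i x)"
      by (simp add: pushforward_def t cong: infsum_cong)
    also have "\<dots> = c * \<phi> x + r * iter_path (Suc n) x h"
      using Suc(3)[OF x h] \<phi>_sum[OF x]
      by (simp add: infsum_add infsum_cmult_right summable_on_cmult_right pushforward_def)
    finally have "iter_path (Suc n) x (\<lambda>y. c + r * h y) = c * \<phi> x + r * iter_path (Suc n) x h" .
  } note lin = this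
  {
    fix x K K' e :: real and h h' :: "'k \<Rightarrow> real"
    assume x: "x \<in> J" and h: "\<forall>y. \<bar>h y\<bar> \<le> K" and h': "\<forall>y. \<bar>h' y\<bar> \<le> K'" and d: "\<forall>y. \<bar>h y - h' y\<bar> \<le> e"
    let ?b = "\<lambda>h i. branch_term (\<lambda>u. iter_path n u (\<lambda>z. h (H u z))) i x"
    have eq: "iter_path (Suc n) x h - iter_path (Suc n) x h' = (\<Sum>\<^sub>\<infinity>i\<in>Q. ?b h i + (-1) * ?b h' i)"
      unfolding infsum_add[OF Suc(3)[OF x h] summable_on_cmult_right[OF Suc(3)[OF x h']]] infsum_cmult_right'
      by (simp add: pushforward_def)
    have "\<bar>iter_path (Suc n) x h - iter_path (Suc n) x h'\<bar> \<le> (\<Sum>\<^sub>\<infinity>i\<in>Q. e * branch_term \<phi> i x)"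
      unfolding eq
    proof (rule infsum_dominated(2))
      show "(\<lambda>i. e * branch_term \<phi> i x) summable_on Q" by (intro summable_on_cmult_right \<phi>_sum x)
      fix i assume i: "i \<in> Q"
      show "\<bar>?b h i + (-1) * ?b h' i\<bar> \<le> e * branch_term \<phi> i x"
      proof (cases "x \<in> \<tau> ` ival i")
        case True
        define u where "u = preim \<tau> i x"
        have u: "u \<in> J" unfolding u_def by (rule J_closed[OF x i True])
        have "\<bar>iter_path n u (\<lambda>z. h (H u z)) - iter_path n u (\<lambda>z. h' (H u z))\<bar> \<le> \<phi> u * e"
          by (rule Suc(2)[OF u, of _ K _ K']) (use h h' d in auto)
        then have "g u * \<bar>iter_path n u (\<lambda>z. h (H u z)) - iter_path n u (\<lambda>z. h' (H u z))\<bar> \<le> g u * (\<phi> u * e)"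
          by (rule mult_left_mono) simp
        moreover have "?b h i + (-1) * ?b h' i = g u * (iter_path n u (\<lambda>z. h (H u z)) - iter_path n u (\<lambda>z. h' (H u z)))"
          using True by (simp add: branch_term_def u_def algebra_simps)
        ultimately show ?thesis using True by (simp add: abs_mult branch_term_def u_def[symmetric] mult_ac)
      qed (simp add: branch_term_def)
    qed
    also have "\<dots> = \<phi> x * e" using \<phi>_sum[OF x] by (simp add: infsum_cmult_right pushforward_def[symmetric])
    finally have "\<bar>iter_path (Suc n) x h - iter_path (Suc n) x h'\<bar> \<le> \<phi> x * e" .
  } note bd = this
  {
    case 1 then show ?case by (rule lin)
  next
    case 2 then show ?case by (rule bd)
  next
    case 3 then show ?case by (rule aux) (use lin bd in blast)+
  }
qed

lemma iter_path_le: "x \<in> J \<Longrightarrow> \<forall>y. \<bar>h y\<bar> \<le> 1 \<Longrightarrow> \<bar>iter_path n x h\<bar> \<le> \<phi> x"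
  using iter_path_props(1)[of x "\<lambda>_. 0" 0 n 0 0] iter_path_props(2)[of x h 1 "\<lambda>_. 0" 0 1 n] by simp

text \<open>
  The estimate for a single branch. The changes of the weight and of the functional are dominated by
  increments of \<open>W\<close>. The change of the fiber map costs \<open>L * (y - x)\<close> times the term
  of the branch in the transfer of \<open>\<phi>\<close>, which sums up to \<open>L * (y - x) * \<phi>
  y\<close> over all branches.
\<close>
lemma branch_majorant:
  fixes w :: "real \<Rightarrow> real"
  assumes w: "mono w"
    and wT: "\<And>x y h. x \<in> J \<Longrightarrow> y \<in> J \<Longrightarrow> x \<le> y \<Longrightarrow> test_fn h \<Longrightarrow> \<bar>iter_path n x h - iter_path n y h\<bar> \<le> w y - w x"
    and i: "i \<in> Q"
  defines "W \<equiv> \<lambda>x. C * wg x + s * w\<phi> x + a * s * w x"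
  obtains V where "mono V" "\<And>x. 0 \<le> V x" "\<And>x. V x \<le> W (snd i) - W (fst i)"
    "\<And>x y h. x \<in> J \<Longrightarrow> y \<in> J \<Longrightarrow> x \<le> y \<Longrightarrow> test_fn h \<Longrightarrow>
       \<bar>branch_term (\<lambda>u. iter_path n u (\<lambda>z. h (H u z))) i y - branch_term (\<lambda>u. iter_path n u (\<lambda>z. h (H u z))) i x\<bar>
         \<le> V y - V x + L * (y - x) * branch_term \<phi> i y"
proof -
  have as: "0 \<le> a * s" using nonneg by simp
  have Wmono: "mono W" unfolding W_def
    using nonneg as w w\<phi>(1) wg(1) by (intro monoI add_mono mult_left_mono) (auto dest: monoD)
  have Wabs: "\<bar>W u' - W u\<bar> = C * \<bar>wg u' - wg u\<bar> + s * \<bar>w\<phi> u' - w\<phi> u\<bar> + a * s * \<bar>w u' - w u\<bar>" for u u'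
  proof -
    have "\<bar>W u' - W u\<bar> = C * \<bar>wg u' - wg u\<bar> + s * \<bar>w\<phi> u' - w\<phi> u\<bar> + a * s * \<bar>w u' - w u\<bar>" if "u \<le> u'" for u u'
    proof -
      have "wg u \<le> wg u'" "w\<phi> u \<le> w\<phi> u'" "w u \<le> w u'" "W u \<le> W u'"
        using monoD[OF wg(1) that] monoD[OF w\<phi>(1) that] monoD[OF w that] monoD[OF Wmono that] by auto
      then show ?thesis by (simp add: W_def algebra_simps)
    qed
    from this[of u u'] this[of u' u] show ?thesis
      by (cases "u \<le> u'") (auto simp: abs_minus_commute)
  qed
  obtain \<psi> V where \<psi>: "\<And>x. x \<in> \<tau> ` ival i \<Longrightarrow> \<psi> x = preim \<tau> i x"
    "\<And>x. x \<notin> \<tau> ` ival i \<Longrightarrow> \<psi> x = fst i \<or> \<psi> x = snd i"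
    and V: "mono V" "\<And>x. 0 \<le> V x" "\<And>x. V x \<le> W (snd i) - W (fst i)"
    "\<And>x y. x \<le> y \<Longrightarrow> \<bar>W (\<psi> y) - W (\<psi> x)\<bar> = V y - V x"
    by (rule branch_increment[OF i Wmono]) blast
  have g_lip: "\<bar>g u - g u'\<bar> \<le> \<bar>wg u' - wg u\<bar>" if "u \<in> {0..1}" "u' \<in> {0..1}" for u u'
    using wg(4)[OF that] wg(4)[OF that(2,1)] by (cases "u \<le> u'") auto
  have endp: "\<psi> x \<in> {0..1}" "g (\<psi> x) = 0" if "x \<notin> \<tau> ` ival i" for x
    using \<psi>(2)[OF that] g_endpoint[OF i] bounds[OF i] by auto
  \<comment> \<open>one of two consecutive points has no preimage in the interval: \<open>g\<close> drops to \<open>0\<close> at the end point\<close>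
  have drop: "\<bar>branch_term (\<lambda>u. iter_path n u (\<lambda>z. h (H u z))) i x\<bar> \<le> \<bar>W (\<psi> y) - W (\<psi> x)\<bar>"
    if x: "x \<in> J" "x \<in> \<tau> ` ival i" and y: "y \<notin> \<tau> ` ival i" and h: "test_fn h" for x y h
  proof -
    define u where "u = preim \<tau> i x"
    have u: "u \<in> J" "u \<in> {0..1}" "\<psi> x = u"
      using J_closed[OF x(1) i x(2)] J_sub \<psi>(1)[OF x(2)] by (auto simp: u_def)
    have "\<bar>iter_path n u (\<lambda>z. h (H u z))\<bar> \<le> \<phi> u" using h by (intro iter_path_le u) (simp add: test_fn_def)
    then have "\<bar>iter_path n u (\<lambda>z. h (H u z))\<bar> \<le> C" using \<phi>_bound(2)[OF u(1)] by simp
    then have "\<bar>branch_term (\<lambda>u. iter_path n u (\<lambda>z. h (H u z))) i x\<bar> \<le> g u * C"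
      using x(2) by (simp add: branch_term_def abs_mult u_def[symmetric] mult_left_mono)
    also have "\<dots> = C * \<bar>g u - g (\<psi> y)\<bar>" using endp(2)[OF y] by simp
    also have "\<dots> \<le> C * \<bar>wg (\<psi> y) - wg u\<bar>"
      by (rule mult_left_mono[OF g_lip[OF u(2) endp(1)[OF y]]]) (rule nonneg)
    also have "\<dots> \<le> \<bar>W (\<psi> y) - W (\<psi> x)\<bar>"
      unfolding Wabs u(3) using nonneg as by (simp add: add_nonneg_nonneg)
    finally show ?thesis .
  qed
  show ?thesis
  proof (rule that[OF V(1-3)])
    fix x y and h :: "'k \<Rightarrow> real"
    assume x: "x \<in> J" and y: "y \<in> J" and xy: "x \<le> y" and h: "test_fn h"
    let ?q = "\<lambda>u. iter_path n u (\<lambda>z. h (H u z))"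
    have btn: "0 \<le> L * (y - x) * branch_term \<phi> i y"
    proof -
      have "0 \<le> branch_term \<phi> i y" using J_closed[OF y i] \<phi>_bound(1) by (auto simp: branch_term_def)
      then show ?thesis using nonneg xy by simp
    qed
    consider "x \<in> \<tau> ` ival i" "y \<in> \<tau> ` ival i" | "x \<in> \<tau> ` ival i" "y \<notin> \<tau> ` ival i"
      | "x \<notin> \<tau> ` ival i" "y \<in> \<tau> ` ival i" | "x \<notin> \<tau> ` ival i" "y \<notin> \<tau> ` ival i" by blast
    then have "\<bar>branch_term ?q i y - branch_term ?q i x\<bar> \<le> \<bar>W (\<psi> y) - W (\<psi> x)\<bar> + L * (y - x) * branch_term \<phi> i y"
    proof cases
      case 2
      then have "branch_term ?q i y = 0" by (simp add: branch_term_def)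
      then show ?thesis using drop[OF x 2 h] btn by simp
    next
      case 3
      then have "branch_term ?q i x = 0" by (simp add: branch_term_def)
      then show ?thesis using drop[OF y 3(2,1) h] btn by (simp add: abs_minus_commute)
    next
      case 4
      then show ?thesis using btn by (simp add: branch_term_def)
    next
      case 1
      define u where "u = preim \<tau> i x"
      define u' where "u' = preim \<tau> i y"
      have u: "u \<in> J" "u \<in> ival i" "\<tau> u = x" "\<psi> x = u"
        using J_closed[OF x i 1(1)] preim[OF i] \<psi>(1) 1 by (auto simp: u_def)
      have u': "u' \<in> J" "u' \<in> ival i" "\<tau> u' = y" "\<psi> y = u'"
        using J_closed[OF y i 1(2)] preim[OF i] \<psi>(1) 1 by (auto simp: u'_def)
      have h1: "\<forall>z. \<bar>h (H w z)\<bar> \<le> 1" for w using h by (simp add: test_fn_def)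
      have hd: "\<bar>h z - h z'\<bar> \<le> dist z z'" for z z' using h by (simp add: test_fn_def)
      \<comment> \<open>the change of the fiber map\<close>
      have A: "\<bar>iter_path n u' (\<lambda>z. h (H u' z)) - iter_path n u' (\<lambda>z. h (H u z))\<bar> \<le> \<phi> u' * (L * (y - x))"
      proof (rule iter_path_props(2)[OF u'(1) h1 h1], rule allI)
        fix z
        have "\<bar>h (H u' z) - h (H u z)\<bar> \<le> dist (H u' z) (H u z)" by (rule hd)
        also have "\<dots> \<le> L * \<bar>\<tau> u' - \<tau> u\<bar>" using u u' by (intro H_lip[OF i]) auto
        finally show "\<bar>h (H u' z) - h (H u z)\<bar> \<le> L * (y - x)" using xy u u' by simp
      qed
      \<comment> \<open>the change of the weight\<close>
      have B: "\<bar>g u' - g u\<bar> * \<bar>iter_path n u' (\<lambda>z. h (H u z))\<bar> \<le> C * \<bar>wg u' - wg u\<bar>"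
      proof -
        have "\<bar>iter_path n u' (\<lambda>z. h (H u z))\<bar> \<le> C"
          using iter_path_le[OF u'(1) h1[of u], of n] \<phi>_bound(2)[OF u'(1)] by simp
        moreover have "\<bar>g u' - g u\<bar> \<le> \<bar>wg u' - wg u\<bar>"
          using g_lip[OF subsetD[OF J_sub u(1)] subsetD[OF J_sub u'(1)]] by (simp add: abs_minus_commute)
        ultimately have "\<bar>g u' - g u\<bar> * \<bar>iter_path n u' (\<lambda>z. h (H u z))\<bar> \<le> \<bar>wg u' - wg u\<bar> * C"
          by (intro mult_mono) auto
        then show ?thesis by (simp add: mult.commute)
      qed
      \<comment> \<open>the change of the measure: \<open>h \<circ> H u\<close> is a constant plus \<open>a\<close> times a test function\<close>
      have D: "\<bar>iter_path n u' (\<lambda>z. h (H u z)) - iter_path n u (\<lambda>z. h (H u z))\<bar> \<le> \<bar>w\<phi> u' - w\<phi> u\<bar> + a * \<bar>w u' - w u\<bar>"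
      proof -
        define c where "c = h (H u y0)"
        \<comment> \<open>for \<open>a = 0\<close> the function \<open>h \<circ> H u\<close> is constant, and division by \<open>0\<close> makes \<open>h' = 0\<close>\<close>
        define h' where "h' z = (h (H u z) - c) / a" for z
        have d: "\<bar>h (H u z) - h (H u z')\<bar> \<le> a * dist z z'" for z z'
          using hd[of "H u z" "H u z'"] H_contr[OF u(1), of z z'] by simp
        have dec: "h (H u z) = c + a * h' z" for z
          using d[of z y0] by (cases "a = 0") (auto simp: h'_def c_def)
        have h': "test_fn h'"
        proof -
          have l: "\<bar>h' z - h' z'\<bar> \<le> dist z z'" for z z'
          proof (cases "a = 0")
            case False
            then have "0 < a" using nonneg by simp
            moreover have "h' z - h' z' = (h (H u z) - h (H u z')) / a" by (simp add: h'_def diff_divide_distrib)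
            ultimately show ?thesis using d[of z z'] by (simp add: abs_divide pos_divide_le_eq mult.commute)
          qed (simp add: h'_def)
          have "h' y0 = 0" by (simp add: h'_def c_def)
          then have "\<bar>h' z\<bar> \<le> 1" for z using l[of z y0] diam[of z y0] by simp
          then show ?thesis using l by (simp add: test_fn_def)
        qed
        then have hb: "\<forall>z. \<bar>h' z\<bar> \<le> 1" by (simp add: test_fn_def)
        have e: "(\<lambda>z. h (H u z)) = (\<lambda>z. c + a * h' z)" using dec by auto
        have eq: "iter_path n u' (\<lambda>z. h (H u z)) - iter_path n u (\<lambda>z. h (H u z)) = c * (\<phi> u' - \<phi> u) + a * (iter_path n u' h' - iter_path n u h')"
          unfolding e iter_path_props(1)[OF u(1) hb] iter_path_props(1)[OF u'(1) hb] by (simp add: algebra_simps)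
        have "\<bar>iter_path n u' (\<lambda>z. h (H u z)) - iter_path n u (\<lambda>z. h (H u z))\<bar> \<le> \<bar>c\<bar> * \<bar>\<phi> u' - \<phi> u\<bar> + a * \<bar>iter_path n u' h' - iter_path n u h'\<bar>"
          unfolding eq using nonneg(1) by (intro order_trans[OF abs_triangle_ineq]) (simp add: abs_mult)
        also have "\<dots> \<le> 1 * \<bar>w\<phi> u' - w\<phi> u\<bar> + a * \<bar>w u' - w u\<bar>"
        proof (intro add_mono mult_mono mult_left_mono nonneg)
          show "\<bar>c\<bar> \<le> 1" using h by (simp add: c_def test_fn_def)
          show "\<bar>\<phi> u' - \<phi> u\<bar> \<le> \<bar>w\<phi> u' - w\<phi> u\<bar>"
            using w\<phi>(4)[OF u(1) u'(1)] w\<phi>(4)[OF u'(1) u(1)] by (cases "u \<le> u'") auto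
          show "\<bar>iter_path n u' h' - iter_path n u h'\<bar> \<le> \<bar>w u' - w u\<bar>"
            using wT[OF u(1) u'(1) _ h'] wT[OF u'(1) u(1) _ h'] by (cases "u \<le> u'") auto
        qed auto
        finally show ?thesis by simp
      qed
      have eq: "branch_term ?q i y - branch_term ?q i x = g u' * (iter_path n u' (\<lambda>z. h (H u' z)) - iter_path n u' (\<lambda>z. h (H u z)))
          + (g u' - g u) * iter_path n u' (\<lambda>z. h (H u z))
          + g u * (iter_path n u' (\<lambda>z. h (H u z)) - iter_path n u (\<lambda>z. h (H u z)))"
        using 1 by (simp add: branch_term_def u_def[symmetric] u'_def[symmetric] algebra_simps)
      have "\<bar>branch_term ?q i y - branch_term ?q i x\<bar> \<le> g u' * \<bar>iter_path n u' (\<lambda>z. h (H u' z)) - iter_path n u' (\<lambda>z. h (H u z))\<bar>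
          + \<bar>g u' - g u\<bar> * \<bar>iter_path n u' (\<lambda>z. h (H u z))\<bar>
          + g u * \<bar>iter_path n u' (\<lambda>z. h (H u z)) - iter_path n u (\<lambda>z. h (H u z))\<bar>"
        unfolding eq
        by (intro order_trans[OF abs_triangle_ineq] add_mono order.refl) (simp_all add: abs_mult)
      also have "\<dots> \<le> g u' * (\<phi> u' * (L * (y - x))) + C * \<bar>wg u' - wg u\<bar>
          + s * (\<bar>w\<phi> u' - w\<phi> u\<bar> + a * \<bar>w u' - w u\<bar>)"
        by (intro add_mono mult_left_mono mult_mono A B D g_le[OF u(1)]) (simp_all add: nonneg)
      also have "\<dots> = \<bar>W u' - W u\<bar> + L * (y - x) * branch_term \<phi> i y"
        unfolding Wabs using 1 by (simp add: branch_term_def u'_def[symmetric] algebra_simps)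
      finally show ?thesis using u(4) u'(4) by simp
    qed
    then show "\<bar>branch_term ?q i y - branch_term ?q i x\<bar> \<le> V y - V x + L * (y - x) * branch_term \<phi> i y"
      using V(4)[OF xy] by simp
  qed
qed

text \<open>
  Summing the majorants of the branches: their total increments are increments of \<open>W\<close> over
  disjoint intervals and thus bounded by the range of \<open>W\<close>. The linear part of \<open>w'\<close>
  accounts for the change of the fiber maps; it is cut off outside of the unit interval to stay bounded.
\<close>
lemma variation_step:
  fixes w :: "real \<Rightarrow> real"
  assumes w: "mono w" "\<And>x. 0 \<le> w x" "\<And>x. w x \<le> B"
    and wT: "\<And>x y h. x \<in> J \<Longrightarrow> y \<in> J \<Longrightarrow> x \<le> y \<Longrightarrow> test_fn h \<Longrightarrow> \<bar>iter_path n x h - iter_path n y h\<bar> \<le> w y - w x"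
  obtains w' where "mono w'" "\<And>x. 0 \<le> w' x" "\<And>x. w' x \<le> C * U + s * v + a * s * B + C * L"
    "\<And>x y h. x \<in> J \<Longrightarrow> y \<in> J \<Longrightarrow> x \<le> y \<Longrightarrow> test_fn h \<Longrightarrow> \<bar>iter_path (Suc n) x h - iter_path (Suc n) y h\<bar> \<le> w' y - w' x"
proof -
  define W where "W = (\<lambda>x. C * wg x + s * w\<phi> x + a * s * w x)"
  have as: "0 \<le> a * s" using nonneg by simp
  define BW where "BW = C * U + s * v + a * s * B"
  have W: "mono W" "0 \<le> W x" "W x \<le> BW" for x
  proof -
    show "mono W" unfolding W_def
      using nonneg as w(1) w\<phi>(1) wg(1) by (intro monoI add_mono mult_left_mono) (auto dest: monoD)
    show "0 \<le> W x" unfolding W_def using nonneg as w(2) w\<phi>(2) wg(2) by simp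
    show "W x \<le> BW" unfolding W_def BW_def
      using nonneg as w(3) w\<phi>(3) wg(3) by (intro add_mono mult_left_mono) auto
  qed
  define good where "good i V \<longleftrightarrow> mono V \<and> (\<forall>x. 0 \<le> V x \<and> V x \<le> W (snd i) - W (fst i)) \<and>
    (\<forall>x y h. x \<in> J \<longrightarrow> y \<in> J \<longrightarrow> x \<le> y \<longrightarrow> test_fn h \<longrightarrow>
       \<bar>branch_term (\<lambda>u. iter_path n u (\<lambda>z. h (H u z))) i y - branch_term (\<lambda>u. iter_path n u (\<lambda>z. h (H u z))) i x\<bar>
         \<le> V y - V x + L * (y - x) * branch_term \<phi> i y)" for i V
  have "\<exists>V. good i V" if i: "i \<in> Q" for i
    unfolding W_def good_def by (rule branch_majorant[OF w(1) wT i]) (assumption | blast)+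
  then obtain V where gV: "\<And>i. i \<in> Q \<Longrightarrow> good i (V i)" using bchoice[of Q good] by blast
  have V: "mono (V i)" "0 \<le> V i x" "V i x \<le> W (snd i) - W (fst i)" if "i \<in> Q" for i x
    using gV[OF that] by (auto simp: good_def)
  have V4: "\<bar>branch_term (\<lambda>u. iter_path n u (\<lambda>z. h (H u z))) i y - branch_term (\<lambda>u. iter_path n u (\<lambda>z. h (H u z))) i x\<bar>
         \<le> V i y - V i x + L * (y - x) * branch_term \<phi> i y"
    if "i \<in> Q" "x \<in> J" "y \<in> J" "x \<le> y" "test_fn h" for i x y h
    using gV[OF that(1)] that(2-5) unfolding good_def by blast
  have dW: "0 \<le> W (snd i) - W (fst i)" if "i \<in> Q" for i
    using V(2,3)[OF that] order_trans by blast
  have fs: "(\<Sum>i\<in>F. W (snd i) - W (fst i)) \<le> BW" if "finite F" "F \<subseteq> Q" for F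
    using that bounds(2) disjoint_family_on_mono[OF that(2) disj]
    by (intro sum_increments_disjoint_intervals[OF W]) auto
  have sW: "(\<lambda>i. W (snd i) - W (fst i)) summable_on Q"
    by (rule nonneg_bdd_above_summable_on) (use dW fs in \<open>auto intro!: bdd_aboveI[of _ BW]\<close>)
  have iW: "(\<Sum>\<^sub>\<infinity>i\<in>Q. W (snd i) - W (fst i)) \<le> BW"
    by (rule infsum_le_finite_sums[OF sW fs])
  have sV: "(\<lambda>i. V i x) summable_on Q" for x
    by (rule summable_on_comparison_test[OF sW]) (use V(2,3) in auto)
  define w' where "w' x = (\<Sum>\<^sub>\<infinity>i\<in>Q. V i x) + C * L * max 0 (min x 1)" for x
  have CL: "0 \<le> C * L" using nonneg by simp
  show ?thesis
  proof (rule that[of w'])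
    show "mono w'" unfolding w'_def
      using V(1) sV CL by (intro monoI add_mono infsum_mono mult_left_mono) (auto dest: monoD)
    show "0 \<le> w' x" for x unfolding w'_def using V(2) CL by (intro add_nonneg_nonneg infsum_nonneg mult_nonneg_nonneg[OF CL]) auto
    show "w' x \<le> C * U + s * v + a * s * B + C * L" for x
    proof -
      have "(\<Sum>\<^sub>\<infinity>i\<in>Q. V i x) \<le> BW"
        using infsum_mono[OF sV sW V(3)] iW by (rule order_trans)
      moreover have "C * L * max 0 (min x 1) \<le> C * L * 1" by (rule mult_left_mono[OF _ CL]) simp
      ultimately show ?thesis by (simp add: w'_def BW_def)
    qed
    fix x y and h :: "'k \<Rightarrow> real"
    assume x: "x \<in> J" and y: "y \<in> J" and xy: "x \<le> y" and h: "test_fn h"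
    let ?q = "\<lambda>u. iter_path n u (\<lambda>z. h (H u z))"
    have hb: "\<forall>y. \<bar>h y\<bar> \<le> 1" using h by (simp add: test_fn_def)
    have sq: "(\<lambda>i. branch_term ?q i y) summable_on Q" "(\<lambda>i. branch_term ?q i x) summable_on Q"
      using iter_path_props(3)[OF y hb] iter_path_props(3)[OF x hb] by auto
    have sVV: "(\<lambda>i. V i y + (-1) * V i x) summable_on Q"
      by (intro summable_on_add summable_on_cmult_right sV)
    have eq: "iter_path (Suc n) y h - iter_path (Suc n) x h = (\<Sum>\<^sub>\<infinity>i\<in>Q. branch_term ?q i y + (-1) * branch_term ?q i x)"
      unfolding infsum_add[OF sq(1) summable_on_cmult_right[OF sq(2)]] infsum_cmult_right'
      by (simp add: pushforward_def)
    have "\<bar>iter_path (Suc n) y h - iter_path (Suc n) x h\<bar> \<le> (\<Sum>\<^sub>\<infinity>i\<in>Q. (V i y + (-1) * V i x) + L * (y - x) * branch_term \<phi> i y)"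
      unfolding eq using V4[OF _ x y xy h]
      by (intro infsum_dominated(2) summable_on_add summable_on_cmult_right sV \<phi>_sum y) auto
    also have "\<dots> = (\<Sum>\<^sub>\<infinity>i\<in>Q. V i y) - (\<Sum>\<^sub>\<infinity>i\<in>Q. V i x) + L * (y - x) * \<phi> y"
      unfolding infsum_add[OF sVV summable_on_cmult_right[OF \<phi>_sum(1)[OF y]]]
        infsum_add[OF sV summable_on_cmult_right[OF sV]] infsum_cmult_right'
      using \<phi>_sum(2)[OF y] by (simp add: pushforward_def)
    also have "\<dots> \<le> w' y - w' x"
    proof -
      have "x \<in> {0..1}" "y \<in> {0..1}" using x y J_sub by auto
      moreover have "L * (y - x) * \<phi> y \<le> L * (y - x) * C"
        using \<phi>_bound(2)[OF y] nonneg xy by (intro mult_left_mono) auto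
      ultimately show ?thesis by (simp add: w'_def algebra_simps)
    qed
    finally show "\<bar>iter_path (Suc n) x h - iter_path (Suc n) y h\<bar> \<le> w' y - w' x" by (simp add: abs_minus_commute)
  qed
qed

text \<open>
  The bound is chosen so that the step with factor \<open>a * s \<le> A < 1\<close> maps it into itself.
\<close>
lemma uniform_variation:
  assumes as: "a * s \<le> A" "A < 1"
  shows "\<exists>w. mono w \<and> (\<forall>x. 0 \<le> w x \<and> w x \<le> v + (C * U + s * v + C * L) / (1 - A)) \<and>
    (\<forall>x y h. x \<in> J \<longrightarrow> y \<in> J \<longrightarrow> x \<le> y \<longrightarrow> test_fn h \<longrightarrow> \<bar>iter_path n x h - iter_path n y h\<bar> \<le> w y - w x)"
proof (induction n)
  have K: "0 \<le> (C * U + s * v + C * L) / (1 - A)" using nonneg as by simp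
  case 0
  have "\<bar>iter_path 0 x h - iter_path 0 y h\<bar> \<le> w\<phi> y - w\<phi> x" if "x \<in> J" "y \<in> J" "x \<le> y" "test_fn h" for x y h
  proof -
    have "\<bar>iter_path 0 x h - iter_path 0 y h\<bar> = \<bar>\<phi> x - \<phi> y\<bar> * \<bar>h y0\<bar>" by (simp add: abs_mult flip: left_diff_distrib)
    also have "\<dots> \<le> \<bar>\<phi> x - \<phi> y\<bar> * 1" using that(4) by (intro mult_left_mono) (auto simp: test_fn_def)
    finally show ?thesis using w\<phi>(4)[OF that(1-3)] by simp
  qed
  then show ?case using w\<phi>(1-3) K by (intro exI[of _ w\<phi>]) (auto intro: add_increasing2)
next
  case (Suc n)
  define B where "B = v + (C * U + s * v + C * L) / (1 - A)"
  obtain w where "mono w" "\<And>x. 0 \<le> w x" "\<And>x. w x \<le> B"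
    "\<And>x y h. x \<in> J \<Longrightarrow> y \<in> J \<Longrightarrow> x \<le> y \<Longrightarrow> test_fn h \<Longrightarrow> \<bar>iter_path n x h - iter_path n y h\<bar> \<le> w y - w x"
    using Suc unfolding B_def by blast
  from variation_step[OF this] obtain w' where w': "mono w'" "\<And>x. 0 \<le> w' x"
    "\<And>x. w' x \<le> C * U + s * v + a * s * B + C * L"
    "\<And>x y h. x \<in> J \<Longrightarrow> y \<in> J \<Longrightarrow> x \<le> y \<Longrightarrow> test_fn h \<Longrightarrow> \<bar>iter_path (Suc n) x h - iter_path (Suc n) y h\<bar> \<le> w' y - w' x"
    by blast
  have "C * U + s * v + a * s * B + C * L \<le> B"
  proof -
    define K where "K = (C * U + s * v + C * L) / (1 - A)"
    have K: "C * U + s * v + C * L = K * (1 - A)" "0 \<le> K" using as nonneg by (auto simp: K_def)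
    have "0 \<le> B" using K nonneg by (simp add: B_def K_def[symmetric])
    then have "a * s * B \<le> A * B" using as by (intro mult_right_mono) auto
    moreover have "A * v \<le> v" using as nonneg mult_right_mono[of A 1 v] by simp
    moreover have "B = v + K" by (simp add: B_def K_def)
    ultimately show ?thesis using K by (simp add: algebra_simps)
  qed
  then have "\<And>x. w' x \<le> B" using w'(3) order_trans by blast
  then show ?case using w'(1,2,4) unfolding B_def by blast
qed

end

section \<open>Test functions, skew products and disintegrations\<close>

lemma test_fn_iff: "test_fn h \<longleftrightarrow> 1-lipschitz_on UNIV h \<and> (\<forall>y. \<bar>h y\<bar> \<le> 1)"
  by (auto simp: test_fn_def lipschitz_on_def dist_real_def)

lemma test_fn_measurable: "test_fn h \<Longrightarrow> h \<in> borel_measurable borel"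
  unfolding test_fn_iff by (intro borel_measurable_continuous_onI) (blast intro: lipschitz_on_continuous_on)

text \<open>
  The lower envelope of finitely many cones with slope \<open>1\<close>, cut off at height \<open>1\<close>.
  Cones with rational heights and with vertices in a countable dense set provide countably many functions with
  Lipschitz constant \<open>1\<close>.
\<close>
definition inf_cones :: "('k::metric_space \<times> real) list \<Rightarrow> 'k \<Rightarrow> real" where
  "inf_cones l y = foldr (\<lambda>(p, r) m. min (r + dist y p) m) l 1"

lemma inf_cones_simps [simp]: "inf_cones [] y = 1" "inf_cones ((p, r) # l) y = min (r + dist y p) (inf_cones l y)"
  by (simp_all add: inf_cones_def)

lemma inf_cones_lipschitz: "\<bar>inf_cones l y - inf_cones l z\<bar> \<le> dist y z"
proof (induction l)
  case (Cons pr l)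
  obtain p r where [simp]: "pr = (p, r)" by (cases pr)
  have "\<bar>dist y p - dist z p\<bar> \<le> dist y z"
    using dist_triangle[of y p z] dist_triangle[of z p y] by (simp add: abs_le_iff dist_commute)
  then show ?case using Cons by (simp add: min_def abs_le_iff)
qed simp

lemma inf_cones_le1: "inf_cones l y \<le> 1"
  by (induction l) auto

lemma inf_cones_lower: "(\<And>p r. (p, r) \<in> set l \<Longrightarrow> c \<le> r + dist y p) \<Longrightarrow> c \<le> 1 \<Longrightarrow> c \<le> inf_cones l y"
  by (induction l) auto

lemma inf_cones_upper: "(p, r) \<in> set l \<Longrightarrow> inf_cones l y \<le> r + dist y p"
  by (induction l) auto

text \<open>
  A test function \<open>h\<close> is the envelope of the cones \<open>h p + dist y p\<close>; by compactness
  the vertices of a finite net suffice up to an error, and rounding the heights up adds one more.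
\<close>
lemma countable_dense_test_fns:
  assumes K: "compact (UNIV :: 'k :: {metric_space, second_countable_topology} set)"
  obtains D :: "('k::{metric_space, second_countable_topology} \<Rightarrow> real) set" where "countable D" "\<And>h. h \<in> D \<Longrightarrow> test_fn h"
    "\<And>h \<eta>. test_fn h \<Longrightarrow> 0 < \<eta> \<Longrightarrow> \<exists>h'\<in>D. \<forall>y. \<bar>h y - h' y\<bar> \<le> \<eta>"
proof -
  obtain S :: "'k set" where S: "countable S" "\<And>X. open X \<Longrightarrow> X \<noteq> {} \<Longrightarrow> \<exists>d\<in>S. d \<in> X"
    by (rule countable_dense_setE) blast
  define f :: "('k \<times> real) list \<Rightarrow> 'k \<Rightarrow> real" where "f l y = max (-1) (inf_cones l y)" for l y
  show ?thesis
  proof (rule that[of "f ` lists (S \<times> \<rat>)"])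
    show "countable (f ` lists (S \<times> \<rat>))"
      by (intro countable_image countable_lists countable_SIGMA S countable_rat)
    show "test_fn h" if h: "h \<in> f ` lists (S \<times> \<rat>)" for h
    proof -
      obtain l where "h = f l" using h by auto
      then show ?thesis
        using inf_cones_lipschitz[of l] inf_cones_le1[of l]
        by (auto simp: test_fn_def f_def abs_le_iff max_def) (smt (verit) zero_le_dist)+
    qed
    fix h :: "'k \<Rightarrow> real" and \<eta> :: real
    assume h: "test_fn h" and eta: "0 < \<eta>"
    define e where "e = \<eta> / 3"
    have e: "0 < e" using eta by (simp add: e_def)
    have "UNIV \<subseteq> (\<Union>p\<in>S. ball p e)"
    proof
      fix y :: 'k
      obtain p where "p \<in> S" "p \<in> ball y e" using S(2)[of "ball y e"] e by auto
      then show "y \<in> (\<Union>p\<in>S. ball p e)" by (auto simp: dist_commute)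
    qed
    then obtain F where F: "F \<subseteq> S" "finite F" "UNIV \<subseteq> (\<Union>p\<in>F. ball p e)"
      by (rule compactE_image[OF K, of S "\<lambda>p. ball p e", rotated]) auto
    have "\<exists>r. r \<in> \<rat> \<and> h p < r \<and> r < h p + e" for p
      using Rats_dense_in_real[of "h p" "h p + e"] e by auto
    then obtain r where r: "\<And>p. r p \<in> \<rat>" "\<And>p. h p < r p" "\<And>p. r p < h p + e" by metis
    obtain ps where ps: "set ps = F" using finite_list[OF F(2)] by auto
    define l where "l = map (\<lambda>p. (p, r p)) ps"
    have hl: "\<bar>h y - h z\<bar> \<le> dist y z" "\<bar>h y\<bar> \<le> 1" for y z using h by (auto simp: test_fn_def)
    have "\<bar>h y - f l y\<bar> \<le> \<eta>" for y
    proof -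
      have lo: "h y \<le> inf_cones l y"
      proof (rule inf_cones_lower)
        fix p r' assume "(p, r') \<in> set l"
        then have "r' = r p" by (auto simp: l_def)
        then show "h y \<le> r' + dist y p" using hl(1)[of y p] r(2)[of p] by simp
      next
        show "h y \<le> 1" using hl(2)[of y] by simp
      qed
      have "y \<in> (\<Union>p\<in>F. ball p e)" using F(3) by blast
      then obtain p where p: "p \<in> F" "dist p y < e" by auto
      have "inf_cones l y \<le> r p + dist y p"
        by (rule inf_cones_upper) (use p ps in \<open>auto simp: l_def\<close>)
      also have "\<dots> \<le> h y + 3 * e"
        using r(3)[of p] p(2) hl(1)[of p y] by (simp add: dist_commute)
      finally have "inf_cones l y \<le> h y + \<eta>" by (simp add: e_def)
      then show ?thesis using lo hl(2)[of y] by (auto simp: f_def)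
    qed
    moreover have "l \<in> lists (S \<times> \<rat>)" using F(1) ps r(1) by (auto simp: l_def)
    ultimately show "\<exists>h'\<in>f ` lists (S \<times> \<rat>). \<forall>y. \<bar>h y - h' y\<bar> \<le> \<eta>" by blast
  qed
qed

lemma space_SigmaM [simp]: "space SigmaM = {0..1} \<times> UNIV"
  by (simp add: SigmaM_def space_restrict_space)

lemma sets_mI_eq: "sets mI = sets (restrict_space borel {0..1})"
  by (auto simp: mI_def intro!: sets_restrict_space_cong)

lemma fst_SigmaM: "fst \<in> measurable (SigmaM :: (real \<times> 'k::metric_space) measure) mI"
proof -
  have "fst \<in> borel_measurable (SigmaM :: (real \<times> 'k::metric_space) measure)"
    unfolding SigmaM_def
    by (intro measurable_restrict_space1 borel_measurable_continuous_onI continuous_on_fst continuous_on_id)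
  then have "fst \<in> measurable (SigmaM :: (real \<times> 'k::metric_space) measure) (restrict_space borel {0..1})"
    by (intro measurable_restrict_space2) auto
  then show ?thesis by (subst measurable_cong_sets[OF refl sets_mI_eq])
qed

lemma snd_SigmaM: "snd \<in> measurable (SigmaM :: (real \<times> 'k::metric_space) measure) borel"
  by (auto simp: SigmaM_def intro!: measurable_restrict_space1 borel_measurable_continuous_onI continuous_on_snd continuous_on_id)

lemma measurable_SigmaM_I:
  fixes F :: "'a \<Rightarrow> real \<times> 'k::{metric_space, second_countable_topology}"
  assumes "(\<lambda>x. fst (F x)) \<in> measurable M mI" "(\<lambda>x. snd (F x)) \<in> measurable M borel"
  shows "F \<in> measurable M SigmaM"
proof -
  have 1: "(\<lambda>x. fst (F x)) \<in> measurable M borel"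
    using measurable_comp[OF assms(1), of "\<lambda>x. x" borel] by (simp add: measurable_mI comp_def)
  have "(\<lambda>x. (fst (F x), snd (F x))) \<in> measurable M (borel \<Otimes>\<^sub>M borel)"
    using 1 assms(2) by measurable
  then have "F \<in> measurable M borel" by (simp add: borel_prod)
  then show ?thesis unfolding SigmaM_def
    using measurable_space[OF assms(1)] by (intro measurable_restrict_space2) (auto simp: mem_Times_iff)
qed

lemma skew_measurable:
  fixes H :: "real \<Rightarrow> 'k \<Rightarrow> 'k::{metric_space, second_countable_topology}"
  assumes "skew_product \<tau> H"
  shows "skew \<tau> H \<in> measurable SigmaM SigmaM"
proof (rule measurable_SigmaM_I)
  show "(\<lambda>x. fst (skew \<tau> H x)) \<in> measurable SigmaM mI"
    using measurable_comp[OF fst_SigmaM, of \<tau> mI] assms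
    by (simp add: skew_product_def skew_def case_prod_unfold comp_def)
  show "(\<lambda>x. snd (skew \<tau> H x)) \<in> measurable SigmaM borel"
    using assms by (simp add: skew_product_def skew_def case_prod_unfold)
qed

lemma skew_iterate: "fst ((skew \<tau> H ^^ n) z) = (\<tau> ^^ n) (fst z)"
  by (induction n arbitrary: z) (auto simp: skew_def case_prod_unfold)

lemma distr_funpow:
  assumes "F \<in> measurable M M" "sets \<mu> = sets M" "distr \<mu> M F = \<mu>"
  shows "distr \<mu> M (F ^^ n) = \<mu>"
proof (induction n)
  case 0
  have "distr \<mu> M (\<lambda>x. x) = \<mu>" by (rule distr_id2) (simp add: assms)
  then show ?case by (simp add: id_def)
next
  case (Suc n)
  have F: "F \<in> measurable \<mu> M" using assms by (simp cong: measurable_cong_sets)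
  have "distr \<mu> M (F ^^ Suc n) = distr (distr \<mu> M F) M (F ^^ n)"
    by (subst distr_distr) (auto simp: funpow_measurable assms F funpow_swap1 comp_def)
  then show ?case using Suc assms(3) by (simp add: comp_def)
qed

text \<open>
  Extended by the null measure outside of \<open>J\<close>, a disintegration is a measurable kernel, and
  \<open>\<nu>\<close> is its composition with the projection of \<open>\<nu>\<close> to the base.
\<close>
lemma nn_integral_disintegration:
  fixes \<nu> :: "(real \<times> 'k::metric_space) measure"
  assumes d: "disintegrates \<nu> J \<kappa> \<phi>" and s: "sets \<nu> = sets SigmaM"
    and w: "w \<in> borel_measurable SigmaM"
  defines "\<kappa>' \<equiv> \<lambda>x. if x \<in> J then \<kappa> x else null_measure SigmaM"
  shows "(\<lambda>x. \<integral>\<^sup>+z. w z \<partial>\<kappa>' x) \<in> borel_measurable mI"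
    and "(\<integral>\<^sup>+z. w z \<partial>\<nu>) = (\<integral>\<^sup>+x. ennreal (\<phi> x) * (\<integral>\<^sup>+z. w z \<partial>\<kappa>' x) \<partial>mI)"
proof -
  have J: "J \<in> sets mI" "\<phi> \<in> borel_measurable mI" "density mI (\<lambda>\<gamma>. ennreal (\<phi> \<gamma>)) = distr \<nu> mI fst"
    and \<kappa>: "\<And>x. x \<in> J \<Longrightarrow> prob_space (\<kappa> x)" "\<And>x. x \<in> J \<Longrightarrow> sets (\<kappa> x) = sets SigmaM"
    and E: "\<And>E. E \<in> sets SigmaM \<Longrightarrow> (\<lambda>\<gamma>. emeasure (\<kappa> \<gamma>) E) \<in> borel_measurable (restrict_space mI J)"
      "\<And>E. E \<in> sets SigmaM \<Longrightarrow> emeasure \<nu> E = (\<integral>\<^sup>+\<gamma>\<in>J. emeasure (\<kappa> \<gamma>) E \<partial>distr \<nu> mI fst)"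
    using d by (auto simp: disintegrates_def)
  have JM: "J \<inter> space mI \<in> sets mI" using J(1) sets.sets_into_space[OF J(1)] by (simp add: Int_absorb2)
  have k: "\<kappa>' \<in> measurable mI (subprob_algebra SigmaM)"
  proof (rule measurable_subprob_algebra)
    show "subprob_space (\<kappa>' x)" for x
    proof (cases "x \<in> J")
      case True
      then show ?thesis using \<kappa>(1) by (simp add: \<kappa>'_def prob_space_imp_subprob_space)
    next
      case False
      then show ?thesis by (auto simp: \<kappa>'_def intro!: subprob_spaceI)
    qed
    show "sets (\<kappa>' x) = sets SigmaM" for x using \<kappa>(2) by (simp add: \<kappa>'_def)
    fix A :: "(real \<times> 'k) set" assume A: "A \<in> sets SigmaM"
    have "(\<lambda>x. emeasure (\<kappa>' x) A) = (\<lambda>x. emeasure (\<kappa> x) A * indicator J x)"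
      by (auto simp: \<kappa>'_def fun_eq_iff)
    then show "(\<lambda>x. emeasure (\<kappa>' x) A) \<in> borel_measurable mI"
      using E(1)[OF A] by (simp add: borel_measurable_restrict_space_iff_ennreal[OF JM])
  qed
  have w': "(\<lambda>x. \<integral>\<^sup>+z. w z \<partial>\<kappa>' x) \<in> borel_measurable mI"
    by (rule nn_integral_measurable_subprob_algebra2[OF _ k]) (use w in simp)
  then show "(\<lambda>x. \<integral>\<^sup>+z. w z \<partial>\<kappa>' x) \<in> borel_measurable mI" .
  define N where "N = distr \<nu> mI fst"
  have kN: "\<kappa>' \<in> measurable N (subprob_algebra SigmaM)" using k by (simp add: N_def cong: measurable_cong_sets)
  have ne: "space N \<noteq> {}" by (simp add: N_def)
  have "\<nu> = N \<bind> \<kappa>'"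
  proof (rule measure_eqI)
    show "sets \<nu> = sets (N \<bind> \<kappa>')" using sets_bind[OF sets_kernel[OF kN] ne] s by simp
    fix A assume "A \<in> sets \<nu>"
    then have A: "A \<in> sets SigmaM" using s by simp
    have "emeasure (N \<bind> \<kappa>') A = (\<integral>\<^sup>+x. emeasure (\<kappa>' x) A \<partial>N)" by (rule emeasure_bind[OF ne kN A])
    also have "\<dots> = (\<integral>\<^sup>+\<gamma>\<in>J. emeasure (\<kappa> \<gamma>) A \<partial>N)" by (rule nn_integral_cong) (simp add: \<kappa>'_def)
    finally show "emeasure \<nu> A = emeasure (N \<bind> \<kappa>') A" using E(2)[OF A] by (simp add: N_def)
  qed
  then have "(\<integral>\<^sup>+z. w z \<partial>\<nu>) = (\<integral>\<^sup>+x. (\<integral>\<^sup>+z. w z \<partial>\<kappa>' x) \<partial>N)"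
    using nn_integral_bind[OF w kN] by simp
  also have "\<dots> = (\<integral>\<^sup>+x. ennreal (\<phi> x) * (\<integral>\<^sup>+z. w z \<partial>\<kappa>' x) \<partial>mI)"
    unfolding N_def J(3)[symmetric] using J(2) w' by (subst nn_integral_density) auto
  finally show "(\<integral>\<^sup>+z. w z \<partial>\<nu>) = (\<integral>\<^sup>+x. ennreal (\<phi> x) * (\<integral>\<^sup>+z. w z \<partial>\<kappa>' x) \<partial>mI)" .
qed

lemma nn_integral_base:
  assumes "density mI (\<lambda>\<gamma>. ennreal (\<phi> \<gamma>)) = distr \<nu> mI fst" "\<phi> \<in> borel_measurable mI"
    "sets \<nu> = sets (SigmaM :: (real \<times> 'k::metric_space) measure)" "u \<in> borel_measurable mI"
  shows "(\<integral>\<^sup>+z. u (fst z) \<partial>(\<nu> :: (real \<times> 'k) measure)) = (\<integral>\<^sup>+x. ennreal (\<phi> x) * u x \<partial>mI)"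
proof -
  have f: "fst \<in> measurable \<nu> mI" using fst_SigmaM assms(3) by (simp cong: measurable_cong_sets)
  have "(\<integral>\<^sup>+z. u (fst z) \<partial>\<nu>) = (\<integral>\<^sup>+x. u x \<partial>distr \<nu> mI fst)"
    using f assms(4) by (subst nn_integral_distr) auto
  also have "\<dots> = (\<integral>\<^sup>+x. ennreal (\<phi> x) * u x \<partial>mI)"
    unfolding assms(1)[symmetric] using assms(2,4) by (subst nn_integral_density) auto
  finally show ?thesis .
qed

section \<open>The iterates approximate the fibers of the invariant measure\<close>

lemma AE_le_if_nn_integral_le:
  assumes p: "p \<in> borel_measurable M" and q: "q \<in> borel_measurable M" and fin: "(\<integral>\<^sup>+x. q x \<partial>M) < \<infinity>"
    and le: "\<And>E. E \<in> sets M \<Longrightarrow> (\<integral>\<^sup>+x. p x * indicator E x \<partial>M) \<le> (\<integral>\<^sup>+x. q x * indicator E x \<partial>M)"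
  shows "AE x in M. p x \<le> q x"
proof -
  have [measurable]: "p \<in> borel_measurable M" "q \<in> borel_measurable M" by fact+
  define E where "E = {x \<in> space M. q x < p x}"
  have E [measurable]: "E \<in> sets M" unfolding E_def by measurable
  have qE: "(\<integral>\<^sup>+x. q x * indicator E x \<partial>M) < \<infinity>"
    by (rule order.strict_trans1[OF _ fin]) (auto intro!: nn_integral_mono simp: indicator_def)
  have "(\<integral>\<^sup>+x. q x * indicator E x \<partial>M) + (\<integral>\<^sup>+x. (p x - q x) * indicator E x \<partial>M) =
      (\<integral>\<^sup>+x. p x * indicator E x \<partial>M)"
    by (subst nn_integral_add[symmetric])
      (auto intro!: nn_integral_cong simp: indicator_def E_def less_imp_le add_diff_inverse_ennreal)
  also have "\<dots> \<le> (\<integral>\<^sup>+x. q x * indicator E x \<partial>M) + 0" using le[OF E] by simp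
  finally have "(\<integral>\<^sup>+x. (p x - q x) * indicator E x \<partial>M) = 0"
    using qE unfolding ennreal_add_left_cancel_le by auto
  then have "AE x in M. (p x - q x) * indicator E x = 0" by (subst (asm) nn_integral_0_iff_AE) auto
  then show ?thesis using AE_space
    by eventually_elim (auto simp: E_def indicator_def diff_eq_0_iff_ennreal split: if_splits)
qed

context skewed begin

lemma iter_path_scale: "iter_path n x (\<lambda>z. c * h z) = c * iter_path n x h"
proof (induction n arbitrary: x h)
  case (Suc n)
  have "branch_term (\<lambda>u. c * iter_path n u (\<lambda>z. h (H u z))) i x = c * branch_term (\<lambda>u. iter_path n u (\<lambda>z. h (H u z))) i x" for i
    by (simp add: branch_term_def)
  then show ?case using Suc[of _ "\<lambda>z. h (H _ z)"] by (simp add: pushforward_def infsum_cmult_right')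
qed simp

text \<open>
  Each step of the recursion is the transfer operator of \<open>\<tau>\<close> on the base composed with
  \<open>H\<close> on the fiber, so the duality of the transfer operator moves all \<open>n\<close> steps onto
  the integrand. The function \<open>w\<close> depends on the base point as well since the induction replaces
  \<open>w\<close> by \<open>w \<circ> skew \<tau> H\<close>.
\<close>
lemma iter_path_transfer:
  assumes sk: "skew_product \<tau> H" and \<phi>: "integrable mI \<phi>" "\<And>x. x \<in> {0..1} \<Longrightarrow> 0 \<le> \<phi> x"
    and w: "w \<in> borel_measurable SigmaM" "\<And>z. z \<in> space SigmaM \<Longrightarrow> 0 \<le> w z" "\<And>z. z \<in> space SigmaM \<Longrightarrow> w z \<le> K"
  shows "integrable mI (\<lambda>x. iter_path n x (\<lambda>z. w (x, z))) \<and> (\<forall>x\<in>{0..1}. 0 \<le> iter_path n x (\<lambda>z. w (x, z))) \<and>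
     (\<integral>x. iter_path n x (\<lambda>z. w (x, z)) \<partial>mI) = (\<integral>x. \<phi> x * w ((skew \<tau> H ^^ n) (x, y0)) \<partial>mI)"
  using w
proof (induction n arbitrary: w)
  case 0
  have "(\<lambda>x. (x, y0)) \<in> measurable mI SigmaM" by (rule measurable_SigmaM_I) auto
  then have "(\<lambda>x. w (x, y0)) \<in> borel_measurable mI" using 0(1) by simp
  then have "integrable mI (\<lambda>x. w (x, y0) * \<phi> x)"
    by (rule integrable_bounded_mult[OF \<phi>(1), where C = K]) (use 0(2,3) in \<open>simp add: abs_le_iff\<close>)
  then show ?case using \<phi>(2) 0(2) by (simp add: mult.commute)
next
  case (Suc n)
  define w' where "w' z = w (skew \<tau> H z)" for z
  have sm: "skew \<tau> H \<in> measurable SigmaM SigmaM" by (rule skew_measurable[OF sk])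
  have w': "w' \<in> borel_measurable SigmaM" "\<And>z. z \<in> space SigmaM \<Longrightarrow> 0 \<le> w' z" "\<And>z. z \<in> space SigmaM \<Longrightarrow> w' z \<le> K"
  proof -
    show "w' \<in> borel_measurable SigmaM"
      using measurable_comp[OF sm Suc.prems(1)] by (simp add: w'_def[abs_def] comp_def)
    show "0 \<le> w' z" "w' z \<le> K" if "z \<in> space SigmaM" for z
      unfolding w'_def by (rule Suc.prems(2,3), rule measurable_space[OF sm that])+
  qed
  define q where "q u = iter_path n u (\<lambda>z. w' (u, z))" for u
  have q: "integrable mI q" "\<And>u. u \<in> {0..1} \<Longrightarrow> 0 \<le> q u"
    "(\<integral>x. q x \<partial>mI) = (\<integral>x. \<phi> x * w' ((skew \<tau> H ^^ n) (x, y0)) \<partial>mI)"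
    using Suc.IH[OF w'] by (auto simp: q_def[abs_def])
  have "branch_term (\<lambda>u. iter_path n u (\<lambda>z. w (x, H u z))) i x = branch_term q i x" if "i \<in> Q" for i x
    using preim(2)[OF that] by (auto simp: branch_term_def q_def w'_def skew_def)
  then have Tq: "iter_path (Suc n) x (\<lambda>z. w (x, z)) = pushforward q x" for x
    by (simp add: pushforward_def cong: infsum_cong)
  show ?case
    using pushforward_nonneg_props(2,3,4)[OF q(1,2)] q(3) by (simp add: Tq w'_def del: iter_path.simps)
qed

end

lemma skew_iterate_contraction:
  assumes "\<And>j. j < n \<Longrightarrow> \<forall>z z'. dist (H ((\<tau> ^^ j) x) z) (H ((\<tau> ^^ j) x) z') \<le> a * dist z z'" "0 \<le> a"
  shows "dist (snd ((skew \<tau> H ^^ n) (x, y))) (snd ((skew \<tau> H ^^ n) (x, y'))) \<le> a ^ n * dist y y'"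
  using assms(1)
proof (induction n)
  case (Suc n)
  have s: "snd ((skew \<tau> H ^^ Suc n) (x, y)) = H ((\<tau> ^^ n) x) (snd ((skew \<tau> H ^^ n) (x, y)))" for y
    using skew_iterate[of n \<tau> H "(x, y)"] by (simp add: skew_def case_prod_unfold)
  have "dist (snd ((skew \<tau> H ^^ Suc n) (x, y))) (snd ((skew \<tau> H ^^ Suc n) (x, y'))) \<le>
      a * dist (snd ((skew \<tau> H ^^ n) (x, y))) (snd ((skew \<tau> H ^^ n) (x, y')))"
    unfolding s using Suc.prems by blast
  also have "\<dots> \<le> a * (a ^ n * dist y y')"
    using Suc by (intro mult_left_mono assms(2)) auto
  finally show ?case by simp
qed simp

locale invariant_skewed = skewed Q \<tau> H \<phi> y0
  for Q \<tau> and H :: "real \<Rightarrow> 'k::{metric_space, second_countable_topology} \<Rightarrow> 'k" and \<phi> y0 +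
  fixes \<mu> :: "(real \<times> 'k) measure" and J0 \<kappa> a
  assumes sk: "skew_product \<tau> H"
    and inv: "invariant_probability \<tau> H \<mu>"
    and dis: "disintegrates \<mu> J0 \<kappa> \<phi>"
    and \<phi>_nonneg: "\<And>x. 0 \<le> \<phi> x"
    and diam: "\<And>z z' :: 'k. dist z z' \<le> 1"
    and a: "0 \<le> a"
    and contr: "AE x in mI. \<forall>z z'. dist (H x z) (H x z') \<le> a * dist z z'"
begin

lemma \<mu>_sets: "sets \<mu> = sets SigmaM" and \<mu>_prob: "prob_space \<mu>" and \<mu>_inv: "distr \<mu> SigmaM (skew \<tau> H) = \<mu>"
  using inv by (auto simp: invariant_probability_def)

lemma \<phi>_meas [measurable]: "\<phi> \<in> borel_measurable mI" and \<phi>_dens: "density mI (\<lambda>x. ennreal (\<phi> x)) = distr \<mu> mI fst"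
  using dis by (auto simp: disintegrates_def)

lemma iterate_meas: "skew \<tau> H ^^ n \<in> measurable SigmaM SigmaM"
  by (rule funpow_measurable[OF skew_measurable[OF sk]])

lemma iterate_inv: "distr \<mu> SigmaM (skew \<tau> H ^^ n) = \<mu>"
  by (rule distr_funpow[OF skew_measurable[OF sk] \<mu>_sets \<mu>_inv])

lemma iterate_meas': "skew \<tau> H ^^ n \<in> measurable \<mu> SigmaM"
  using iterate_meas \<mu>_sets by (simp cong: measurable_cong_sets)

lemma base_integral:
  assumes "u \<in> borel_measurable mI"
  shows "(\<integral>\<^sup>+z. u (fst z) \<partial>\<mu>) = (\<integral>\<^sup>+x. ennreal (\<phi> x) * u x \<partial>mI)"
  by (rule nn_integral_base[OF \<phi>_dens \<phi>_meas \<mu>_sets assms])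

lemma iterate_integral:
  assumes "w \<in> borel_measurable SigmaM"
  shows "(\<integral>\<^sup>+z. w ((skew \<tau> H ^^ n) z) \<partial>\<mu>) = (\<integral>\<^sup>+z. w z \<partial>\<mu>)"
proof -
  have "(\<integral>\<^sup>+z. w z \<partial>\<mu>) = (\<integral>\<^sup>+z. w z \<partial>distr \<mu> SigmaM (skew \<tau> H ^^ n))" by (simp add: iterate_inv)
  also have "\<dots> = (\<integral>\<^sup>+z. w ((skew \<tau> H ^^ n) z) \<partial>\<mu>)"
    by (rule nn_integral_distr[OF iterate_meas']) (simp add: assms)
  finally show ?thesis by simp
qed

lemma \<phi>_integral: "(\<integral>\<^sup>+x. ennreal (\<phi> x) \<partial>mI) = 1"
  using base_integral[of "\<lambda>_. 1"] prob_space.emeasure_space_1[OF \<mu>_prob] by simp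

lemma \<phi>_integrable: "integrable mI \<phi>"
  by (rule integrableI_nonneg) (auto simp: \<phi>_integral \<phi>_nonneg)

lemma AE_base: "AE x in mI. R x \<Longrightarrow> AE z in \<mu>. R (fst z)"
proof -
  assume R: "AE x in mI. R x"
  have f: "fst \<in> measurable \<mu> mI" using fst_SigmaM \<mu>_sets by (simp cong: measurable_cong_sets)
  have "AE x in density mI (\<lambda>x. ennreal (\<phi> x)). R x"
    using R by (subst AE_density) (auto elim: eventually_mono)
  then show ?thesis unfolding \<phi>_dens by (rule AE_distrD[OF f])
qed

lemma AE_iterate: "AE z in \<mu>. R z \<Longrightarrow> AE z in \<mu>. R ((skew \<tau> H ^^ n) z)"
  by (rule AE_distrD[OF iterate_meas'], subst iterate_inv)

text \<open>
  Two points of a fiber, which has diameter at most \<open>1\<close>, are contracted \<open>n\<close> times.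
  The contraction holds only for almost every base point, but it holds along whole orbits because
  \<open>\<mu>\<close> is invariant.
\<close>
lemma AE_close:
  "AE z in \<mu>. dist (snd ((skew \<tau> H ^^ n) z)) (snd ((skew \<tau> H ^^ n) (fst z, y0))) \<le> a ^ n"
proof -
  have "AE z in \<mu>. \<forall>y y'. dist (H ((\<tau> ^^ j) (fst z)) y) (H ((\<tau> ^^ j) (fst z)) y') \<le> a * dist y y'" for j
    using AE_iterate[OF AE_base[OF contr], of j] by (simp add: skew_iterate)
  then have "AE z in \<mu>. \<forall>j. \<forall>y y'. dist (H ((\<tau> ^^ j) (fst z)) y) (H ((\<tau> ^^ j) (fst z)) y') \<le> a * dist y y'"
    by (simp add: AE_all_countable)
  then show ?thesis
  proof eventually_elim
    fix z :: "real \<times> 'k"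
    assume z: "\<forall>j. \<forall>y y'. dist (H ((\<tau> ^^ j) (fst z)) y) (H ((\<tau> ^^ j) (fst z)) y') \<le> a * dist y y'"
    have "dist (snd ((skew \<tau> H ^^ n) (fst z, snd z))) (snd ((skew \<tau> H ^^ n) (fst z, y0))) \<le> a ^ n * dist (snd z) y0"
      by (rule skew_iterate_contraction[OF _ a]) (use z in blast)
    also have "\<dots> \<le> a ^ n * 1" using diam a by (intro mult_left_mono) auto
    finally show "dist (snd ((skew \<tau> H ^^ n) z)) (snd ((skew \<tau> H ^^ n) (fst z, y0))) \<le> a ^ n" by simp
  qed
qed

text \<open>
  The projection of \<open>\<mu>\<close> is invariant under \<open>\<tau>\<close>, so its density is fixed by
  the transfer operator.
\<close>
lemma pushforward_\<phi>: "AE x in mI. (\<lambda>i. branch_term \<phi> i x) summable_on Q \<and> pushforward \<phi> x = \<phi> x"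
proof -
  note pp = pushforward_nonneg_props[OF \<phi>_integrable \<phi>_nonneg]
  have "(\<integral>x. pushforward \<phi> x * indicator E x \<partial>mI) = (\<integral>x. \<phi> x * indicator E x \<partial>mI)" if E: "E \<in> sets mI" for E
  proof -
    define q where "q u = \<phi> u * indicator E (\<tau> u)" for u
    have m: "(\<lambda>u. indicator E (\<tau> u) :: real) \<in> borel_measurable mI" using meas E by measurable
    have "integrable mI (\<lambda>u. indicator E (\<tau> u) * \<phi> u)"
      by (rule integrable_bounded_mult[OF \<phi>_integrable m, where C = 1]) (simp add: indicator_def)
    then have q: "integrable mI q" "\<And>u. 0 \<le> q u" by (auto simp: q_def[abs_def] mult.commute \<phi>_nonneg)
    have "branch_term q i x = indicator E x * branch_term \<phi> i x" if "i \<in> Q" for i x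
      using preim(2)[OF that] by (auto simp: branch_term_def q_def)
    then have "pushforward q x = pushforward \<phi> x * indicator E x" for x
      by (simp add: pushforward_def infsum_cmult_right' mult.commute cong: infsum_cong)
    then have "(\<integral>x. pushforward \<phi> x * indicator E x \<partial>mI) = (\<integral>x. q x \<partial>mI)"
      using pushforward_nonneg_props(3)[OF q] by simp
    also have "\<dots> = enn2real (\<integral>\<^sup>+x. ennreal (q x) \<partial>mI)" using q by (intro integral_eq_nn_integral) auto
    also have "(\<integral>\<^sup>+x. ennreal (q x) \<partial>mI) = (\<integral>\<^sup>+x. ennreal (\<phi> x) * indicator E (\<tau> x) \<partial>mI)"
      by (intro nn_integral_cong) (auto simp: q_def indicator_def)
    also have "\<dots> = (\<integral>\<^sup>+z. indicator E (\<tau> (fst z)) \<partial>\<mu>)"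
      using meas E by (subst base_integral) auto
    also have "\<dots> = (\<integral>\<^sup>+z. indicator E (fst ((skew \<tau> H ^^ 1) z)) \<partial>\<mu>)"
      by (simp add: skew_iterate[of 1, simplified])
    also have "\<dots> = (\<integral>\<^sup>+z. indicator E (fst z) \<partial>\<mu>)"
      using measurable_comp[OF fst_SigmaM borel_measurable_indicator[OF E]]
      by (intro iterate_integral) (simp add: comp_def)
    also have "\<dots> = (\<integral>\<^sup>+x. ennreal (\<phi> x) * indicator E x \<partial>mI)"
      using E by (subst base_integral) auto
    also have "\<dots> = (\<integral>\<^sup>+x. ennreal (\<phi> x * indicator E x) \<partial>mI)"
      by (intro nn_integral_cong) (auto simp: indicator_def)
    also have "enn2real \<dots> = (\<integral>x. \<phi> x * indicator E x \<partial>mI)"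
      using E by (intro integral_eq_nn_integral[symmetric]) (auto simp: \<phi>_nonneg)
    finally show ?thesis .
  qed
  then have "AE x in mI. pushforward \<phi> x = \<phi> x"
    using pp(2) \<phi>_integrable by (intro density_unique_real) (auto simp: set_lebesgue_integral_def mult.commute)
  with pp(1) show ?thesis by eventually_elim auto
qed

text \<open>
  Both sides are compared after integration over a set \<open>E\<close> of base points. By duality the iterate
  integrates \<open>h (H\<^sub>n (x, y0))\<close> and by invariance the path of \<open>\<mu>\<close>
  integrates \<open>h (H\<^sub>n (x, y))\<close>, both against \<open>\<mu>\<close> and over the same preimage
  of \<open>E\<close>, where \<open>H\<^sub>n\<close> denotes the fiber component of the \<open>n\<close>-th
  iterate; these integrands are \<open>a ^ n\<close>-close. Adding \<open>1\<close> makes \<open>h\<close>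
  nonnegative, as the transfer of integrals requires.
\<close>
lemma approximation_by_iterates:
  assumes h: "test_fn h"
  shows "AE x in mI. x \<in> J0 \<longrightarrow>
     \<bar>iter_path n x (\<lambda>z. h z + 1) - (\<phi> x * (\<integral>z. h (snd z) \<partial>\<kappa> x) + \<phi> x)\<bar> \<le> a ^ n * \<phi> x"
proof -
  define F where "F = skew \<tau> H ^^ n"
  have hb: "\<bar>h y\<bar> \<le> 1" "\<bar>h y - h y'\<bar> \<le> dist y y'" for y y' using h by (auto simp: test_fn_def)
  have h1: "0 \<le> h y + 1" for y using hb(1)[of y] by (simp add: abs_le_iff)
  have hm [measurable]: "h \<in> borel_measurable borel" by (rule test_fn_measurable[OF h])
  have an: "0 \<le> a ^ n" using a by simp
  have hs: "(\<lambda>z. h (snd z)) \<in> borel_measurable (SigmaM :: (real \<times> 'k) measure)"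
    using measurable_comp[OF snd_SigmaM hm] by (simp add: comp_def)
  define \<kappa>' where "\<kappa>' = (\<lambda>x. if x \<in> J0 then \<kappa> x else null_measure SigmaM)"
  define X where "X x = (\<integral>\<^sup>+z. ennreal (h (snd z) + 1) \<partial>\<kappa>' x)" for x
  have wm: "(\<lambda>z. ennreal (h (snd z) + 1)) \<in> borel_measurable (SigmaM :: (real \<times> 'k) measure)"
    using hs by measurable
  have Xm [measurable]: "X \<in> borel_measurable mI"
    using nn_integral_disintegration(1)[OF dis \<mu>_sets wm] by (simp add: X_def[abs_def] \<kappa>'_def)
  define p where "p x = iter_path n x (\<lambda>z. h z + 1)" for x
  have Tp: "integrable mI (\<lambda>x. iter_path n x (\<lambda>z. w (x, z)))" "\<forall>x\<in>{0..1}. 0 \<le> iter_path n x (\<lambda>z. w (x, z))"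
     "(\<integral>x. iter_path n x (\<lambda>z. w (x, z)) \<partial>mI) = (\<integral>x. \<phi> x * w (F (x, y0)) \<partial>mI)"
    if "w \<in> borel_measurable SigmaM" "\<And>z. 0 \<le> w z" "\<And>z. w z \<le> 2" for w
    using iter_path_transfer[OF sk \<phi>_integrable \<phi>_nonneg that(1,2,3)] by (auto simp: F_def)
  have h2: "h y + 1 \<le> 2" for y using hb(1)[of y] by (simp add: abs_le_iff)
  have pint: "integrable mI p" and pnn: "\<And>x. x \<in> {0..1} \<Longrightarrow> 0 \<le> p x"
    using Tp[of "\<lambda>z. h (snd z) + 1"] hs h1 h2 by (auto simp: p_def[abs_def])
  have pm [measurable]: "p \<in> borel_measurable mI" using pint by auto
  have fst0: "(\<lambda>x. (x, y0)) \<in> measurable mI SigmaM" by (rule measurable_SigmaM_I) auto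
  have Fm: "F \<in> measurable SigmaM SigmaM" unfolding F_def by (rule iterate_meas)
  have hF0: "(\<lambda>x. h (snd (F (x, y0)))) \<in> borel_measurable mI"
    using measurable_comp[OF fst0 measurable_comp[OF Fm hs]] by (simp add: comp_def)
  have \<tau>n: "\<tau> ^^ n \<in> measurable mI mI" by (rule funpow_measurable[OF meas])
  have fm: "fst \<in> measurable \<mu> mI" using fst_SigmaM \<mu>_sets by (simp cong: measurable_cong_sets)
  have hF0': "(\<lambda>z. h (snd (F (fst z, y0)))) \<in> borel_measurable \<mu>"
    using measurable_comp[OF fm hF0] by (simp add: comp_def)
  have hF': "(\<lambda>z. h (snd (F z))) \<in> borel_measurable \<mu>"
    using measurable_comp[OF iterate_meas' hs, of n] by (simp add: comp_def F_def)
  {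
    fix E assume E: "E \<in> sets mI"
    have iE: "(\<lambda>z. indicator E (fst z) :: real) \<in> borel_measurable (SigmaM :: (real \<times> 'k) measure)"
      using measurable_comp[OF fst_SigmaM borel_measurable_indicator[OF E]] by (simp add: comp_def)
    have iE': "(\<lambda>z. indicator E (fst z) :: ennreal) \<in> borel_measurable (SigmaM :: (real \<times> 'k) measure)"
      using measurable_comp[OF fst_SigmaM borel_measurable_indicator[OF E]] by (simp add: comp_def)
    have iEn: "(\<lambda>x. indicator E ((\<tau> ^^ n) x) :: ennreal) \<in> borel_measurable mI"
      using measurable_comp[OF \<tau>n borel_measurable_indicator[OF E]] by (simp add: comp_def)
    have iEnm: "(\<lambda>z. indicator E ((\<tau> ^^ n) (fst z)) :: ennreal) \<in> borel_measurable \<mu>"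
      using measurable_comp[OF fm iEn] by (simp add: comp_def)
    \<comment> \<open>the three integrals over \<open>E\<close>, all written as integrals over \<open>\<mu>\<close>\<close>
    have A: "(\<integral>\<^sup>+x. ennreal (p x) * indicator E x \<partial>mI) =
       (\<integral>\<^sup>+z. indicator E ((\<tau> ^^ n) (fst z)) * ennreal (h (snd (F (fst z, y0))) + 1) \<partial>\<mu>)"
    proof -
      define w where "w z = indicator E (fst z) * (h (snd z) + 1)" for z :: "real \<times> 'k"
      have wS: "w \<in> borel_measurable SigmaM" unfolding w_def using iE hs by measurable
      have wb: "0 \<le> w z" "w z \<le> 2" for z using h1 h2 by (auto simp: w_def indicator_def)
      have Tw: "iter_path n x (\<lambda>z. w (x, z)) = indicator E x * p x" for x
        unfolding w_def p_def by (simp add: iter_path_scale)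
      note t = Tp[OF wS wb]
      have wF: "w (F (x, y0)) = indicator E ((\<tau> ^^ n) x) * (h (snd (F (x, y0))) + 1)" for x
        by (simp add: w_def F_def skew_iterate)
      have Fn: "(\<lambda>x. w (F (x, y0))) \<in> borel_measurable mI"
        using measurable_comp[OF fst0 measurable_comp[OF Fm wS]] by (simp add: comp_def)
      have i2: "integrable mI (\<lambda>x. \<phi> x * w (F (x, y0)))"
        using integrable_bounded_mult[OF \<phi>_integrable Fn, of 2] wb by (simp add: mult.commute abs_of_nonneg)
      have "(\<integral>\<^sup>+x. ennreal (p x) * indicator E x \<partial>mI) = (\<integral>\<^sup>+x. ennreal (iter_path n x (\<lambda>z. w (x, z))) \<partial>mI)"
        by (intro nn_integral_cong) (simp add: Tw indicator_def)
      also have "\<dots> = ennreal (\<integral>x. iter_path n x (\<lambda>z. w (x, z)) \<partial>mI)"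
        using t(1,2) by (intro nn_integral_eq_integral) auto
      also have "\<dots> = ennreal (\<integral>x. \<phi> x * w (F (x, y0)) \<partial>mI)" by (simp add: t(3))
      also have "\<dots> = (\<integral>\<^sup>+x. ennreal (\<phi> x * w (F (x, y0))) \<partial>mI)"
        using i2 wb \<phi>_nonneg by (intro nn_integral_eq_integral[symmetric]) auto
      also have "\<dots> = (\<integral>\<^sup>+x. ennreal (\<phi> x) * (indicator E ((\<tau> ^^ n) x) * ennreal (h (snd (F (x, y0))) + 1)) \<partial>mI)"
        by (intro nn_integral_cong) (simp add: wF ennreal_mult' \<phi>_nonneg indicator_def)
      also have "\<dots> = (\<integral>\<^sup>+z. indicator E ((\<tau> ^^ n) (fst z)) * ennreal (h (snd (F (fst z, y0))) + 1) \<partial>\<mu>)"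
        by (intro base_integral[symmetric] borel_measurable_times_ennreal iEn
            measurable_compose[OF _ measurable_ennreal] borel_measurable_add hF0 borel_measurable_const)
      finally show ?thesis .
    qed
    have G: "(\<integral>\<^sup>+x. (ennreal (\<phi> x) * X x) * indicator E x \<partial>mI) =
       (\<integral>\<^sup>+z. indicator E ((\<tau> ^^ n) (fst z)) * ennreal (h (snd (F z)) + 1) \<partial>\<mu>)"
    proof -
      define w :: "real \<times> 'k \<Rightarrow> ennreal" where "w z = indicator E (fst z) * ennreal (h (snd z) + 1)" for z
      have wS: "w \<in> borel_measurable SigmaM" unfolding w_def using iE' wm by measurable
      have inner: "X x * indicator E x = (\<integral>\<^sup>+z. w z \<partial>\<kappa>' x)" for x
      proof (cases "x \<in> J0")
        case True
        then have k: "prob_space (\<kappa> x)" "sets (\<kappa> x) = sets SigmaM" "emeasure (\<kappa> x) ({x} \<times> UNIV) = 1"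
          using dis by (auto simp: disintegrates_def)
        interpret k: prob_space "\<kappa> x" by (rule k(1))
        have "AE z in \<kappa> x. z \<in> {x} \<times> UNIV" using k(3) by (intro k.AE_prob_1) (simp add: measure_def)
        then have "(\<integral>\<^sup>+z. w z \<partial>\<kappa> x) = (\<integral>\<^sup>+z. ennreal (h (snd z) + 1) * indicator E x \<partial>\<kappa> x)"
          by (intro nn_integral_cong_AE) (auto simp: w_def mult.commute)
        also have "\<dots> = X x * indicator E x"
          using wm k(2) True by (subst nn_integral_multc) (auto simp: X_def \<kappa>'_def cong: measurable_cong_sets)
        finally show ?thesis using True by (simp add: \<kappa>'_def)
      qed (simp add: X_def \<kappa>'_def)
      have "(\<integral>\<^sup>+x. (ennreal (\<phi> x) * X x) * indicator E x \<partial>mI) = (\<integral>\<^sup>+x. ennreal (\<phi> x) * (\<integral>\<^sup>+z. w z \<partial>\<kappa>' x) \<partial>mI)"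
        by (intro nn_integral_cong) (simp add: inner[symmetric] mult.assoc)
      also have "\<dots> = (\<integral>\<^sup>+z. w z \<partial>\<mu>)"
        using nn_integral_disintegration(2)[OF dis \<mu>_sets wS] by (simp add: \<kappa>'_def)
      also have "\<dots> = (\<integral>\<^sup>+z. w (F z) \<partial>\<mu>)" unfolding F_def by (rule iterate_integral[OF wS, symmetric])
      also have "\<dots> = (\<integral>\<^sup>+z. indicator E ((\<tau> ^^ n) (fst z)) * ennreal (h (snd (F z)) + 1) \<partial>\<mu>)"
        by (simp add: w_def F_def skew_iterate)
      finally show ?thesis .
    qed
    have R: "(\<integral>\<^sup>+x. ennreal (a ^ n * \<phi> x) * indicator E x \<partial>mI) =
       (\<integral>\<^sup>+z. indicator E ((\<tau> ^^ n) (fst z)) * ennreal (a ^ n) \<partial>\<mu>)"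
    proof -
      have "(\<integral>\<^sup>+z. indicator E ((\<tau> ^^ n) (fst z)) * ennreal (a ^ n) \<partial>\<mu>) =
          (\<integral>\<^sup>+z. (indicator E (fst (F z)) * ennreal (a ^ n)) \<partial>\<mu>)"
        by (simp add: F_def skew_iterate)
      also have "\<dots> = (\<integral>\<^sup>+z. indicator E (fst z) * ennreal (a ^ n) \<partial>\<mu>)"
        unfolding F_def by (intro iterate_integral borel_measurable_times_ennreal iE' borel_measurable_const)
      also have "\<dots> = (\<integral>\<^sup>+x. ennreal (\<phi> x) * (indicator E x * ennreal (a ^ n)) \<partial>mI)"
        using E by (intro base_integral borel_measurable_times_ennreal borel_measurable_const) simp
      also have "\<dots> = (\<integral>\<^sup>+x. ennreal (a ^ n * \<phi> x) * indicator E x \<partial>mI)"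
        by (intro nn_integral_cong) (simp add: ennreal_mult an \<phi>_nonneg mult_ac)
      finally show ?thesis by simp
    qed
    have dom: "(\<integral>\<^sup>+z. indicator E ((\<tau> ^^ n) (fst z)) * ennreal (h (v z) + 1) \<partial>\<mu>) \<le>
        (\<integral>\<^sup>+z. indicator E ((\<tau> ^^ n) (fst z)) * ennreal (h (v' z) + 1) \<partial>\<mu>) +
        (\<integral>\<^sup>+z. indicator E ((\<tau> ^^ n) (fst z)) * ennreal (a ^ n) \<partial>\<mu>)"
      if v': "(\<lambda>z. h (v' z)) \<in> borel_measurable \<mu>" and close: "AE z in \<mu>. dist (v z) (v' z) \<le> a ^ n" for v v'
    proof -
      have "(\<integral>\<^sup>+z. indicator E ((\<tau> ^^ n) (fst z)) * ennreal (h (v z) + 1) \<partial>\<mu>) \<le>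
        (\<integral>\<^sup>+z. indicator E ((\<tau> ^^ n) (fst z)) * ennreal (h (v' z) + 1) + indicator E ((\<tau> ^^ n) (fst z)) * ennreal (a ^ n) \<partial>\<mu>)"
      proof (rule nn_integral_mono_AE)
        show "AE z in \<mu>. indicator E ((\<tau> ^^ n) (fst z)) * ennreal (h (v z) + 1)
           \<le> indicator E ((\<tau> ^^ n) (fst z)) * ennreal (h (v' z) + 1) + indicator E ((\<tau> ^^ n) (fst z)) * ennreal (a ^ n)"
          using close
        proof eventually_elim
          fix z assume "dist (v z) (v' z) \<le> a ^ n"
          then have "h (v z) + 1 \<le> (h (v' z) + 1) + a ^ n" using hb(2)[of "v z" "v' z"] by simp
          then have "ennreal (h (v z) + 1) \<le> ennreal (h (v' z) + 1) + ennreal (a ^ n)"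
            using h1[of "v' z"] an by (subst ennreal_plus[symmetric]) (auto intro: ennreal_leI simp del: ennreal_plus)
          then show "indicator E ((\<tau> ^^ n) (fst z)) * ennreal (h (v z) + 1)
            \<le> indicator E ((\<tau> ^^ n) (fst z)) * ennreal (h (v' z) + 1) + indicator E ((\<tau> ^^ n) (fst z)) * ennreal (a ^ n)"
            by (simp add: indicator_def)
        qed
      qed
      also have "\<dots> = (\<integral>\<^sup>+z. indicator E ((\<tau> ^^ n) (fst z)) * ennreal (h (v' z) + 1) \<partial>\<mu>) +
        (\<integral>\<^sup>+z. indicator E ((\<tau> ^^ n) (fst z)) * ennreal (a ^ n) \<partial>\<mu>)"
        by (intro nn_integral_add borel_measurable_times_ennreal iEnm borel_measurable_const
            measurable_compose[OF _ measurable_ennreal] borel_measurable_add v')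
      finally show ?thesis .
    qed
    have le1: "(\<integral>\<^sup>+x. ennreal (p x) * indicator E x \<partial>mI) \<le>
        (\<integral>\<^sup>+x. (ennreal (\<phi> x) * X x + ennreal (a ^ n * \<phi> x)) * indicator E x \<partial>mI)"
    proof -
      have "(\<integral>\<^sup>+x. (ennreal (\<phi> x) * X x + ennreal (a ^ n * \<phi> x)) * indicator E x \<partial>mI) =
         (\<integral>\<^sup>+x. (ennreal (\<phi> x) * X x) * indicator E x \<partial>mI) + (\<integral>\<^sup>+x. ennreal (a ^ n * \<phi> x) * indicator E x \<partial>mI)"
        using E by (subst nn_integral_add[symmetric]) (auto simp: distrib_right)
      then show ?thesis unfolding A G R
        using dom[OF hF', of "\<lambda>z. snd (F (fst z, y0))"] AE_close[of n] by (simp add: F_def dist_commute)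
    qed
    have le2: "(\<integral>\<^sup>+x. (ennreal (\<phi> x) * X x) * indicator E x \<partial>mI) \<le>
        (\<integral>\<^sup>+x. (ennreal (p x) + ennreal (a ^ n * \<phi> x)) * indicator E x \<partial>mI)"
    proof -
      have "(\<integral>\<^sup>+x. (ennreal (p x) + ennreal (a ^ n * \<phi> x)) * indicator E x \<partial>mI) =
         (\<integral>\<^sup>+x. ennreal (p x) * indicator E x \<partial>mI) + (\<integral>\<^sup>+x. ennreal (a ^ n * \<phi> x) * indicator E x \<partial>mI)"
        using E by (subst nn_integral_add[symmetric]) (auto simp: distrib_right)
      then show ?thesis unfolding A G R
        using dom[OF hF0', of "\<lambda>z. snd (F z)"] AE_close[of n] by (simp add: F_def)
    qed
    note le1 le2
  }
  note le = this
  have fin3: "(\<integral>\<^sup>+x. ennreal (a ^ n * \<phi> x) \<partial>mI) < \<infinity>"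
    using integrable_mult_right[OF \<phi>_integrable, of "a ^ n"] an \<phi>_nonneg
    by (subst nn_integral_eq_integral) auto
  have fin1: "(\<integral>\<^sup>+x. ennreal (p x) \<partial>mI) < \<infinity>"
    using pint pnn by (subst nn_integral_eq_integral) auto
  have fin2: "(\<integral>\<^sup>+x. ennreal (\<phi> x) * X x \<partial>mI) < \<infinity>"
  proof -
    have "(\<integral>\<^sup>+x. ennreal (\<phi> x) * X x \<partial>mI) = (\<integral>\<^sup>+x. (ennreal (\<phi> x) * X x) * indicator {0..1} x \<partial>mI)"
      by (intro nn_integral_cong) auto
    also have "\<dots> \<le> (\<integral>\<^sup>+x. (ennreal (p x) + ennreal (a ^ n * \<phi> x)) * indicator {0..1} x \<partial>mI)"
      by (rule le(2)) (simp add: sets_mI)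
    also have "\<dots> = (\<integral>\<^sup>+x. ennreal (p x) + ennreal (a ^ n * \<phi> x) \<partial>mI)" by (intro nn_integral_cong) auto
    also have "\<dots> = (\<integral>\<^sup>+x. ennreal (p x) \<partial>mI) + (\<integral>\<^sup>+x. ennreal (a ^ n * \<phi> x) \<partial>mI)"
      by (intro nn_integral_add) measurable
    also have "\<dots> < \<infinity>" using fin1 fin3 by simp
    finally show ?thesis .
  qed
  have "AE x in mI. ennreal (p x) \<le> ennreal (\<phi> x) * X x + ennreal (a ^ n * \<phi> x)"
    by (rule AE_le_if_nn_integral_le) (use fin2 fin3 le(1) in \<open>auto simp: nn_integral_add\<close>)
  moreover have "AE x in mI. ennreal (\<phi> x) * X x \<le> ennreal (p x) + ennreal (a ^ n * \<phi> x)"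
    by (rule AE_le_if_nn_integral_le) (use fin1 fin3 le(2) in \<open>auto simp: nn_integral_add\<close>)
  ultimately show ?thesis using AE_space
  proof eventually_elim
    fix x
    assume 1: "ennreal (p x) \<le> ennreal (\<phi> x) * X x + ennreal (a ^ n * \<phi> x)"
      and 2: "ennreal (\<phi> x) * X x \<le> ennreal (p x) + ennreal (a ^ n * \<phi> x)"
      and x: "x \<in> space mI"
    show "x \<in> J0 \<longrightarrow> \<bar>iter_path n x (\<lambda>z. h z + 1) - (\<phi> x * (\<integral>z. h (snd z) \<partial>\<kappa> x) + \<phi> x)\<bar> \<le> a ^ n * \<phi> x"
    proof
      assume x0: "x \<in> J0"
      then have k: "prob_space (\<kappa> x)" "sets (\<kappa> x) = sets SigmaM" using dis by (auto simp: disintegrates_def)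
      interpret k: prob_space "\<kappa> x" by (rule k(1))
      define m where "m = (\<integral>z. h (snd z) \<partial>\<kappa> x)"
      have hk: "(\<lambda>z. h (snd z)) \<in> borel_measurable (\<kappa> x)" using hs k(2) by (simp cong: measurable_cong_sets)
      have ik: "integrable (\<kappa> x) (\<lambda>z. h (snd z))"
        by (rule k.integrable_const_bound[where B = 1]) (use hb(1) hk in auto)
      have "X x = ennreal (\<integral>z. h (snd z) + 1 \<partial>\<kappa> x)"
        unfolding X_def using x0 ik h1 by (subst nn_integral_eq_integral) (auto simp: \<kappa>'_def)
      also have "(\<integral>z. h (snd z) + 1 \<partial>\<kappa> x) = m + 1" using ik k.prob_space by (simp add: m_def)
      finally have X: "X x = ennreal (m + 1)" .
      have "0 \<le> (\<integral>z. h (snd z) + 1 \<partial>\<kappa> x)" using h1 by (intro Bochner_Integration.integral_nonneg) auto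
      then have m: "0 \<le> m + 1" using ik k.prob_space by (simp add: m_def)
      have n: "0 \<le> a ^ n * \<phi> x" "0 \<le> \<phi> x * (m + 1)" "0 \<le> p x"
        using an \<phi>_nonneg m pnn x by auto
      have "p x \<le> \<phi> x * (m + 1) + a ^ n * \<phi> x"
        using 1 n unfolding X by (simp add: ennreal_mult'[symmetric] \<phi>_nonneg ennreal_plus[symmetric] del: ennreal_plus)
      moreover have "\<phi> x * (m + 1) \<le> p x + a ^ n * \<phi> x"
        using 2 n unfolding X by (simp add: ennreal_mult'[symmetric] \<phi>_nonneg ennreal_plus[symmetric] del: ennreal_plus)
      ultimately show "\<bar>iter_path n x (\<lambda>z. h z + 1) - (\<phi> x * (\<integral>z. h (snd z) \<partial>\<kappa> x) + \<phi> x)\<bar> \<le> a ^ n * \<phi> x"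
        by (simp add: p_def m_def algebra_simps)
    qed
  qed
qed

end

section \<open>Variation of the invariant measure of one system\<close>

lemma integral_scale_measure:
  fixes f :: "'a \<Rightarrow> real"
  assumes c: "0 \<le> c" and f: "f \<in> borel_measurable M"
  shows "(\<integral>x. f x \<partial>scale_measure (ennreal c) M) = c * (\<integral>x. f x \<partial>M)"
proof -
  have "scale_measure (ennreal c) M = density M (\<lambda>_. ennreal c)"
    by (rule measure_eqI) (auto simp: emeasure_density_const)
  then show ?thesis using c f by (simp add: integral_density)
qed

lemma fiber_restriction_integral:
  fixes \<kappa> :: "real \<Rightarrow> (real \<times> 'k::metric_space) measure"
  assumes "sets (\<kappa> x) = sets SigmaM" "0 \<le> \<phi> x" "h \<in> borel_measurable borel"
  shows "(\<integral>y. h y \<partial>fiber_restriction \<kappa> \<phi> x) = \<phi> x * (\<integral>z. h (snd z) \<partial>\<kappa> x)"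
proof -
  have s: "snd \<in> measurable (\<kappa> x) borel" using snd_SigmaM assms(1) by (simp cong: measurable_cong_sets)
  then have s': "snd \<in> measurable (scale_measure (ennreal (\<phi> x)) (\<kappa> x)) borel"
    by (simp cong: measurable_cong_sets)
  have "(\<lambda>z. h (snd z)) \<in> borel_measurable (\<kappa> x)" using s assms(3) by measurable
  then show ?thesis unfolding fiber_restriction_def
    using integral_distr[OF s' assms(3)] assms(2) by (simp add: integral_scale_measure)
qed

text \<open>
  Null sets may be removed from the domain, and the density may be changed outside of it. This freedom is what
  makes the variation of a measure an essential variation.
\<close>
lemma disintegrates_restrict:
  fixes \<nu> :: "(real \<times> 'k::metric_space) measure"
  assumes d: "disintegrates \<nu> J \<kappa> \<phi>" and J': "J' \<subseteq> J" "J' \<in> sets mI" "AE x in mI. x \<in> J'"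
    and \<phi>': "\<phi>' \<in> borel_measurable mI" "\<And>x. x \<in> J' \<Longrightarrow> \<phi>' x = \<phi> x"
  shows "disintegrates \<nu> J' \<kappa> \<phi>'"
proof -
  have J: "J \<in> sets mI" "\<phi> \<in> borel_measurable mI" "density mI (\<lambda>\<gamma>. ennreal (\<phi> \<gamma>)) = distr \<nu> mI fst"
    using d by (auto simp: disintegrates_def)
  have "AE x in distr \<nu> mI fst. x \<in> J'"
    unfolding J(3)[symmetric] using J'(3) J(2) by (subst AE_density) (auto elim: eventually_mono)
  then have int: "(\<integral>\<^sup>+\<gamma>\<in>J. F \<gamma> \<partial>distr \<nu> mI fst) = (\<integral>\<^sup>+\<gamma>\<in>J'. F \<gamma> \<partial>distr \<nu> mI fst)" for F
    using J'(1) by (intro nn_integral_cong_AE) (auto elim!: eventually_mono simp: indicator_def)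
  have m: "F \<in> borel_measurable (restrict_space mI J')" if "F \<in> borel_measurable (restrict_space mI J)" for F :: "real \<Rightarrow> ennreal"
    using measurable_restrict_mono[OF that J'(1)] .
  have e0: "emeasure mI (space mI - J') = 0"
  proof -
    have "AE x in mI. x \<notin> space mI - J'" using J'(3) by eventually_elim auto
    then show ?thesis
      using J'(2) by (subst (asm) AE_iff_measurable[where N = "space mI - J'"]) (auto simp del: space_mI)
  qed
  have den: "density mI (\<lambda>\<gamma>. ennreal (\<phi>' \<gamma>)) = density mI (\<lambda>\<gamma>. ennreal (\<phi> \<gamma>))"
    using J(2) \<phi>' J'(3) by (intro density_cong) (auto elim: eventually_mono)
  show ?thesis
    unfolding disintegrates_def
  proof (intro conjI ballI)
    show "J' \<in> sets mI" "emeasure mI (space mI - J') = 0" "\<phi>' \<in> borel_measurable mI" by fact+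
    show "density mI (\<lambda>\<gamma>. ennreal (\<phi>' \<gamma>)) = distr \<nu> mI fst" using den J(3) by simp
    fix x assume "x \<in> J'"
    then have x: "x \<in> J" "\<phi>' x = \<phi> x" using J'(1) \<phi>'(2) by auto
    then show "0 \<le> \<phi>' x" "prob_space (\<kappa> x)" "sets (\<kappa> x) = sets SigmaM" "emeasure (\<kappa> x) ({x} \<times> UNIV) = 1"
      using d by (simp_all add: disintegrates_def)
  next
    fix E :: "(real \<times> 'k) set" assume E: "E \<in> sets SigmaM"
    have dE: "(\<lambda>\<gamma>. emeasure (\<kappa> \<gamma>) E) \<in> borel_measurable (restrict_space mI J)"
      "emeasure \<nu> E = (\<integral>\<^sup>+\<gamma>\<in>J. emeasure (\<kappa> \<gamma>) E \<partial>distr \<nu> mI fst)"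
      using d E unfolding disintegrates_def by blast+
    show "(\<lambda>\<gamma>. emeasure (\<kappa> \<gamma>) E) \<in> borel_measurable (restrict_space mI J')" by (rule m[OF dE(1)])
    show "emeasure \<nu> E = (\<integral>\<^sup>+\<gamma>\<in>J'. emeasure (\<kappa> \<gamma>) E \<partial>distr \<nu> mI fst)"
      unfolding dE(2) by (rule int)
  qed
qed

lemma phi1_of_positive:
  fixes \<nu> :: "(real \<times> 'k::metric_space) measure"
  assumes "sets \<nu> = sets SigmaM"
    "density mI (\<lambda>x. ennreal (\<phi> x)) = distr \<nu> mI fst" "\<phi> \<in> borel_measurable mI" "\<And>x. 0 \<le> \<phi> x"
  shows "AE x in mI. phi1 (of_positive \<nu>) x = \<phi> x"
proof -
  interpret mI: prob_space mI by (rule prob_space_mI)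
  have f: "fst \<in> measurable \<nu> mI" using fst_SigmaM assms(1) by (simp cong: measurable_cong_sets)
  have 1: "AE x in mI. ennreal (\<phi> x) = RN_deriv mI (distr \<nu> mI fst) x"
    using assms by (intro mI.RN_deriv_unique) auto
  have f0: "fst \<in> measurable (null_measure \<nu>) mI" using f by (simp cong: measurable_cong_sets)
  have n: "density mI (\<lambda>_. 0) = distr (null_measure \<nu>) mI fst"
    using f0 by (intro measure_eqI) (auto simp: emeasure_density emeasure_distr)
  have "AE x in mI. 0 = RN_deriv mI (distr (null_measure \<nu>) mI fst) x"
    using n by (intro mI.RN_deriv_unique) auto
  with 1 show ?thesis
    by eventually_elim (auto simp: phi1_def of_positive_def assms(4) dest!: sym[of _ "RN_deriv _ _ _"])
qed

lemma W1_le: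
  assumes "\<And>h. test_fn h \<Longrightarrow> \<bar>sintegral \<mu> h - sintegral \<nu> h\<bar> \<le> c"
  shows "W1 \<mu> \<nu> \<le> ennreal c"
  unfolding W1_def by (rule SUP_least) (use assms in \<open>auto simp: test_fn_iff intro!: ennreal_leI\<close>)

text \<open>
  The infimum over an empty set of paths would be infinite, so finiteness of the norm in the definition of
  \<open>S1\<close> provides a disintegration.
\<close>
lemma S1_disintegration:
  fixes \<nu> :: "(real \<times> 'k::metric_space) measure"
  assumes S1: "of_positive \<nu> \<in> S1" and sets: "sets \<nu> = sets SigmaM"
  obtains J \<kappa> \<phi> \<kappa>n \<phi>n where "disintegrates \<nu> J \<kappa> \<phi>" "disintegrates (null_measure \<nu>) J \<kappa>n \<phi>n"
    "\<And>x. 0 \<le> \<phi> x" "AE x in mI. x \<in> J" "AE x in mI. phi1 (of_positive \<nu>) x = \<phi> x"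
proof -
  have "disintegration_paths (of_positive \<nu>) \<noteq> {}"
    using S1 by (auto simp: S1_def norm1_def)
  then obtain J \<kappa> \<phi>0 \<kappa>n \<phi>n where d0: "disintegrates \<nu> J \<kappa> \<phi>0"
    and dn: "disintegrates (null_measure \<nu>) J \<kappa>n \<phi>n"
    by (auto simp: disintegration_paths_def of_positive_def)
  define \<phi> where "\<phi> x = max 0 (\<phi>0 x)" for x
  have J: "J \<in> sets mI" "emeasure mI (space mI - J) = 0" "\<And>x. x \<in> J \<Longrightarrow> 0 \<le> \<phi>0 x" "\<phi>0 \<in> borel_measurable mI"
    using d0 by (auto simp: disintegrates_def)
  have "AE x in mI. x \<notin> space mI - J"
    using J by (intro AE_not_in) (auto simp: null_sets_def simp del: space_mI)
  then have AEJ: "AE x in mI. x \<in> J" using AE_space by eventually_elim auto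
  have \<phi>m: "\<phi> \<in> borel_measurable mI" unfolding \<phi>_def using J by measurable
  have \<phi>nn: "0 \<le> \<phi> x" for x by (simp add: \<phi>_def)
  have d: "disintegrates \<nu> J \<kappa> \<phi>"
    by (rule disintegrates_restrict[OF d0 order.refl J(1) AEJ \<phi>m]) (simp add: \<phi>_def J)
  have "density mI (\<lambda>x. ennreal (\<phi> x)) = distr \<nu> mI fst" using d by (simp add: disintegrates_def)
  then have "AE x in mI. phi1 (of_positive \<nu>) x = \<phi> x"
    by (rule phi1_of_positive[OF sets _ \<phi>m \<phi>nn])
  then show ?thesis using that[OF d dn \<phi>nn AEJ] by blast
qed

text \<open>
  The domain of the path is cut down to a measurable set \<open>J1\<close> of full measure on which the
  iterates converge to the path for countably many test functions, hence for all of them by density. On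
  \<open>J1\<close> the path then inherits the variation bound of the iterates. The constant \<open>C\<close>
  bounds the variation and the supremum of the density at the same time.
\<close>
lemma measure_variation_invariant_le:
  fixes \<mu> :: "(real \<times> 'k::{metric_space, second_countable_topology}) measure"
  assumes K: "compact (UNIV :: 'k set)" "\<And>z z' :: 'k. dist z z' \<le> 1"
    and Q: "interval_partition Q" "regular_branches Q \<tau>"
    and sk: "skew_product \<tau> H" and inv: "invariant_probability \<tau> H \<mu>" and S1: "of_positive \<mu> \<in> S1"
    and rate: "0 \<le> a" "a < 1" "AE x in mI. \<forall>z z'. dist (H x z) (H x z') \<le> a * dist z z'"
    and s: "0 \<le> s" "AE x in mI. inv_deriv Q \<tau> x \<le> s" "a * s \<le> A" "A < 1"
    and U: "0 \<le> U" "variation_on {0..1} (inv_deriv Q \<tau>) \<le> ennreal U"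
    and L: "0 \<le> L" "AE x in mI. Rl x" "\<And>i x x' z. i \<in> Q \<Longrightarrow> x \<in> ival i \<Longrightarrow> x' \<in> ival i \<Longrightarrow> Rl x \<Longrightarrow> Rl x' \<Longrightarrow>
        dist (H x z) (H x' z) \<le> L * \<bar>\<tau> x - \<tau> x'\<bar>"
    and C: "0 \<le> C" "BV_norm (phi1 (of_positive \<mu>)) < ennreal C"
  shows "measure_variation (of_positive \<mu>) \<le> ennreal (C + (C * U + s * C + C * L) / (1 - A))"
proof -
  define y0 :: 'k where "y0 = undefined"
  have \<mu>: "prob_space \<mu>" "sets \<mu> = sets SigmaM" using inv by (auto simp: invariant_probability_def)
  have \<tau>m: "\<tau> \<in> measurable mI mI" using sk by (simp add: skew_product_def)
  obtain J0 \<kappa> \<phi> \<kappa>n \<phi>n where d: "disintegrates \<mu> J0 \<kappa> \<phi>" and dn: "disintegrates (null_measure \<mu>) J0 \<kappa>n \<phi>n"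
    and \<phi>nn: "\<And>x. 0 \<le> \<phi> x" and AEJ0: "AE x in mI. x \<in> J0" and \<phi>1: "AE x in mI. phi1 (of_positive \<mu>) x = \<phi> x"
    using S1_disintegration[OF S1 \<mu>(2)] by blast
  have \<phi>m: "\<phi> \<in> borel_measurable mI" using d by (simp add: disintegrates_def)
  obtain h' where h': "AE x in mI. h' x = \<phi> x" "variation_on {0..1} h' \<le> ennreal C" "\<And>x. x \<in> {0..1} \<Longrightarrow> \<bar>h' x\<bar> \<le> C"
    using BV_representative[OF \<phi>m, of C] C(2) BV_norm_cong_AE[OF \<phi>1] by auto
  obtain w\<phi> where w\<phi>: "mono w\<phi>" "\<And>x. 0 \<le> w\<phi> x" "\<And>x. w\<phi> x \<le> C"
    "\<And>x y. x \<in> {0..1} \<Longrightarrow> y \<in> {0..1} \<Longrightarrow> x \<le> y \<Longrightarrow> \<bar>h' x - h' y\<bar> \<le> w\<phi> y - w\<phi> x"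
    by (rule bounded_variation_majorant[OF h'(2) C(1)]) blast
  obtain wg where wg: "mono wg" "\<And>x. 0 \<le> wg x" "\<And>x. wg x \<le> U"
    "\<And>x y. x \<in> {0..1} \<Longrightarrow> y \<in> {0..1} \<Longrightarrow> x \<le> y \<Longrightarrow> \<bar>inv_deriv Q \<tau> x - inv_deriv Q \<tau> y\<bar> \<le> wg y - wg x"
    by (rule bounded_variation_majorant[OF U(2) U(1)]) blast
  have \<phi>n0: "AE x in mI. x \<in> J0 \<longrightarrow> \<phi>n x = 0"
  proof -
    have m: "\<phi>n \<in> borel_measurable mI" "\<And>x. x \<in> J0 \<Longrightarrow> 0 \<le> \<phi>n x"
      "density mI (\<lambda>x. ennreal (\<phi>n x)) = distr (null_measure \<mu>) mI fst"
      using dn by (auto simp: disintegrates_def)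
    have f0: "fst \<in> measurable (null_measure \<mu>) mI" using fst_SigmaM \<mu>(2) by (simp cong: measurable_cong_sets)
    have "(\<integral>\<^sup>+x. ennreal (\<phi>n x) \<partial>mI) = emeasure (density mI (\<lambda>x. ennreal (\<phi>n x))) (space mI)"
      using m(1) by (subst emeasure_density) (auto intro!: nn_integral_cong simp: sets_mI)
    also have "\<dots> = 0" unfolding m(3) using f0 by (subst emeasure_distr) (auto simp: sets_mI)
    finally have "AE x in mI. ennreal (\<phi>n x) = 0" using m(1) by (subst (asm) nn_integral_0_iff_AE) auto
    then show ?thesis
    proof eventually_elim
      fix x assume "ennreal (\<phi>n x) = 0"
      then show "x \<in> J0 \<longrightarrow> \<phi>n x = 0" using m(2)[of x] by (auto simp: ennreal_eq_0_iff)
    qed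
  qed
  interpret invariant_skewed Q \<tau> H \<phi> y0 \<mu> J0 \<kappa> a
    by unfold_locales (use Q sk inv d \<phi>nn K(2) rate \<tau>m in auto)
  have gm: "g = inv_deriv Q \<tau>" by (simp add: g_def)
  define R where "R x \<longleftrightarrow> x \<in> J0 \<and> h' x = \<phi> x \<and> inv_deriv Q \<tau> x \<le> s \<and> (\<forall>z z'. dist (H x z) (H x z') \<le> a * dist z z')
     \<and> (\<lambda>i. branch_term \<phi> i x) summable_on Q \<and> pushforward \<phi> x = \<phi> x \<and> Rl x" for x
  have "AE x in mI. R x"
    using AEJ0 h'(1) s(2) rate(3) pushforward_\<phi> L(2) by eventually_elim (simp add: R_def)
  from backward_closed_set[OF this] obtain J where J: "AE x in mI. x \<in> J" "\<And>x. x \<in> J \<Longrightarrow> R x" "J \<subseteq> {0..1}"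
    "\<And>x i. x \<in> J \<Longrightarrow> i \<in> Q \<Longrightarrow> x \<in> \<tau> ` ival i \<Longrightarrow> preim \<tau> i x \<in> J" by blast
  have R: "x \<in> J0" "h' x = \<phi> x" "inv_deriv Q \<tau> x \<le> s" "\<And>z z'. dist (H x z) (H x z') \<le> a * dist z z'"
     "(\<lambda>i. branch_term \<phi> i x) summable_on Q" "pushforward \<phi> x = \<phi> x" "Rl x" "x \<in> {0..1}" if "x \<in> J" for x
    using J(2)[OF that] J(3) that by (auto simp: R_def)
  have \<phi>C: "\<phi> x \<le> C" if "x \<in> J" for x using R(2)[OF that] h'(3)[OF R(8)[OF that]] by simp
  interpret LY: lasota_yorke Q \<tau> H \<phi> y0 J a s L C C U w\<phi> wg
  proof unfold_locales
    show "\<bar>\<phi> x - \<phi> y\<bar> \<le> w\<phi> y - w\<phi> x" if "x \<in> J" "y \<in> J" "x \<le> y" for x y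
      using w\<phi>(4)[OF R(8)[OF that(1)] R(8)[OF that(2)] that(3)] R(2) that by simp
    show "dist (H x z) (H x' z) \<le> L * \<bar>\<tau> x - \<tau> x'\<bar>" if "i \<in> Q" "x \<in> J \<inter> ival i" "x' \<in> J \<inter> ival i" for i x x' z
      using L(3)[OF that(1)] that R(7) by blast
    show "preim \<tau> i x \<in> J" if "x \<in> J" "i \<in> Q" "x \<in> \<tau> ` ival i" for x i using J(4) that by blast
  qed (use rate(1) s(1) L(1) C(1) U(1) J(3) \<phi>nn \<phi>C R w\<phi>(1-3) wg K(2) gm in \<open>auto simp: gm\<close>)
  \<comment> \<open>the path of the given disintegration, tested against \<open>h\<close>\<close>
  define \<Gamma> where "\<Gamma> x h = \<phi> x * (\<integral>z. h (snd z) \<partial>\<kappa> x)" for x and h :: "'k \<Rightarrow> real"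
  obtain D :: "('k \<Rightarrow> real) set" where D: "countable D" "\<And>h. h \<in> D \<Longrightarrow> test_fn h"
    "\<And>h \<eta>. test_fn h \<Longrightarrow> 0 < \<eta> \<Longrightarrow> \<exists>h'\<in>D. \<forall>y. \<bar>h y - h' y\<bar> \<le> \<eta>"
    by (rule countable_dense_test_fns[OF K(1)]) blast
  have "AE x in mI. \<forall>h\<in>D. \<forall>n. x \<in> J0 \<longrightarrow> \<bar>iter_path n x (\<lambda>z. h z + 1) - (\<Gamma> x h + \<phi> x)\<bar> \<le> a ^ n * \<phi> x"
    unfolding AE_ball_countable[OF D(1)] AE_all_countable \<Gamma>_def
    using approximation_by_iterates[OF D(2)] by blast
  with \<phi>n0 J(1) have "AE x in mI. x \<in> J \<and> \<phi>n x = 0 \<and>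
       (\<forall>h\<in>D. \<forall>n. \<bar>iter_path n x (\<lambda>z. h z + 1) - (\<Gamma> x h + \<phi> x)\<bar> \<le> a ^ n * \<phi> x)"
    by eventually_elim (use R(1) in blast)
  then obtain N where N: "{x \<in> space mI. \<not> (x \<in> J \<and> \<phi>n x = 0 \<and>
       (\<forall>h\<in>D. \<forall>n. \<bar>iter_path n x (\<lambda>z. h z + 1) - (\<Gamma> x h + \<phi> x)\<bar> \<le> a ^ n * \<phi> x))} \<subseteq> N"
    "emeasure mI N = 0" "N \<in> sets mI" by (rule AE_E)
  define J1 where "J1 = space mI - N"
  have "AE x in mI. x \<notin> N" using N by (intro AE_not_in) (auto simp: null_sets_def)
  then have "AE x in mI. x \<in> J1" using AE_space by eventually_elim (auto simp: J1_def)
  moreover have "J1 \<in> sets mI" using N(3) unfolding J1_def by blast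
  ultimately have J1: "J1 \<in> sets mI" "AE x in mI. x \<in> J1" by auto
  have J1p: "x \<in> J" "\<phi>n x = 0" "\<And>h n. h \<in> D \<Longrightarrow> \<bar>iter_path n x (\<lambda>z. h z + 1) - (\<Gamma> x h + \<phi> x)\<bar> \<le> a ^ n * \<phi> x" if "x \<in> J1" for x
  proof -
    have "x \<in> space mI" "x \<notin> N" using that by (auto simp: J1_def)
    then show "x \<in> J" "\<phi>n x = 0" "\<And>h n. h \<in> D \<Longrightarrow> \<bar>iter_path n x (\<lambda>z. h z + 1) - (\<Gamma> x h + \<phi> x)\<bar> \<le> a ^ n * \<phi> x"
      using N(1) by blast+
  qed
  have J1J0: "J1 \<subseteq> J0" using J1p(1) R(1) by blast
  have approx: "\<bar>iter_path n x h - \<Gamma> x h\<bar> \<le> (a ^ n + 2 * \<eta>) * \<phi> x" if x: "x \<in> J1" and h: "test_fn h" and \<eta>: "0 < \<eta>" for x h n \<eta>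
  proof -
    have xJ: "x \<in> J" "x \<in> J0" using J1p(1)[OF x] R(1) by auto
    obtain k where k: "k \<in> D" "\<And>y. \<bar>h y - k y\<bar> \<le> \<eta>" using D(3)[OF h \<eta>] by blast
    have kt: "test_fn k" by (rule D(2)[OF k(1)])
    have b: "\<forall>y. \<bar>h y\<bar> \<le> 1" "\<forall>y. \<bar>k y\<bar> \<le> 1" using h kt by (auto simp: test_fn_def)
    have "iter_path n x (\<lambda>z. 1 + 1 * k z) = 1 * \<phi> x + 1 * iter_path n x k" by (rule LY.iter_path_props(1)[OF xJ(1) b(2)])
    then have "\<bar>iter_path n x k - \<Gamma> x k\<bar> \<le> a ^ n * \<phi> x" using J1p(3)[OF x k(1), of n] by (simp add: add.commute)
    moreover have "\<bar>iter_path n x h - iter_path n x k\<bar> \<le> \<phi> x * \<eta>" by (rule LY.iter_path_props(2)[OF xJ(1) b]) (use k in blast)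
    moreover have "\<bar>\<Gamma> x h - \<Gamma> x k\<bar> \<le> \<phi> x * \<eta>"
    proof -
      have kx: "prob_space (\<kappa> x)" "sets (\<kappa> x) = sets SigmaM" using d xJ by (auto simp: disintegrates_def)
      interpret kx: prob_space "\<kappa> x" by (rule kx(1))
      have sm: "snd \<in> measurable (\<kappa> x) borel" using snd_SigmaM kx(2) by (simp cong: measurable_cong_sets)
      have int: "integrable (\<kappa> x) (\<lambda>z. f (snd z))" if "test_fn f" for f
        using measurable_comp[OF sm test_fn_measurable[OF that]] that
        by (intro kx.integrable_const_bound[where B = 1]) (auto simp: test_fn_def comp_def)
      have "\<bar>(\<integral>z. h (snd z) \<partial>\<kappa> x) - (\<integral>z. k (snd z) \<partial>\<kappa> x)\<bar> = \<bar>\<integral>z. h (snd z) - k (snd z) \<partial>\<kappa> x\<bar>"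
        using int[OF h] int[OF kt] by simp
      also have "\<dots> \<le> (\<integral>z. \<bar>h (snd z) - k (snd z)\<bar> \<partial>\<kappa> x)" by (rule integral_abs_bound)
      also have "\<dots> \<le> (\<integral>z. \<eta> \<partial>\<kappa> x)"
        using int[OF h] int[OF kt] k(2) by (intro integral_mono) auto
      also have "\<dots> = \<eta>" using kx.prob_space by simp
      finally have "\<phi> x * \<bar>(\<integral>z. h (snd z) \<partial>\<kappa> x) - (\<integral>z. k (snd z) \<partial>\<kappa> x)\<bar> \<le> \<phi> x * \<eta>"
        by (rule mult_left_mono[OF _ \<phi>nn])
      then show ?thesis using \<phi>nn[of x] by (simp add: \<Gamma>_def abs_mult flip: right_diff_distrib)
    qed
    ultimately have "\<bar>iter_path n x h - \<Gamma> x h\<bar> \<le> a ^ n * \<phi> x + \<phi> x * \<eta> + \<phi> x * \<eta>" by linarith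
    then show ?thesis by (simp add: algebra_simps)
  qed
  define B where "B = C + (C * U + s * C + C * L) / (1 - A)"
  define path where "path = (\<lambda>x. (fiber_restriction \<kappa> \<phi> x, fiber_restriction \<kappa>n \<phi>n x))"
  have sint: "sintegral (path x) h = \<Gamma> x h" if x: "x \<in> J1" and h: "test_fn h" for x h
  proof -
    have "x \<in> J0" using x J1J0 by blast
    then have "sets (\<kappa> x) = sets SigmaM" "sets (\<kappa>n x) = sets SigmaM"
      using d dn by (auto simp: disintegrates_def)
    then show ?thesis
      using J1p(2)[OF x] \<phi>nn[of x] test_fn_measurable[OF h]
      by (simp add: sintegral_def path_def \<Gamma>_def fiber_restriction_integral)
  qed
  have "(J1, path) \<in> disintegration_paths (of_positive \<mu>)"
    unfolding disintegration_paths_def path_def of_positive_def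
  proof (intro CollectI exI conjI)
    show "disintegrates (fst (\<mu>, null_measure \<mu>)) J1 \<kappa> \<phi>"
      using disintegrates_restrict[OF d J1J0 J1 \<phi>m] by simp
    have "\<phi>n \<in> borel_measurable mI" using dn by (simp add: disintegrates_def)
    then show "disintegrates (snd (\<mu>, null_measure \<mu>)) J1 \<kappa>n \<phi>n"
      using disintegrates_restrict[OF dn J1J0 J1] by simp
  qed simp
  then have "measure_variation (of_positive \<mu>) \<le> variation_wrt W1 J1 path"
    unfolding measure_variation_def by (intro INF_lower2[of "(J1, path)"]) auto
  also have "\<dots> \<le> ennreal B"
  proof (rule variation_le_of_approximate_majorants)
    fix \<epsilon> :: real assume \<epsilon>: "0 < \<epsilon>"
    \<comment> \<open>chosen such that \<open>(a ^ n + 2 * \<eta>) * \<phi> x \<le> \<epsilon> / 2\<close>, once for each of the two points\<close>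
    define \<eta> where "\<eta> = (\<epsilon> / 8) / (C + 1)"
    have \<eta>: "0 < \<eta>" using \<epsilon> C(1) by (simp add: \<eta>_def)
    obtain n where n: "a ^ n < \<eta>" using real_arch_pow_inv[OF \<eta> rate(2)] by blast
    obtain w where w: "mono w" "\<And>x. 0 \<le> w x" "\<And>x. w x \<le> B"
      "\<And>x y h. x \<in> J \<Longrightarrow> y \<in> J \<Longrightarrow> x \<le> y \<Longrightarrow> test_fn h \<Longrightarrow> \<bar>iter_path n x h - iter_path n y h\<bar> \<le> w y - w x"
      using LY.uniform_variation[OF s(3,4), of n] unfolding B_def by blast
    have small: "(a ^ n + 2 * \<eta>) * \<phi> x \<le> \<epsilon> / 2" if "x \<in> J1" for x
    proof -
      have "(a ^ n + 2 * \<eta>) * \<phi> x \<le> (3 * \<eta>) * (C + 1)"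
        using n \<eta> \<phi>nn[of x] \<phi>C[OF J1p(1)[OF that]] rate(1) C(1) by (intro mult_mono) auto
      also have "\<dots> = 3 * (\<epsilon> / 8)"
      proof -
        have "\<eta> * (C + 1) = \<epsilon> / 8" 
          using C(1) \<eta>_def nonzero_eq_divide_eq[of "C + 1" \<eta> "\<epsilon> / 8"] by linarith
        then show ?thesis by simp
      qed
      finally show ?thesis using \<epsilon> by simp
    qed
    have "W1 (path x) (path y) \<le> ennreal (w y - w x + \<epsilon>)" if x: "x \<in> J1" and y: "y \<in> J1" and xy: "x < y" for x y
    proof (rule W1_le)
      fix h :: "'k \<Rightarrow> real" assume h: "test_fn h"
      have "\<bar>iter_path n x h - iter_path n y h\<bar> \<le> w y - w x" using w(4)[OF J1p(1)[OF x] J1p(1)[OF y] less_imp_le[OF xy] h] .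
      moreover have "\<bar>iter_path n x h - \<Gamma> x h\<bar> \<le> \<epsilon> / 2" "\<bar>iter_path n y h - \<Gamma> y h\<bar> \<le> \<epsilon> / 2"
        using approx[OF x h \<eta>, of n] approx[OF y h \<eta>, of n] small x y by fastforce+
      ultimately show "\<bar>sintegral (path x) h - sintegral (path y) h\<bar> \<le> w y - w x + \<epsilon>"
        unfolding sint[OF x h] sint[OF y h] by linarith
    qed
    then show "\<exists>w. mono w \<and> (\<forall>x. 0 \<le> w x \<and> w x \<le> B) \<and>
        (\<forall>x\<in>J1. \<forall>y\<in>J1. x < y \<longrightarrow> W1 (path x) (path y) \<le> ennreal (w y - w x + \<epsilon>))"
      using w(1-3) by blast
  qed
  finally show ?thesis by (simp add: B_def)
qed

section \<open>Cylinders\<close>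

definition cylinder :: "(real \<Rightarrow> real) \<Rightarrow> (nat \<Rightarrow> real \<times> real) \<Rightarrow> nat \<Rightarrow> real set" where
  "cylinder f s n = {x \<in> {0..1}. \<forall>l<n. (f ^^ l) x \<in> ival (s l)}"

lemma cylinder_Suc: "cylinder f s (Suc n) = {x \<in> cylinder f s n. (f ^^ n) x \<in> ival (s n)}"
  by (auto simp: cylinder_def less_Suc_eq)

lemma iter_partition_cylinder:
  "i \<in> iter_partition f P k \<longleftrightarrow> fst i < snd i \<and> (\<exists>s. (\<forall>l<k. s l \<in> P) \<and> ival i = cylinder f s k)"
  by (auto simp: iter_partition_def cylinder_def)

lemma open_interval_ival:
  fixes C :: "real set"
  assumes "open C" "is_interval C" "C \<subseteq> {0..1}" "C \<noteq> {}"
  obtains i where "fst i < snd i" "C = ival i"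
proof -
  have bdd: "bdd_below C" "bdd_above C" 
    using assms(3) by (meson bdd_below_mono bdd_below_Icc, meson bdd_above_mono bdd_above_Icc)
  have no: "Inf C < x" "x < Sup C" if x: "x \<in> C" for x
  proof -
    obtain e where e: "0 < e" "ball x e \<subseteq> C" using assms(1) x by (auto simp: open_contains_ball)
    then have "x - e / 2 \<in> C" "x + e / 2 \<in> C" by (auto simp: subset_iff dist_real_def)
    then show "Inf C < x" "x < Sup C"
      using cInf_lower[OF _ bdd(1), of "x - e / 2"] cSup_upper[OF _ bdd(2), of "x + e / 2"] e(1) by auto
  qed
  have "x \<in> C" if lo: "Inf C < x" and hi: "x < Sup C" for x
  proof -
    obtain u where "u \<in> C" "u < x" using lo unfolding cInf_less_iff[OF assms(4) bdd(1)] by blast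
    moreover obtain v where "v \<in> C" "x < v" using hi unfolding less_cSup_iff[OF assms(4) bdd(2)] by blast
    ultimately show ?thesis using assms(2) unfolding is_interval_1 by (meson less_imp_le)
  qed
  then have "C = ival (Inf C, Sup C)" using no by (auto simp: ival_def)
  moreover have "Inf C < Sup C" using no assms(4) by (meson ex_in_conv order.strict_trans)
  ultimately show ?thesis using that[of "(Inf C, Sup C)"] by simp
qed

lemma ival_inject:
  assumes "fst i < snd i" "fst j < snd j" "ival i = ival j" shows "i = j"
proof -
  have "Inf (ival i) = fst i" "Sup (ival i) = snd i" "Inf (ival j) = fst j" "Sup (ival j) = snd j"
    using assms(1,2) by (auto simp: ival_def)
  then show ?thesis using assms(3) by (simp add: prod_eq_iff)
qed

lemma ival_in_unit:
  assumes "fst i < snd i" "ival i \<subseteq> {0..1}" shows "0 \<le> fst i" "snd i \<le> 1"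
proof -
  show "0 \<le> fst i"
  proof (rule ccontr)
    assume "\<not> 0 \<le> fst i"
    then obtain z where "fst i < z" "z < min 0 (snd i)" using assms(1) dense[of "fst i" "min 0 (snd i)"] by auto
    then have "z \<in> ival i" "z < 0" by (auto simp: ival_def)
    then show False using assms(2) by auto
  qed
  show "snd i \<le> 1"
  proof (rule ccontr)
    assume "\<not> snd i \<le> 1"
    then obtain z where "max 1 (fst i) < z" "z < snd i" using assms(1) dense[of "max 1 (fst i)" "snd i"] by auto
    then have "z \<in> ival i" "z > 1" by (auto simp: ival_def)
    then show False using assms(2) by auto
  qed
qed

lemma AE_nonsingular:
  assumes "f \<in> measurable mI mI" "nonsingular f" "AE x in mI. R x"
  shows "AE x in mI. R ((f ^^ n) x)"
proof (induction n)
  case 0 show ?case using assms(3) by simp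
next
  case (Suc n)
  have "AE x in distr mI mI f. R ((f ^^ n) x)"
    by (rule absolutely_continuous_AE[OF _ _ Suc]) (use assms(2) in \<open>auto simp: nonsingular_def\<close>)
  from AE_distrD[OF assms(1) this] show ?case by (simp add: funpow_swap1)
qed

locale nonsingular_branched = branched P f for P f +
  assumes nons: "nonsingular f"
begin

lemma iterate_unit: "x \<in> {0..1} \<Longrightarrow> (f ^^ n) x \<in> {0..1}"
  using measurable_space[OF funpow_measurable[OF meas], of x n] by simp

lemma cylinder_1: "s 0 \<in> P \<Longrightarrow> cylinder f s (Suc 0) = ival (s 0)"
  using ival_subset[of "s 0"] by (auto simp: cylinder_def)

text \<open>
  A cylinder of length \<open>n + 1\<close> is the preimage of an interval under the restriction of
  \<open>f\<^sup>n\<close> to a cylinder of length \<open>n\<close>; this restriction is continuous and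
  injective, hence monotone.
\<close>
lemma cylinder_props:
  assumes s: "\<And>l. l < Suc n \<Longrightarrow> s l \<in> P"
  shows "open (cylinder f s (Suc n)) \<and> is_interval (cylinder f s (Suc n)) \<and>
    inj_on (f ^^ Suc n) (cylinder f s (Suc n)) \<and>
    (\<forall>x\<in>cylinder f s (Suc n). \<exists>d. d \<noteq> 0 \<and> ((f ^^ Suc n) has_field_derivative d) (at x))"
  using s
proof (induction n)
  case 0
  then have s0: "s 0 \<in> P" by simp
  have "\<exists>d. d \<noteq> 0 \<and> ((f ^^ Suc 0) has_field_derivative d) (at x)" if "x \<in> ival (s 0)" for x
    using deriv(1,2)[OF s0 that] by auto
  then show ?case unfolding cylinder_1[of s, OF s0]
    using deriv(3)[OF s0] by (auto simp: ival_def is_interval_oo)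
next
  case (Suc n)
  let ?C = "cylinder f s (Suc n)" and ?h = "f ^^ Suc n"
  have IH: "open ?C" "is_interval ?C" "inj_on ?h ?C"
    "\<And>x. x \<in> ?C \<Longrightarrow> \<exists>d. d \<noteq> 0 \<and> (?h has_field_derivative d) (at x)"
    using Suc by (auto simp del: funpow.simps)
  have sn: "s (Suc n) \<in> P" using Suc.prems by simp
  have cont: "continuous_on ?C ?h"
    using IH(4) by (meson DERIV_isCont continuous_at_imp_continuous_on)
  have C': "cylinder f s (Suc (Suc n)) = {x \<in> ?C. ?h x \<in> ival (s (Suc n))}" by (rule cylinder_Suc)
  have op: "open (cylinder f s (Suc (Suc n)))"
  proof -
    have "open (?C \<inter> ?h -` ival (s (Suc n)))"
      by (rule continuous_open_preimage[OF cont IH(1)]) (simp add: ival_def)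
    moreover have "?C \<inter> ?h -` ival (s (Suc n)) = cylinder f s (Suc (Suc n))" unfolding C' by auto
    ultimately show ?thesis by simp
  qed
  have iv: "is_interval (cylinder f s (Suc (Suc n)))"
    unfolding is_interval_1 C'
  proof (intro ballI allI impI)
    fix u v x assume u: "u \<in> {x \<in> ?C. ?h x \<in> ival (s (Suc n))}" and v: "v \<in> {x \<in> ?C. ?h x \<in> ival (s (Suc n))}"
      and "u \<le> x \<and> x \<le> v"
    then have x: "u \<le> x" "x \<le> v" by auto
    have sub: "{u..v} \<subseteq> ?C" using u v IH(2) unfolding is_interval_1 by auto
    show "x \<in> {x \<in> ?C. ?h x \<in> ival (s (Suc n))}"
    proof (cases "x = u \<or> x = v")
      case True then show ?thesis using u v by auto
    next
      case False
      then have "u < x" "x < v" using x by auto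
      then have "(?h u < ?h x \<and> ?h x < ?h v) \<or> (?h v < ?h x \<and> ?h x < ?h u)"
        by (rule continuous_inj_imp_mono[OF _ _ continuous_on_subset[OF cont sub] inj_on_subset[OF IH(3) sub]])
      then show ?thesis using u v sub x by (auto simp: ival_def simp del: funpow.simps)
    qed
  qed
  have inj: "inj_on (f ^^ Suc (Suc n)) (cylinder f s (Suc (Suc n)))"
  proof (rule inj_onI)
    fix x y assume "x \<in> cylinder f s (Suc (Suc n))" "y \<in> cylinder f s (Suc (Suc n))"
      "(f ^^ Suc (Suc n)) x = (f ^^ Suc (Suc n)) y"
    then have xy: "x \<in> ?C" "y \<in> ?C" "?h x \<in> ival (s (Suc n))" "?h y \<in> ival (s (Suc n))" "f (?h x) = f (?h y)"
      unfolding C' by auto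
    have "?h x = ?h y" by (rule inj_onD[OF deriv(3)[OF sn] xy(5,3,4)])
    then show "x = y" by (rule inj_onD[OF IH(3) _ xy(1,2)])
  qed
  have der: "\<exists>d. d \<noteq> 0 \<and> ((f ^^ Suc (Suc n)) has_field_derivative d) (at x)"
    if "x \<in> cylinder f s (Suc (Suc n))" for x
  proof -
    have x: "x \<in> ?C" "?h x \<in> ival (s (Suc n))" using that unfolding C' by auto
    obtain d where d: "d \<noteq> 0" "(?h has_field_derivative d) (at x)" using IH(4)[OF x(1)] by blast
    have "(f \<circ> ?h has_field_derivative deriv f (?h x) * d) (at x)"
      by (rule DERIV_chain[OF deriv(1)[OF sn x(2)] d(2)])
    then show ?thesis using d(1) deriv(2)[OF sn x(2)] by (intro exI[of _ "deriv f (?h x) * d"]) simp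
  qed
  show ?case using op iv inj der by blast
qed

lemma cylinder_ival:
  assumes "1 \<le> n" "\<And>l. l < n \<Longrightarrow> s l \<in> P" "cylinder f s n \<noteq> {}"
  obtains i where "i \<in> iter_partition f P n" "ival i = cylinder f s n"
proof -
  obtain m where n: "n = Suc m" using assms(1) by (cases n) auto
  have "open (cylinder f s n)" "is_interval (cylinder f s n)"
    using cylinder_props[of m s] assms(2) unfolding n by blast+
  moreover have "cylinder f s n \<subseteq> {0..1}" by (auto simp: cylinder_def)
  ultimately obtain i where i: "fst i < snd i" "cylinder f s n = ival i"
    using assms(3) by (rule open_interval_ival)
  have "i \<in> iter_partition f P n"
    unfolding iter_partition_cylinder using i assms(2) by (intro conjI exI[of _ s]) auto
  then show ?thesis using that[of i] i(2) by simp
qed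

lemma regular_iterate: assumes "1 \<le> k" shows "regular_branches (iter_partition f P k) (f ^^ k)"
  unfolding regular_branches_def
proof (intro ballI conjI)
  obtain m where k: "k = Suc m" using assms by (cases k) auto
  fix i assume "i \<in> iter_partition f P k"
  then obtain s where s: "\<And>l. l < k \<Longrightarrow> s l \<in> P" "ival i = cylinder f s k"
    by (auto simp: iter_partition_cylinder)
  note pr = cylinder_props[of m s, folded k, OF s(1)]
  show "inj_on (f ^^ k) (ival i)" unfolding s(2) using pr by blast
  fix x assume "x \<in> ival i"
  then obtain d where d: "d \<noteq> 0" "((f ^^ k) has_field_derivative d) (at x)" unfolding s(2) using pr by blast
  then show "(f ^^ k) differentiable at x" using real_differentiable_def by blast
  show "deriv (f ^^ k) x \<noteq> 0" using d(1) DERIV_imp_deriv[OF d(2)] by simp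
qed

lemma same_cylinder:
  assumes s: "\<And>l. l < k \<Longrightarrow> s l \<in> P" "\<And>l. l < k \<Longrightarrow> s' l \<in> P" and x: "x \<in> cylinder f s k" "x \<in> cylinder f s' k"
  shows "cylinder f s k = cylinder f s' k"
proof -
  have "s l = s' l" if l: "l < k" for l
  proof (rule ccontr)
    assume "s l \<noteq> s' l"
    then have "ival (s l) \<inter> ival (s' l) = {}" using disj s[OF l] by (auto simp: disjoint_family_on_def)
    moreover have "(f ^^ l) x \<in> ival (s l) \<inter> ival (s' l)" using x l by (auto simp: cylinder_def)
    ultimately show False by blast
  qed
  then show ?thesis by (auto simp: cylinder_def)
qed

lemma AE_cylinder: "AE x in mI. \<exists>s. (\<forall>l<k. s l \<in> P) \<and> x \<in> cylinder f s k"
proof -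
  have "AE x in mI. \<forall>l. (f ^^ l) x \<in> (\<Union>i\<in>P. ival i)"
    using AE_nonsingular[OF meas nons AE_ival] by (simp add: AE_all_countable)
  then show ?thesis using AE_space
  proof eventually_elim
    fix x assume "\<forall>l. (f ^^ l) x \<in> (\<Union>i\<in>P. ival i)" and x: "x \<in> space mI"
    then have "\<forall>l. \<exists>i. i \<in> P \<and> (f ^^ l) x \<in> ival i" by blast
    then obtain s where "\<forall>l. s l \<in> P \<and> (f ^^ l) x \<in> ival (s l)" using choice by metis
    then show "\<exists>s. (\<forall>l<k. s l \<in> P) \<and> x \<in> cylinder f s k" using x by (auto simp: cylinder_def)
  qed
qed

lemma iterate_partition: assumes k: "1 \<le> k" shows "interval_partition (iter_partition f P k)"
proof -
  let ?Q = "iter_partition f P k"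
  have Qi: "fst i < snd i" "ival i \<subseteq> {0..1}" if "i \<in> ?Q" for i
    using that by (auto simp: iter_partition_cylinder cylinder_def)
  have inj: "inj_on ival ?Q" using ival_inject Qi(1) by (auto simp: inj_on_def)
  have "ival ` ?Q \<subseteq> (\<lambda>xs. cylinder f (\<lambda>l. xs ! l) k) ` lists P"
  proof
    fix X assume "X \<in> ival ` ?Q"
    then obtain i where "i \<in> ?Q" "X = ival i" by blast
    then obtain s where s: "\<And>l. l < k \<Longrightarrow> s l \<in> P" "X = cylinder f s k"
      unfolding iter_partition_cylinder by blast
    have "X = cylinder f (\<lambda>l. map s [0..<k] ! l) k" unfolding s(2) by (auto simp: cylinder_def)
    moreover have "map s [0..<k] \<in> lists P" using s(1) by auto
    ultimately show "X \<in> (\<lambda>xs. cylinder f (\<lambda>l. xs ! l) k) ` lists P" by blast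
  qed
  then have "countable (ival ` ?Q)" by (rule countable_subset) (intro countable_image countable_lists cntbl)
  then have cnt: "countable ?Q" by (rule countable_image_inj_on[OF _ inj])
  have disj: "disjoint_family_on ival ?Q"
    unfolding disjoint_family_on_def
  proof (intro ballI impI)
    fix i j assume ij: "i \<in> ?Q" "j \<in> ?Q" "i \<noteq> j"
    obtain s s' where "\<And>l. l < k \<Longrightarrow> s l \<in> P" "ival i = cylinder f s k" "\<And>l. l < k \<Longrightarrow> s' l \<in> P" "ival j = cylinder f s' k"
      using ij(1,2) unfolding iter_partition_cylinder by metis
    then have "ival i = ival j" if "x \<in> ival i" "x \<in> ival j" for x using same_cylinder[of k s s' x] that by simp
    then show "ival i \<inter> ival j = {}" using ij inj by (auto simp: inj_on_def)
  qed
  have "AE x in mI. x \<in> (\<Union>i\<in>?Q. ival i)" using AE_cylinder[of k]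
  proof eventually_elim
    fix x assume "\<exists>s. (\<forall>l<k. s l \<in> P) \<and> x \<in> cylinder f s k"
    then obtain s where "\<And>l. l < k \<Longrightarrow> s l \<in> P" "x \<in> cylinder f s k" by blast
    then show "x \<in> (\<Union>i\<in>?Q. ival i)" using cylinder_ival[OF k, of s] by blast
  qed
  then have AE: "AE x in lborel. x \<notin> {0..1} - (\<Union>i\<in>?Q. ival i)" unfolding AE_mI by eventually_elim auto
  have "{0..1} - (\<Union>i\<in>?Q. ival i) \<in> sets borel"
    by (intro sets.Diff sets.countable_UN'' cnt) (auto simp: ival_def)
  then have "emeasure lborel ({0..1} - (\<Union>i\<in>?Q. ival i)) = 0"
    using AE by (subst (asm) AE_iff_measurable[where N = "{0..1} - (\<Union>i\<in>?Q. ival i)"]) auto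
  then show ?thesis unfolding interval_partition_def
    using cnt disj Qi ival_in_unit by simp
qed

lemma cylinder_shift:
  assumes "x \<in> cylinder f s (m + n)" shows "(f ^^ m) x \<in> cylinder f (\<lambda>l. s (l + m)) n"
proof -
  have "(f ^^ l) ((f ^^ m) x) = (f ^^ (l + m)) x" for l by (simp add: funpow_add)
  then show ?thesis using assms iterate_unit[of x m] by (auto simp: cylinder_def)
qed

text \<open>
  The preimage under \<open>f\<^sup>n\<close> of the interval between the images of \<open>x\<close> and
  \<open>y\<close> contains the interval between \<open>x\<close> and \<open>y\<close>, since
  \<open>f\<^sup>n\<close> is monotone on the cylinder. So the distortion of Lebesgue measure bounds the
  contraction of distances.
\<close>
lemma expansion_on_cylinder:
  assumes pre: "\<And>E. E \<in> sets mI \<Longrightarrow> measure mI ((f ^^ n) -` E \<inter> {0..1}) \<le> c * measure mI E"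
    and s: "\<And>l. l < n \<Longrightarrow> s l \<in> P" and xy: "x \<in> cylinder f s n" "y \<in> cylinder f s n" and c: "1 \<le> c"
  shows "\<bar>x - y\<bar> \<le> c * \<bar>(f ^^ n) x - (f ^^ n) y\<bar>"
proof (cases n)
  case 0 then show ?thesis using mult_right_mono[OF c, of "\<bar>x - y\<bar>"] by simp
next
  case (Suc m)
  interpret prob_space mI by (rule prob_space_mI)
  let ?h = "f ^^ n"
  have pr: "is_interval (cylinder f s n)" "inj_on ?h (cylinder f s n)" "continuous_on (cylinder f s n) ?h"
  proof -
    note p = cylinder_props[of m s, folded Suc, OF s]
    show "is_interval (cylinder f s n)" "inj_on ?h (cylinder f s n)" using p by blast+
    show "continuous_on (cylinder f s n) ?h"
    proof (rule continuous_at_imp_continuous_on, rule ballI)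
      fix z assume "z \<in> cylinder f s n"
      then obtain d where "(?h has_field_derivative d) (at z)" using p by blast
      then show "isCont ?h z" by (rule DERIV_isCont)
    qed
  qed
  have le: "y - x \<le> c * \<bar>?h x - ?h y\<bar>" if x: "x \<in> cylinder f s n" and y: "y \<in> cylinder f s n" and "x < y" for x y
  proof -
    define E where "E = {min (?h x) (?h y)..max (?h x) (?h y)}"
    have xu: "x \<in> {0..1}" "y \<in> {0..1}" using x y unfolding cylinder_def by blast+
    note u = iterate_unit[OF xu(1), of n] iterate_unit[OF xu(2), of n] xu
    have "E \<subseteq> {0..1}" unfolding E_def using u by (intro atLeastatMost_subset_iff[THEN iffD2]) auto
    then have E: "E \<in> sets mI" by (simp add: E_def sets_mI)
    have sub: "{x..y} \<subseteq> cylinder f s n"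
    proof
      fix z assume "z \<in> {x..y}"
      then show "z \<in> cylinder f s n" by (intro mem_is_interval_1_I[OF pr(1) x y]) simp_all
    qed
    have hz: "?h z \<in> E" if "z \<in> {x..y}" for z
    proof (cases "z = x \<or> z = y")
      case False
      then have "(?h x < ?h z \<and> ?h z < ?h y) \<or> (?h y < ?h z \<and> ?h z < ?h x)"
        using that sub pr by (intro continuous_inj_imp_mono) (auto intro: continuous_on_subset inj_on_subset)
      then show ?thesis by (auto simp: E_def)
    qed (auto simp: E_def)
    have "y - x = measure mI {x..y}" using u \<open>x < y\<close> by (simp add: measure_def emeasure_mI)
    also have "\<dots> \<le> measure mI (?h -` E \<inter> {0..1})"
      using hz u measurable_sets[OF funpow_measurable[OF meas, of n] E]
      by (intro finite_measure_mono) (auto simp: sets_mI)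
    also have "\<dots> \<le> c * measure mI E" by (rule pre[OF E])
    also have "measure mI E = \<bar>?h x - ?h y\<bar>" using u by (simp add: measure_def E_def emeasure_mI)
    finally show ?thesis .
  qed
  show ?thesis
  proof (cases x y rule: linorder_cases)
    case less then show ?thesis using le[OF xy] by simp
  next
    case equal then show ?thesis by simp
  next
    case greater then show ?thesis using le[OF xy(2,1)] by (simp add: abs_minus_commute)
  qed
qed

text \<open>
  Each of the \<open>k\<close> steps adds the Lipschitz constant \<open>M\<close> of \<open>G\<close> times
  the current distance on the base, which is at most \<open>c\<close> times the final one; the distances
  produced by earlier steps do not grow because the fibers are contracted.
\<close>
lemma fiber_iterate_lipschitz:
  fixes G :: "real \<Rightarrow> 'k::metric_space \<Rightarrow> 'k"
  assumes pre: "\<And>E n. n \<le> k \<Longrightarrow> E \<in> sets mI \<Longrightarrow> measure mI ((f ^^ n) -` E \<inter> {0..1}) \<le> c * measure mI E"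
    and c: "1 \<le> c" and lip: "0 \<le> M" "lip_G P G \<le> ennreal M" and \<alpha>: "0 \<le> \<alpha>" "\<alpha> < 1"
    and s: "\<And>l. l < k \<Longrightarrow> s l \<in> P" and xy: "x \<in> cylinder f s k" "y \<in> cylinder f s k"
    and contr: "\<And>l z z'. l < k \<Longrightarrow> dist (G ((f ^^ l) y) z) (G ((f ^^ l) y) z') \<le> \<alpha> * dist z z'"
  shows "dist (fiber_iter f G k x z) (fiber_iter f G k y z) \<le> real k * M * c * \<bar>(f ^^ k) x - (f ^^ k) y\<bar>"
proof -
  define K where "K = M * (c * \<bar>(f ^^ k) x - (f ^^ k) y\<bar>)"
  have K: "0 \<le> K" using lip c by (simp add: K_def)
  have fs: "fst ((skew f G ^^ m) (x, z)) = (f ^^ m) x" for m x by (induction m) (auto simp: skew_def case_prod_unfold)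
  have step: "fiber_iter f G (Suc m) x z = G ((f ^^ m) x) (fiber_iter f G m x z)" for m x
    using fs[of m x] by (simp add: fiber_iter_def skew_def case_prod_unfold)
  have lipG: "dist (G u z) (G v z) \<le> M * \<bar>u - v\<bar>" if "i \<in> P" "u \<in> ival i" "v \<in> ival i" for i u v z
  proof (cases "u = v")
    case False
    have "ennreal (dist (G u z) (G v z) / dist u v) \<le> lip_G P G"
      unfolding lip_G_def
      by (rule SUP_upper2[OF that(1)], rule SUP_upper2[OF UNIV_I[of z]], rule SUP_upper2[of "(u, v)"])
        (use that False in auto)
    then have "ennreal (dist (G u z) (G v z) / dist u v) \<le> ennreal M" using lip(2) by (rule order_trans)
    then have "dist (G u z) (G v z) / dist u v \<le> M" using lip(1) by simp
    then show ?thesis using False by (simp add: pos_divide_le_eq dist_real_def)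
  qed simp
  have "m \<le> k \<Longrightarrow> dist (fiber_iter f G m x z) (fiber_iter f G m y z) \<le> real m * K" for m
  proof (induction m)
    case 0 then show ?case by (simp add: fiber_iter_def)
  next
    case (Suc m)
    then have m: "m < k" by simp
    obtain n where n: "k = m + n" using m less_imp_add_positive by blast
    have "\<bar>(f ^^ m) x - (f ^^ m) y\<bar> \<le> c * \<bar>(f ^^ n) ((f ^^ m) x) - (f ^^ n) ((f ^^ m) y)\<bar>"
    proof (rule expansion_on_cylinder[OF _ _ _ _ c])
      show "(f ^^ m) x \<in> cylinder f (\<lambda>l. s (l + m)) n" "(f ^^ m) y \<in> cylinder f (\<lambda>l. s (l + m)) n"
        using xy unfolding n by (auto intro: cylinder_shift)
    qed (use pre s n in auto)
    also have "\<dots> = c * \<bar>(f ^^ k) x - (f ^^ k) y\<bar>" by (simp add: n funpow_add add.commute[of m n])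
    finally have d: "M * \<bar>(f ^^ m) x - (f ^^ m) y\<bar> \<le> K" unfolding K_def by (rule mult_left_mono[OF _ lip(1)])
    have iv: "(f ^^ m) x \<in> ival (s m)" "(f ^^ m) y \<in> ival (s m)" using xy m by (auto simp: cylinder_def)
    have "dist (fiber_iter f G (Suc m) x z) (fiber_iter f G (Suc m) y z) \<le>
       dist (G ((f ^^ m) x) (fiber_iter f G m x z)) (G ((f ^^ m) y) (fiber_iter f G m x z)) +
       dist (G ((f ^^ m) y) (fiber_iter f G m x z)) (G ((f ^^ m) y) (fiber_iter f G m y z))"
      unfolding step by (rule dist_triangle)
    also have "\<dots> \<le> M * \<bar>(f ^^ m) x - (f ^^ m) y\<bar> + \<alpha> * dist (fiber_iter f G m x z) (fiber_iter f G m y z)"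
      by (intro add_mono lipG[OF s[OF m] iv] contr[OF m])
    also have "\<dots> \<le> K + 1 * (real m * K)"
      using Suc.IH m \<alpha> K by (intro add_mono d mult_mono) auto
    finally show ?case by (simp add: algebra_simps)
  qed
  from this[of k] show ?thesis by (simp add: K_def mult_ac)
qed

end

lemma finite_subfamily_almost_full:
  assumes P: "interval_partition P" and \<epsilon>: "0 < \<epsilon>"
  obtains P' where "finite P'" "P' \<subseteq> P" "measure mI ({0..1} - (\<Union>i\<in>P'. ival i)) < \<epsilon>"
proof -
  interpret prob_space mI by (rule prob_space_mI)
  have Pc: "countable P" "\<And>i. i \<in> P \<Longrightarrow> ival i \<subseteq> {0..1}"
    and e0: "emeasure lborel ({0..1} - (\<Union>i\<in>P. ival i)) = 0"
    using P by (auto simp: interval_partition_def ival_def dest!: bspec[of P])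
  have ne: "P \<noteq> {}" using e0 by auto
  define A where "A n = {0..1} - (\<Union>j\<in>{..<n}. ival (from_nat_into P j))" for n :: nat
  have As: "A n \<in> sets mI" for n by (auto simp: A_def sets_mI ival_def)
  have INT: "(\<Inter>n. A n) = {0..1} - (\<Union>i\<in>P. ival i)"
  proof -
    have "(\<Union>n. \<Union>j\<in>{..<n}. ival (from_nat_into P j)) = (\<Union>j. ival (from_nat_into P j))" by (auto intro: lessI)
    also have "\<dots> = (\<Union>i\<in>P. ival i)" using range_from_nat_into[OF ne Pc(1)] by (metis image_image)
    finally show ?thesis unfolding A_def by blast
  qed
  have "(\<lambda>n. measure mI (A n)) \<longlonglongrightarrow> measure mI (\<Inter>n. A n)"
    by (rule finite_Lim_measure_decseq) (use As in \<open>auto simp: decseq_def A_def\<close>)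
  moreover have "measure mI (\<Inter>n. A n) = 0" unfolding INT using e0 by (simp add: measure_def emeasure_mI)
  ultimately have "(\<lambda>n. measure mI (A n)) \<longlonglongrightarrow> 0" by simp
  then have "eventually (\<lambda>n. measure mI (A n) < \<epsilon>) sequentially" by (rule order_tendstoD(2)[OF _ \<epsilon>])
  then obtain n where n: "measure mI (A n) < \<epsilon>" by (auto simp: eventually_sequentially)
  show ?thesis
  proof (rule that[of "from_nat_into P ` {..<n}"])
    show "from_nat_into P ` {..<n} \<subseteq> P" using from_nat_into[OF ne] by (intro image_subsetI)
    show "measure mI ({0..1} - (\<Union>i\<in>from_nat_into P ` {..<n}. ival i)) < \<epsilon>"
      using n unfolding A_def by (simp only: image_image SUP_image comp_def)
  qed simp
qed

text \<open>
  Finitely many intervals \<open>P'\<close> miss so little mass that, by the bound on preimages, the orbit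
  segment of length \<open>k\<close> of at least half of the points stays in them. These points lie in at most
  \<open>(card P')\<^sup>k\<close> cylinders, so one of them is long. The choice of \<open>P'\<close> does not
  involve \<open>f\<close>, and neither does the length.
\<close>
lemma long_cylinder:
  assumes P: "interval_partition P" and k: "1 \<le> k" and c: "1 \<le> (c :: real)"
  obtains len0 where "0 < len0"
    "\<And>f. nonsingular_branched P f \<Longrightarrow>
       (\<And>E n. n \<le> k \<Longrightarrow> E \<in> sets mI \<Longrightarrow> measure mI ((f ^^ n) -` E \<inter> {0..1}) \<le> c * measure mI E) \<Longrightarrow>
       \<exists>i\<in>iter_partition f P k. len0 \<le> snd i - fst i"
proof -
  interpret prob_space mI by (rule prob_space_mI)
  have kc: "0 < real k * c" using k c by simp
  obtain P' where P': "finite P'" "P' \<subseteq> P" "measure mI ({0..1} - (\<Union>i\<in>P'. ival i)) < 1 / (2 * (real k * c))"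
    using finite_subfamily_almost_full[OF P, of "1 / (2 * (real k * c))"] kc by auto
  define S where "S = {xs. set xs \<subseteq> P' \<and> length xs = k}"
  have finS: "finite S" unfolding S_def by (rule finite_lists_length_eq[OF P'(1)])
  define N where "N = real (card S) + 1"
  have N: "0 < N" unfolding N_def by linarith
  \<comment> \<open>\<open>N\<close> exceeds the number of cylinders, so that \<open>card S\<close> cylinders shorter than \<open>len0\<close> cannot cover half of the interval\<close>
  define len0 where "len0 = 1 / (2 * N)"
  have l0: "0 < len0" using N by (simp add: len0_def)
  show ?thesis
  proof (rule that[OF l0])
    fix f assume "nonsingular_branched P f"
      and pre: "\<And>E n. n \<le> k \<Longrightarrow> E \<in> sets mI \<Longrightarrow> measure mI ((f ^^ n) -` E \<inter> {0..1}) \<le> c * measure mI E"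
    interpret nonsingular_branched P f by fact
    define X where "X = {0..1} - (\<Union>i\<in>P'. ival i)"
    have "(\<Union>i\<in>P'. ival i) \<in> sets borel" using P'(1) by (intro sets.finite_UN) (auto simp: ival_def)
    then have X: "X \<in> sets mI" by (auto simp: X_def sets_mI)
    define bad where "bad = (\<Union>j\<in>{..<k}. (f ^^ j) -` X \<inter> {0..1})"
    have fX: "(f ^^ j) -` X \<inter> {0..1} \<in> sets mI" for j
      using measurable_sets[OF funpow_measurable[OF meas, of j] X] by simp
    have "measure mI bad \<le> (\<Sum>j<k. measure mI ((f ^^ j) -` X \<inter> {0..1}))"
      unfolding bad_def using fX by (intro finite_measure_subadditive_finite) auto
    also have "\<dots> \<le> (\<Sum>j<k. c * measure mI X)" using pre X by (intro sum_mono) simp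
    also have "\<dots> = (real k * c) * measure mI X" by simp
    also have "\<dots> \<le> (real k * c) * (1 / (2 * (real k * c)))"
      using P'(3) kc by (intro mult_left_mono) (auto simp: X_def)
    also have "\<dots> = 1 / 2" using kc k c by simp
    finally have bad: "measure mI bad \<le> 1 / 2" .
    have badm: "bad \<in> sets mI" unfolding bad_def using fX by (intro sets.finite_UN) auto
    let ?C = "\<lambda>xs. cylinder f (\<lambda>l. xs ! l) k"
    have xsP: "xs ! l \<in> P" if "xs \<in> S" "l < k" for xs l
    proof -
      have "length xs = k" "set xs \<subseteq> P'" using that(1) by (auto simp: S_def)
      then show ?thesis using nth_mem[of l xs] that(2) P'(2) by blast
    qed
    obtain m where m: "k = Suc m" using k by (cases k) auto
    have Cm: "?C xs \<in> sets mI" if xs: "xs \<in> S" for xs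
    proof -
      have "open (?C xs)"
        using cylinder_props[of m "\<lambda>l. xs ! l", folded m, OF xsP[OF xs]] by blast
      moreover have "?C xs \<subseteq> {0..1}" by (auto simp: cylinder_def)
      ultimately show ?thesis by (simp add: sets_mI)
    qed
    have cover: "{0..1} - bad \<subseteq> (\<Union>xs\<in>S. ?C xs)"
    proof
      fix x assume x: "x \<in> {0..1} - bad"
      have "\<exists>i. i \<in> P' \<and> (f ^^ l) x \<in> ival i" if "l < k" for l
        using x that iterate_unit[of x l] unfolding bad_def X_def by blast
      then obtain s where s: "\<And>l. l < k \<Longrightarrow> s l \<in> P' \<and> (f ^^ l) x \<in> ival (s l)" by metis
      have "map s [0..<k] \<in> S" using s by (auto simp: S_def)
      moreover have "x \<in> ?C (map s [0..<k])" using s x by (auto simp: cylinder_def)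
      ultimately show "x \<in> (\<Union>xs\<in>S. ?C xs)" by blast
    qed
    have "1 / 2 \<le> 1 - measure mI bad" using bad by simp
    also have "\<dots> = measure mI ({0..1} - bad)" using prob_compl[OF badm] by simp
    also have "\<dots> \<le> measure mI (\<Union>xs\<in>S. ?C xs)"
      using cover Cm finS by (intro finite_measure_mono sets.finite_UN) auto
    also have "\<dots> \<le> (\<Sum>xs\<in>S. measure mI (?C xs))"
      using Cm finS by (intro finite_measure_subadditive_finite) auto
    finally have half: "1 / 2 \<le> (\<Sum>xs\<in>S. measure mI (?C xs))" .
    have "\<exists>xs\<in>S. len0 \<le> measure mI (?C xs)"
    proof (rule ccontr)
      assume "\<not> ?thesis"
      then have "(\<Sum>xs\<in>S. measure mI (?C xs)) \<le> (\<Sum>xs\<in>S. len0)" by (intro sum_mono) (auto simp: not_le less_imp_le)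
      also have "\<dots> = real (card S) * len0" by simp
      also have "\<dots> < N * len0" using l0 by (simp add: N_def algebra_simps)
      also have "\<dots> = 1 / 2" using N by (simp add: len0_def)
      finally show False using half by simp
    qed
    then obtain xs where xs: "xs \<in> S" "len0 \<le> measure mI (?C xs)" by blast
    then have "?C xs \<noteq> {}" using l0 by auto
    then obtain i where i: "i \<in> iter_partition f P k" "ival i = ?C xs"
      using cylinder_ival[OF k, of "\<lambda>l. xs ! l"] xsP[OF xs(1)] by metis
    have "fst i < snd i" "ival i \<subseteq> {0..1}" using i by (auto simp: iter_partition_cylinder cylinder_def)
    then have "measure mI (ival i) = snd i - fst i"
      by (simp add: measure_def emeasure_mI) (simp add: ival_def)
    then show "\<exists>i\<in>iter_partition f P k. len0 \<le> snd i - fst i" using xs(2) i by auto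
  qed
qed

section \<open>Uniform bounds for the perturbation\<close>

lemma skew_funpow: "skew (f ^^ k) (fiber_iter f G k) = skew f G ^^ k"
proof
  fix z :: "real \<times> 'a"
  have "skew (f ^^ k) (fiber_iter f G k) z = ((f ^^ k) (fst z), snd ((skew f G ^^ k) z))"
    unfolding fiber_iter_def by (subst skew_def) (simp add: case_prod_unfold)
  then show "skew (f ^^ k) (fiber_iter f G k) z = (skew f G ^^ k) z"
    by (simp add: prod_eq_iff skew_iterate)
qed

lemma skew_product_iterate:
  fixes G :: "real \<Rightarrow> 'k \<Rightarrow> 'k::{metric_space, second_countable_topology}"
  assumes "skew_product f G" shows "skew_product (f ^^ k) (fiber_iter f G k)"
proof -
  have m: "skew f G ^^ k \<in> measurable SigmaM SigmaM"
    by (rule funpow_measurable[OF skew_measurable[OF assms]])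
  have "(\<lambda>(x, y). fiber_iter f G k x y) = (\<lambda>z. snd ((skew f G ^^ k) z))"
    by (auto simp: fiber_iter_def)
  then show ?thesis unfolding skew_product_def
    using measurable_comp[OF m snd_SigmaM] funpow_measurable[of f mI k] assms
    by (auto simp: comp_def skew_product_def)
qed

lemma invariant_iterate:
  fixes G :: "real \<Rightarrow> 'k \<Rightarrow> 'k::{metric_space, second_countable_topology}"
  assumes "skew_product f G" "invariant_probability f G \<mu>"
  shows "invariant_probability (f ^^ k) (fiber_iter f G k) \<mu>"
  using assms(2) distr_funpow[OF skew_measurable[OF assms(1)], of \<mu> k]
  by (simp add: invariant_probability_def skew_funpow)

lemma invariant_density:
  fixes G :: "real \<Rightarrow> 'k \<Rightarrow> 'k::{metric_space, second_countable_topology}"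
  assumes sk: "skew_product f G" and inv: "invariant_probability f G \<mu>" and S1: "of_positive \<mu> \<in> S1"
  shows "transfers f (phi1 (of_positive \<mu>)) (phi1 (of_positive \<mu>))" "L1_norm (phi1 (of_positive \<mu>)) = 1"
proof -
  have \<mu>: "prob_space \<mu>" "sets \<mu> = sets SigmaM" "distr \<mu> SigmaM (skew f G) = \<mu>"
    using inv by (auto simp: invariant_probability_def)
  interpret \<mu>: prob_space \<mu> by (rule \<mu>(1))
  obtain J \<kappa> \<phi> \<kappa>n \<phi>n where d: "disintegrates \<mu> J \<kappa> \<phi>"
    and "disintegrates (null_measure \<mu>) J \<kappa>n \<phi>n" and nn: "\<And>x. 0 \<le> \<phi> x"
    and "AE x in mI. x \<in> J" and \<phi>1: "AE x in mI. phi1 (of_positive \<mu>) x = \<phi> x"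
    by (rule S1_disintegration[OF S1 \<mu>(2)], rule that, assumption+)
  have \<phi>m [measurable]: "\<phi> \<in> borel_measurable mI" and den: "density mI (\<lambda>x. ennreal (\<phi> x)) = distr \<mu> mI fst"
    using d by (auto simp: disintegrates_def)
  have fst: "fst \<in> measurable \<mu> mI" using fst_SigmaM \<mu>(2) by (simp cong: measurable_cong_sets)
  have fm: "f \<in> measurable mI mI" using sk by (simp add: skew_product_def)
  have smu: "skew f G \<in> measurable \<mu> SigmaM" using skew_measurable[OF sk] \<mu>(2) by (simp cong: measurable_cong_sets)
  have one: "(\<integral>\<^sup>+x. ennreal (\<phi> x) \<partial>mI) = 1"
    using nn_integral_base[OF den \<phi>m \<mu>(2), of "\<lambda>_. 1"] \<mu>.emeasure_space_1 by simp
  have int: "integrable mI \<phi>" by (rule integrableI_nonneg) (auto simp: one nn)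
  have i1: "integrable mI (phi1 (of_positive \<mu>))" using S1 by (simp add: S1_def BV_def)
  have "L1_norm (phi1 (of_positive \<mu>)) = (\<integral>\<^sup>+x. ennreal (\<phi> x) \<partial>mI)"
    unfolding L1_norm_def by (rule nn_integral_cong_AE) (use \<phi>1 nn in \<open>auto elim: eventually_mono\<close>)
  then show "L1_norm (phi1 (of_positive \<mu>)) = 1" by (simp add: one)
  have inv1: "distr (distr \<mu> mI fst) mI f = distr \<mu> mI fst"
  proof -
    have "distr (distr \<mu> mI fst) mI f = distr \<mu> mI (\<lambda>z. fst (skew f G z))"
      using distr_distr[OF fm fst] by (simp add: comp_def skew_def case_prod_unfold)
    also have "\<dots> = distr (distr \<mu> SigmaM (skew f G)) mI fst"
      using distr_distr[OF fst_SigmaM smu] by (simp add: comp_def)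
    finally show ?thesis by (simp add: \<mu>(3))
  qed
  have base: "(\<integral>x. u x * \<phi> x \<partial>mI) = (\<integral>x. u x \<partial>distr \<mu> mI fst)" if "u \<in> borel_measurable mI" for u :: "real \<Rightarrow> real"
    unfolding den[symmetric] using that nn by (subst integral_density) (auto simp: mult.commute)
  have "transfers f \<phi> \<phi>"
    unfolding transfers_def
  proof (intro conjI int ballI impI)
    fix u :: "real \<Rightarrow> real" assume u: "u \<in> borel_measurable mI"
    have uf: "(\<lambda>x. u (f x)) \<in> borel_measurable mI" using u fm by measurable
    have "(\<integral>x. u x * \<phi> x \<partial>mI) = (\<integral>x. u x \<partial>distr (distr \<mu> mI fst) mI f)" by (simp add: base[OF u] inv1)
    also have "\<dots> = (\<integral>x. u (f x) \<partial>distr \<mu> mI fst)" using fm u by (subst integral_distr) (auto cong: measurable_cong_sets)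
    also have "\<dots> = (\<integral>x. u (f x) * \<phi> x \<partial>mI)" by (rule base[OF uf, symmetric])
    finally show "(\<integral>x. u x * \<phi> x \<partial>mI) = (\<integral>x. u (f x) * \<phi> x \<partial>mI)" .
  qed
  then have t: "transfers f (phi1 (of_positive \<mu>)) \<phi>"
    using \<phi>1 i1 int fm by (intro transfers_cong_AE[of \<phi> "phi1 (of_positive \<mu>)"]) (auto elim: eventually_mono)
  show "transfers f (phi1 (of_positive \<mu>)) (phi1 (of_positive \<mu>))"
    unfolding transfers_def
  proof (intro conjI i1 ballI impI)
    fix u :: "real \<Rightarrow> real" assume u: "u \<in> borel_measurable mI" "\<exists>C. \<forall>x\<in>{0..1}. \<bar>u x\<bar> \<le> C"
    then obtain C where C: "\<And>x. x \<in> {0..1} \<Longrightarrow> \<bar>u x\<bar> \<le> C" by blast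
    have "(\<integral>x. u x * phi1 (of_positive \<mu>) x \<partial>mI) = (\<integral>x. u x * \<phi> x \<partial>mI)"
      using \<phi>1 u(1) i1 by (intro integral_cong_AE) (auto elim: eventually_mono)
    then show "(\<integral>x. u x * phi1 (of_positive \<mu>) x \<partial>mI) = (\<integral>x. u (f x) * phi1 (of_positive \<mu>) x \<partial>mI)"
      using transfers_integral[OF t u(1) C] by simp
  qed
qed

text \<open>
  The weight vanishes at \<open>0\<close>, which lies in no open interval of the partition.
\<close>
lemma inv_deriv_le_variation:
  assumes Q: "interval_partition Q" and U: "variation_on {0..1} (inv_deriv Q \<tau>) \<le> ennreal U" "0 \<le> U"
    and x: "x \<in> {0..1}"
  shows "inv_deriv Q \<tau> x \<le> U"
proof (cases "x = 0")
  have "0 \<notin> (\<Union>i\<in>Q. ival i)" using Q by (auto simp: interval_partition_def ival_def not_less)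
  then have z: "inv_deriv Q \<tau> 0 = 0" by (simp add: inv_deriv_def)
  {
    case True then show ?thesis using z U by simp
  next
    case False
    have "ennreal \<bar>inv_deriv Q \<tau> 0 - inv_deriv Q \<tau> x\<bar> \<le> ennreal U"
      using pair_le_variation[of 0 "{0..1}" x "\<lambda>u v. ennreal \<bar>u - v\<bar>" "inv_deriv Q \<tau>"] U(1) x False
      by (auto simp: variation_on_def)
    then show ?thesis using z U(2) by simp
  }
qed

theorem theoremA:
  fixes P :: "(real \<times> real) set"
    and f :: "real \<Rightarrow> real \<Rightarrow> real"
    and G :: "real \<Rightarrow> real \<Rightarrow> 'k \<Rightarrow> 'k :: {metric_space, second_countable_topology}"
    and \<delta>\<^sub>0 :: real
    and \<mu> :: "real \<Rightarrow> (real \<times> 'k) measure"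
  assumes compact_K: "compact (UNIV :: 'k set)"
    and diam_K: "diameter (UNIV :: 'k set) = 1"
    and partition: "interval_partition P"
    and system: "\<And>\<delta>. \<delta> \<in> {0..<1} \<Longrightarrow> skew_product (f \<delta>) (G \<delta>)"
    and perturbation: "R_perturbation P f G \<delta>\<^sub>0"
    and admissible: "admissible P f G \<delta>\<^sub>0"
    and invariant: "\<And>\<delta>. \<delta> \<in> {0..<\<delta>\<^sub>0} \<Longrightarrow> invariant_probability (f \<delta>) (G \<delta>) (\<mu> \<delta>)"
    and in_S1: "\<And>\<delta>. \<delta> \<in> {0..<\<delta>\<^sub>0} \<Longrightarrow> of_positive (\<mu> \<delta>) \<in> S1"
  shows "\<exists>B\<^sub>u :: real. 0 < B\<^sub>u \<and>
           (\<forall>\<delta>\<in>{0..<\<delta>\<^sub>0}. measure_variation (of_positive (\<mu> \<delta>)) \<le> ennreal B\<^sub>u)"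
proof -
  have diam: "dist z z' \<le> 1" for z z' :: 'k
    using diameter_bounded_bound[of "UNIV :: 'k set" z z'] compact_imp_bounded[OF compact_K] diam_K by simp
  have \<delta>0: "0 < \<delta>\<^sub>0" "\<delta>\<^sub>0 < 1"
    and pre: "\<And>\<delta>. \<delta> \<in> {0..<\<delta>\<^sub>0} \<Longrightarrow> pre_piecewise_convex_or_expanding P (f \<delta>)"
    using perturbation unfolding R_perturbation_def by blast+
  have sk: "skew_product (f \<delta>) (G \<delta>)" if "\<delta> \<in> {0..<\<delta>\<^sub>0}" for \<delta>
    using system[of \<delta>] that \<delta>0 by simp
  have br: "nonsingular_branched P (f \<delta>)" if "\<delta> \<in> {0..<\<delta>\<^sub>0}" for \<delta>
    using pre[OF that] sk[OF that] partition
    by (simp add: nonsingular_branched_def nonsingular_branched_axioms_def branched_def pre_piecewise_convex_or_expanding_def skew_product_def)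
  obtain D q where D: "0 < D" "0 < q" "q < 1"
    and LY: "\<And>h \<delta> n. h \<in> BV \<Longrightarrow> \<delta> \<in> {0..<\<delta>\<^sub>0} \<Longrightarrow> 1 \<le> n \<Longrightarrow>
       BV_norm ((PF (f \<delta>) ^^ n) h) \<le> ennreal (D * q ^ n) * BV_norm h + ennreal D * L1_norm h"
    using admissible unfolding admissible_def by blast
  obtain k \<alpha> where H: "\<And>\<delta>. \<delta> \<in> {0..<\<delta>\<^sub>0} \<Longrightarrow> H1 (\<alpha> \<delta>) (G \<delta>)" "\<And>\<delta>. \<delta> \<in> {0..<\<delta>\<^sub>0} \<Longrightarrow> H2 P (G \<delta>)"
      "\<And>\<delta>. \<delta> \<in> {0..<\<delta>\<^sub>0} \<Longrightarrow> H3 P (f \<delta>) (G \<delta>) (\<alpha> \<delta>) k"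
    and A4: "(SUP \<delta>\<in>{0..<\<delta>\<^sub>0}. alpha4 P (f \<delta>) k (\<alpha> \<delta>)) < 1"
    and U4: "(SUP \<delta>\<in>{0..<\<delta>\<^sub>0}. U4 P (f \<delta>) (G \<delta>) k) < \<infinity>"
    using admissible unfolding admissible_def by blast
  have k: "1 \<le> k" using H(3)[of 0] \<delta>0 by (simp add: H3_def)
  obtain A where A: "(SUP \<delta>\<in>{0..<\<delta>\<^sub>0}. alpha4 P (f \<delta>) k (\<alpha> \<delta>)) = ennreal A" "0 \<le> A" "A < 1"
    using A4 by (cases "SUP \<delta>\<in>{0..<\<delta>\<^sub>0}. alpha4 P (f \<delta>) k (\<alpha> \<delta>)") (auto simp: ennreal_less_iff)
  obtain U where U: "(SUP \<delta>\<in>{0..<\<delta>\<^sub>0}. U4 P (f \<delta>) (G \<delta>) k) = ennreal U" "0 \<le> U"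
    using U4 by (cases "SUP \<delta>\<in>{0..<\<delta>\<^sub>0}. U4 P (f \<delta>) (G \<delta>) k") auto
  have A_le: "alpha4 P (f \<delta>) k (\<alpha> \<delta>) \<le> ennreal A" and U_le: "U4 P (f \<delta>) (G \<delta>) k \<le> ennreal U"
    if "\<delta> \<in> {0..<\<delta>\<^sub>0}" for \<delta>
    unfolding A(1)[symmetric] U(1)[symmetric] by (rule SUP_upper[OF that])+
  \<comment> \<open>a strict bound for the \<open>BV\<close>-norms of all iterates of the constant \<open>1\<close>, and at least \<open>1\<close> to cover \<open>n = 0\<close>\<close>
  define c where "c = max 1 (2 * D + 1)"
  have c: "1 \<le> c" by (simp add: c_def)
  have preimage: "measure mI ((f \<delta> ^^ n) -` E \<inter> {0..1}) \<le> c * measure mI E"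
    if \<delta>: "\<delta> \<in> {0..<\<delta>\<^sub>0}" and E: "E \<in> sets mI" for \<delta> n E
  proof (cases "n = 0")
    case True
    have "E \<inter> {0..1} = E" using E by (auto simp: sets_mI)
    then show ?thesis using True mult_right_mono[OF c, of "measure mI E"] by simp
  next
    case False
    have "BV_norm ((PF (f \<delta>) ^^ n) (\<lambda>_. 1)) \<le> ennreal (D * q ^ n) * 1 + ennreal D * 1"
      using LY[OF one_BV(1) \<delta>, of n] False by (simp add: one_BV)
    also have "\<dots> = ennreal (D * q ^ n + D)" using D by (simp add: ennreal_plus)
    also have "\<dots> < ennreal c"
    proof (rule ennreal_lessI)
      have "D * q ^ n \<le> D * 1" using D by (intro mult_left_mono power_le_one) auto
      then show "D * q ^ n + D < c" by (simp add: c_def)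
      show "0 < c" using c by simp
    qed
    finally show ?thesis
      using br[OF \<delta>] by (intro measure_preimage_le E) (auto simp: nonsingular_branched_def nonsingular_branched_axioms_def branched_def)
  qed
  obtain len0 where len0: "0 < len0"
    and long: "\<And>\<delta>. \<delta> \<in> {0..<\<delta>\<^sub>0} \<Longrightarrow> \<exists>i\<in>iter_partition (f \<delta>) P k. len0 \<le> snd i - fst i"
    using long_cylinder[OF partition k c] br preimage by metis
  \<comment> \<open>the bound for \<open>lip_G P (G \<delta>)\<close>: its product with the essential supremum of the weight is at most \<open>U\<close>\<close>
  define M where "M = U / len0"
  have M: "0 \<le> M" using U(2) len0 by (simp add: M_def)
  define L where "L = real k * M * c"
  have L: "0 \<le> L" using M c by (simp add: L_def)
  define C where "C = D + 1"
  have C: "0 \<le> C" using D by (simp add: C_def)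
  define B where "B = C + (C * U + U * C + C * L) / (1 - A)"
  have "measure_variation (of_positive (\<mu> \<delta>)) \<le> ennreal B" if \<delta>: "\<delta> \<in> {0..<\<delta>\<^sub>0}" for \<delta>
  proof -
    let ?f = "f \<delta>" and ?G = "G \<delta>" and ?\<tau> = "f \<delta> ^^ k" and ?H = "fiber_iter (f \<delta>) (G \<delta>) k"
    let ?Q = "iter_partition ?f P k"
    interpret b: nonsingular_branched P ?f by (rule br[OF \<delta>])
    have Q: "interval_partition ?Q" "regular_branches ?Q ?\<tau>"
      using b.iterate_partition[OF k] b.regular_iterate[OF k] by auto
    have fm: "?f \<in> measurable mI mI" by (rule b.meas)
    interpret q: branched ?Q ?\<tau> using Q funpow_measurable[OF fm] by unfold_locales
    have gq: "q.g = inv_deriv ?Q ?\<tau>" by (simp add: q.g_def)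
    have gi: "iter_inv_deriv P ?f k = inv_deriv ?Q ?\<tau>" by (simp add: iter_inv_deriv_def)
    have var: "variation_on {0..1} (inv_deriv ?Q ?\<tau>) \<le> ennreal U"
      using U_le[OF \<delta>] by (auto simp: U4_def gi intro: order_trans[rotated])
    have gU: "inv_deriv ?Q ?\<tau> x \<le> U" if "x \<in> {0..1}" for x
      by (rule inv_deriv_le_variation[OF Q(1) var U(2) that])
    define S where "S = esssup mI (\<lambda>x. ennreal (inv_deriv ?Q ?\<tau> x))"
    have gm: "(\<lambda>x. ennreal (inv_deriv ?Q ?\<tau> x)) \<in> borel_measurable mI"
      using q.g_measurable by (simp add: gq)
    have SU: "S \<le> ennreal U"
      unfolding S_def by (rule esssup_I[OF gm]) (use gU in \<open>auto intro!: AE_I2 ennreal_leI\<close>)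
    then obtain s where s: "S = ennreal s" "0 \<le> s" by (cases S) (auto simp: top_unique)
    have sU: "s \<le> U" using SU s U(2) by simp
    have gs: "AE x in mI. inv_deriv ?Q ?\<tau> x \<le> s"
      using esssup_AE[of "\<lambda>x. ennreal (inv_deriv ?Q ?\<tau> x)" mI]
    proof eventually_elim
      fix x assume "ennreal (inv_deriv ?Q ?\<tau> x) \<le> esssup mI (\<lambda>x. ennreal (inv_deriv ?Q ?\<tau> x))"
      then show "inv_deriv ?Q ?\<tau> x \<le> s" using s by (simp add: S_def)
    qed
    \<comment> \<open>the essential supremum of the weight is not small, since a long cylinder cannot be expanded much\<close>
    have len_s: "len0 \<le> s"
    proof -
      obtain i where "i \<in> ?Q" "len0 \<le> snd i - fst i" using long[OF \<delta>] by blast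
      then show ?thesis using q.length_le_esssup[of i s] gs by (simp add: gq)
    qed
    have lip: "lip_G P ?G \<le> ennreal M"
    proof -
      obtain l where l: "lip_G P ?G = ennreal l" "0 \<le> l"
        using H(2)[OF \<delta>] by (cases "lip_G P ?G") (auto simp: H2_def)
      have "lip_G P ?G * S \<le> ennreal U" using U_le[OF \<delta>] by (auto simp: U4_def gi S_def intro: order_trans[rotated])
      then have "ennreal (l * s) \<le> ennreal U" using l s by (simp add: ennreal_mult)
      then have "l * s \<le> U" using U(2) by simp
      moreover have "l * len0 \<le> l * s" by (rule mult_left_mono[OF len_s l(2)])
      ultimately have "l \<le> M" using len0 by (simp add: M_def pos_le_divide_eq)
      then show ?thesis using l by (simp add: ennreal_leI)
    qed
    have h3: "H1 (\<alpha> \<delta> ^ k) ?H" using H(3)[OF \<delta>] by (simp add: H3_def)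
    have as: "\<alpha> \<delta> ^ k * s \<le> A"
    proof -
      have "0 \<le> \<alpha> \<delta> ^ k" using h3 by (simp add: H1_def)
      then have "ennreal (\<alpha> \<delta> ^ k * s) = alpha4 P ?f k (\<alpha> \<delta>)"
        using s by (simp add: alpha4_def gi S_def[symmetric] ennreal_mult)
      then have "ennreal (\<alpha> \<delta> ^ k * s) \<le> ennreal A" using A_le[OF \<delta>] by (simp only:)
      then show ?thesis by (subst (asm) ennreal_le_iff[OF A(2)])
    qed
    define Rl where "Rl x \<longleftrightarrow> (\<forall>l. \<forall>z z'. dist (?G ((?f ^^ l) x) z) (?G ((?f ^^ l) x) z') \<le> \<alpha> \<delta> * dist z z')" for x
    have h1: "0 \<le> \<alpha> \<delta>" "\<alpha> \<delta> < 1" "AE x in mI. \<forall>z z'. dist (?G x z) (?G x z') \<le> \<alpha> \<delta> * dist z z'"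
      using H(1)[OF \<delta>] by (auto simp: H1_def)
    have Rl: "AE x in mI. Rl x"
      unfolding Rl_def AE_all_countable using AE_nonsingular[OF b.meas b.nons h1(3)] by blast
    have HL: "dist (?H x z) (?H x' z) \<le> L * \<bar>?\<tau> x - ?\<tau> x'\<bar>"
      if i: "i \<in> ?Q" and x: "x \<in> ival i" "x' \<in> ival i" and R: "Rl x'" for i x x' z
    proof -
      obtain s where s: "\<And>l. l < k \<Longrightarrow> s l \<in> P" "ival i = cylinder ?f s k"
        using i unfolding iter_partition_cylinder by blast
      show ?thesis unfolding L_def
        by (rule b.fiber_iterate_lipschitz[OF preimage[OF \<delta>] c M lip h1(1,2) s(1)])
          (use x s(2) R in \<open>auto simp: Rl_def\<close>)
    qed
    have BVn: "BV_norm (phi1 (of_positive (\<mu> \<delta>))) < ennreal C"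
    proof -
      note dens = invariant_density[OF sk[OF \<delta>] invariant[OF \<delta>] in_S1[OF \<delta>]]
      have bv: "phi1 (of_positive (\<mu> \<delta>)) \<in> BV" using in_S1[OF \<delta>] by (simp add: S1_def)
      have "BV_norm (phi1 (of_positive (\<mu> \<delta>))) \<le> ennreal D * L1_norm (phi1 (of_positive (\<mu> \<delta>)))"
        by (rule BV_norm_fixed_le[OF fm dens(1) bv D LY[OF bv \<delta>]])
      also have "\<dots> < ennreal C" using D by (simp add: dens(2) C_def ennreal_lessI)
      finally show ?thesis .
    qed
    have "measure_variation (of_positive (\<mu> \<delta>)) \<le> ennreal (C + (C * U + s * C + C * L) / (1 - A))"
    proof (rule measure_variation_invariant_le[OF compact_K diam Q skew_product_iterate[OF sk[OF \<delta>]]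
          invariant_iterate[OF sk[OF \<delta>] invariant[OF \<delta>]] in_S1[OF \<delta>] _ _ _ s(2) gs as A(3) U(2) var L Rl HL C BVn])
      show "0 \<le> \<alpha> \<delta> ^ k" "\<alpha> \<delta> ^ k < 1" "AE x in mI. \<forall>z z'. dist (?H x z) (?H x z') \<le> \<alpha> \<delta> ^ k * dist z z'"
        using h3 by (auto simp: H1_def)
    qed
    also have "\<dots> \<le> ennreal B"
      unfolding B_def using sU C A(3) L by (intro ennreal_leI add_left_mono divide_right_mono add_mono mult_right_mono) auto
    finally show ?thesis .
  qed
  moreover have "0 < B"
  proof -
    have "0 \<le> (C * U + U * C + C * L) / (1 - A)" using C U(2) L A(3) by simp
    then show ?thesis using D by (simp add: B_def C_def)
  qed
  ultimately show ?thesis by blast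
qed

end
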